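(* Let $\gamma\in[0,1)$ and let $K:(0,\infty)\times(0,\infty)\to[0,\infty)$ be a continuous function such that $K(x,y)=K(y,x)\ge 0$, $K(ax,ay)=a^{\gamma}K(x,y)$ for all $a,x,y>0$, and, for some constant $C>0$, $K(x,y)\le C(x^{\gamma}+y^{\gamma})$ for all $x,y>0$. Then for every $\rho\in(\gamma,1)$, with $\beta=1/(\rho-\gamma)$, there exists a weak stationary solution $h$ of $$\partial_t h+\partial_x\Big[\int_0^x\int_{x-y}^\infty \frac{K(y,z)}{z}h(z)h(y)\,dz\,dy\Big]-\beta\big[\partial_x(xh)+(\rho-1)h\big]=0 ,\qquad x>0,$$ which is nonnegative, continuous on $(0,\infty)$, and satisfies $$h(x)\sim(1-\rho)x^{-\rho}\quad\text{as }x\to\infty,\qquad\text{i.e. } \lim_{x\to\infty}\frac{h(x)}{(1-\rho)x^{-\rho}}=1 .$$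
   Context: Weak stationary solution: $h$ is nonnegative and locally integrable on $[0,\infty)$, the function $I[h](x)=\int_0^x\int_{x-y}^\infty\frac{K(y,z)}{z}h(z)h(y)\,dz\,dy$ belongs to $L^1_{loc}([0,\infty))$, and for every $\psi\in C^1_0([0,\infty))$ (that is, $\psi$ is $C^1$ on $[0,\infty)$ with compact support in $[0,\infty)$; $\psi(0)$ need not vanish) $$\int_0^\infty \psi'(x)\,I[h](x)\,dx-\beta\int_0^\infty (x\psi(x))'\,h(x)\,dx+\beta\rho\int_0^\infty\psi(x)h(x)\,dx=0 .$$ *)

theory Defs
  imports "HOL-Analysis.Analysis"
begin

text \<open>
  Functions on $[0,\infty)$ or $(0,\infty)$ are total functions on the reals;
  nothing below looks at values outside the intended domain.
\<close>

definition locally_integrable_on :: "real set \<Rightarrow> (real \<Rightarrow> real) \<Rightarrow> bool" where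
  "locally_integrable_on S f \<longleftrightarrow>
     (\<forall>A. compact A \<and> A \<subseteq> S \<longrightarrow> f absolutely_integrable_on A)"

text \<open>The derivative on $[0,\infty)$, one-sided at the origin.\<close>

definition deriv0 :: "(real \<Rightarrow> real) \<Rightarrow> real \<Rightarrow> real" where
  "deriv0 f x = vector_derivative f (at x within {0..})"

text \<open>
  The class $C^1_0([0,\infty))$. The support is taken relative to $[0,\infty)$, so a
  test function need not vanish at the origin.
\<close>

definition C1_compact_support :: "(real \<Rightarrow> real) \<Rightarrow> bool" where
  "C1_compact_support \<psi> \<longleftrightarrow>
     \<psi> differentiable_on {0..} \<and> continuous_on {0..} (deriv0 \<psi>) \<and>
     compact (closure (support_on {0..} \<psi>))"

text \<open>
  For nonnegative \<open>K\<close> and \<open>h\<close> the integrand of $I[h]$ is nonnegative. The integral is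
  taken with values in $[0,\infty]$, since the real-valued Lebesgue integral is \<open>0\<close> by
  convention when it diverges.
\<close>

definition flux :: "(real \<Rightarrow> real \<Rightarrow> real) \<Rightarrow> (real \<Rightarrow> real) \<Rightarrow> real \<Rightarrow> ennreal" where
  "flux K h x =
     (\<integral>\<^sup>+ y\<in>{0<..<x}. (\<integral>\<^sup>+ z\<in>{x - y<..}. ennreal (K y z / z * h z * h y) \<partial>lebesgue) \<partial>lebesgue)"

text \<open>
  That $I[h]$ is in $L^1_{loc}([0,\infty))$ includes that it is finite almost everywhere;
  \<open>enn2real\<close> maps infinity to \<open>0\<close>, so this is required separately.
\<close>

definition weak_stationary_solution ::
    "(real \<Rightarrow> real \<Rightarrow> real) \<Rightarrow> real \<Rightarrow> real \<Rightarrow> (real \<Rightarrow> real) \<Rightarrow> bool" where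
  "weak_stationary_solution K \<beta> \<rho> h \<longleftrightarrow>
     (\<forall>x\<ge>0. h x \<ge> 0) \<and>
     locally_integrable_on {0..} h \<and>
     (AE x in lebesgue. x \<ge> 0 \<longrightarrow> flux K h x < \<infinity>) \<and>
     locally_integrable_on {0..} (\<lambda>x. enn2real (flux K h x)) \<and>
     (\<forall>\<psi>. C1_compact_support \<psi> \<longrightarrow>
        (LINT x:{0..}|lebesgue. deriv0 \<psi> x * enn2real (flux K h x))
        - \<beta> * (LINT x:{0..}|lebesgue. deriv0 (\<lambda>t. t * \<psi> t) x * h x)
        + \<beta> * \<rho> * (LINT x:{0..}|lebesgue. \<psi> x * h x) = 0)"

end

theory Submission
  imports Defs "HOL-Complex_Analysis.Great_Picard"
begin

text \<open>
  With \<open>H x\<close> the integral of \<open>h\<close> over \<open>[0, x]\<close> and \<open>J = I[h]\<close>, the equation integrates to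
  \<open>x h = (1 - \<rho>) H + (\<rho> - \<gamma>) J\<close>, that is, \<open>(H x powr (\<rho> - 1))' = (\<rho> - \<gamma>) J x powr (\<rho> - 2)\<close>.
  Hence \<open>H x powr (\<rho> - 1)\<close> increases, and the normalisation \<open>1\<close> at infinity gives
  \<open>H x \<le> x powr (1 - \<rho>)\<close>, from which all other bounds follow.

  If the density of the partner \<open>z\<close> in \<open>J\<close> is frozen, the equation becomes a linear Volterra equation
  with nonnegative kernel, so that its solution is automatically nonnegative. On the lattice
  \<open>{1/n, 2/n, \<dots>, n}\<close> it is a finite recursion, and Brouwer's theorem provides a fixed point of the
  normalised solution map. Partners \<open>z < \<eta>\<close> contribute at most \<open>\<eta> powr (1 - \<rho>)\<close> times the local
  supremum of the density, which yields a density bound uniform in \<open>n\<close>, then equicontinuity of \<open>H\<close>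
  and \<open>J\<close>, and \<open>J = O(x powr (1 - \<rho> - (\<rho> - \<gamma>)))\<close> at infinity. Since the density is a
  continuous function of \<open>H\<close> and \<open>J\<close>, the lattice densities converge pointwise, and the flux passes to the limit.
\<close>

section \<open>Fixed points and limit theorems\<close>

text \<open>In the flux, \<open>y\<close> runs only below \<open>x\<close> and enters causally,
  whereas the partner \<open>z\<close> runs up to infinity; this nonlocality is why the partner is
  the factor to be frozen. The condition at infinity can only be imposed at the last lattice point
  \<open>n\<close>, which escapes. It survives in the limit because the flux is smaller than
  \<open>x powr (1 - \<rho>)\<close> by the factor \<open>x powr - (\<rho> - \<gamma>)\<close>, so
  that its contributions to \<open>H x powr (\<rho> - 1)\<close> are summable uniformly in
  \<open>n\<close>. The factor \<open>1 / z\<close> is singular at \<open>0\<close>, but a small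
  \<open>z\<close> lifts only those \<open>y\<close> over \<open>x\<close> that lie in an interval
  of length \<open>z\<close>. The price is a local supremum of the density, hence a density bound
  that closes only if the near part is absorbed with a small factor. Near \<open>x = 0\<close> this
  forces a threshold between near and far partners that shrinks faster than \<open>x\<close>: the
  origin of the additional negative power in \<open>weight\<close>. The recursion uses the exact
  ratio \<open>(x (k+1) / x k) powr (1 - \<rho>)\<close> and not its linearisation, so that the
  monotonicity of \<open>H x powr (\<rho> - 1)\<close> holds on the lattice without error.\<close>

lemma brouwer_nat_cube:
  fixes f :: "(nat \<Rightarrow> real) \<Rightarrow> nat \<Rightarrow> real" and n :: nat
  assumes maps: "\<And>x i. (\<And>j. 0 \<le> x j \<and> x j \<le> 1) \<Longrightarrow> 0 \<le> f x i \<and> f x i \<le> 1"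
    and cont: "\<And>X x i. (\<And>m j. 0 \<le> X m j \<and> X m j \<le> 1) \<Longrightarrow> (\<And>j. (\<lambda>m. X m j) \<longlonglongrightarrow> x j) \<Longrightarrow> i < n
                 \<Longrightarrow> (\<lambda>m. f (X m) i) \<longlonglongrightarrow> f x i"
  obtains x where "\<And>j. 0 \<le> x j \<and> x j \<le> 1" "\<And>i. i < n \<Longrightarrow> f x i = x i"
proof -
  \<comment> \<open>The dimension \<open>n\<close> is a term, because it grows with the lattice.
    Points are therefore sequences whose coordinates from \<open>n\<close> on do not matter, and the
    argument runs through Kuhn's combinatorial lemma.\<close>
  define cube where "cube x \<longleftrightarrow> (\<forall>j::nat. 0 \<le> x j \<and> x j \<le> (1::real))" for x
  \<comment> \<open>Kuhn's labelling: label \<open>0\<close> at a coordinate says that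
    \<open>f\<close> does not decrease it, label \<open>1\<close> that \<open>f\<close> does not
    increase it.\<close>
  obtain l where l1: "\<And>x i. l x i \<le> (1::nat)"
    and l_at0: "\<And>x i. cube x \<Longrightarrow> x i = 0 \<Longrightarrow> l x i = 0"
    and l_at1: "\<And>x i. cube x \<Longrightarrow> x i = 1 \<Longrightarrow> l x i = 1"
    and l_0: "\<And>x i. cube x \<Longrightarrow> l x i = 0 \<Longrightarrow> x i \<le> f x i"
    and l_1: "\<And>x i. cube x \<Longrightarrow> l x i = 1 \<Longrightarrow> f x i \<le> x i"
    proof -
    have "\<forall>x. cube x \<longrightarrow> cube (f x)" "\<forall>x. cube x \<longrightarrow> (\<forall>i. True \<longrightarrow> 0 \<le> x i \<and> x i \<le> 1)"
      using maps by (auto simp: cube_def)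
    from kuhn_labelling_lemma'[OF this] show thesis by (elim exE conjE) (rule that; blast)
  qed
  \<comment> \<open>Some small grid cell at \<open>Y\<close> carries both labels in every
    coordinate, at points \<open>A\<close> and \<open>B\<close> that depend on the coordinate. As
    the cells shrink, these give the two inequalities for the fixed point.\<close>
  have "\<exists>Y. cube Y \<and> (\<forall>i<n. \<exists>A B. cube A \<and> cube B \<and> A i \<le> f A i \<and> f B i \<le> B i \<and>
          (\<forall>j. \<bar>A j - Y j\<bar> \<le> 1 / real (Suc m)) \<and> (\<forall>j. \<bar>B j - Y j\<bar> \<le> 1 / real (Suc m)))" for m
  proof -
    define p where "p = Suc m"
    \<comment> \<open>\<open>min p\<close> clips the indices, so that \<open>e\<close> maps every
      index vector into the cube.\<close>
    define e where "e x = (\<lambda>j. if j < n then real (min p (x j)) / real p else 0)" for x :: "nat \<Rightarrow> nat"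
    have cube_e: "cube (e x)" for x
      by (auto simp: cube_def e_def p_def min_def)
    obtain q where q: "\<forall>i<n. q i < p"
      and rs: "\<forall>i<n. \<exists>r s. (\<forall>j<n. q j \<le> r j \<and> r j \<le> q j + 1) \<and> (\<forall>j<n. q j \<le> s j \<and> s j \<le> q j + 1)
                 \<and> l (e r) i \<noteq> l (e s) i"
    proof (rule kuhn_lemma[of p n "\<lambda>x. l (e x)"])
      show "0 < p" by (simp add: p_def)
      show "\<forall>x. (\<forall>i<n. x i \<le> p) \<longrightarrow> (\<forall>i<n. l (e x) i = 0 \<or> l (e x) i = 1)"
        using l1 by (metis le_neq_implies_less less_one)
      show "\<forall>x. (\<forall>i<n. x i \<le> p) \<longrightarrow> (\<forall>i<n. x i = 0 \<longrightarrow> l (e x) i = 0)"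
        using l_at0[OF cube_e] by (simp add: e_def)
      show "\<forall>x. (\<forall>i<n. x i \<le> p) \<longrightarrow> (\<forall>i<n. x i = p \<longrightarrow> l (e x) i = 1)"
        using l_at1[OF cube_e] by (simp add: e_def p_def)
    qed blast
    have near: "\<bar>e r j - e q j\<bar> \<le> 1 / real (Suc m)" if "\<forall>j<n. q j \<le> r j \<and> r j \<le> q j + 1" for r j
    proof (cases "j < n")
      case True
      then have "q j \<le> r j" "r j \<le> q j + 1" "q j < p" using that q by auto
      then have "min p (q j) \<le> min p (r j)" "min p (r j) \<le> min p (q j) + 1" by auto
      then have "\<bar>real (min p (r j)) - real (min p (q j))\<bar> \<le> 1" by linarith
      with True show ?thesis
        by (simp add: e_def p_def diff_divide_distrib[symmetric] divide_right_mono)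
    qed (simp add: e_def)
    have "\<exists>A B. cube A \<and> cube B \<and> A i \<le> f A i \<and> f B i \<le> B i \<and>
          (\<forall>j. \<bar>A j - e q j\<bar> \<le> 1 / real (Suc m)) \<and> (\<forall>j. \<bar>B j - e q j\<bar> \<le> 1 / real (Suc m))"
      if i: "i < n" for i
    proof -
      obtain r s where r: "\<forall>j<n. q j \<le> r j \<and> r j \<le> q j + 1" and s: "\<forall>j<n. q j \<le> s j \<and> s j \<le> q j + 1"
        and ne: "l (e r) i \<noteq> l (e s) i" using rs i by blast
      have "l (e r) i = 0 \<and> l (e s) i = 1 \<or> l (e r) i = 1 \<and> l (e s) i = 0"
        using ne l1[of "e r" i] l1[of "e s" i] by linarith
      then show ?thesis
      proof
        assume "l (e r) i = 0 \<and> l (e s) i = 1"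
        then show ?thesis using near[OF r] near[OF s] cube_e l_0 l_1 by metis
      next
        assume "l (e r) i = 1 \<and> l (e s) i = 0"
        then show ?thesis using near[OF r] near[OF s] cube_e l_0 l_1 by metis
      qed
    qed
    then show ?thesis using cube_e by metis
  qed
  then obtain Y A B where Y: "\<And>m. cube (Y m)"
    and A: "\<And>m i. i < n \<Longrightarrow> cube (A m i) \<and> A m i i \<le> f (A m i) i \<and> (\<forall>j. \<bar>A m i j - Y m j\<bar> \<le> 1 / real (Suc m))"
    and B: "\<And>m i. i < n \<Longrightarrow> cube (B m i) \<and> f (B m i) i \<le> B m i i \<and> (\<forall>j. \<bar>B m i j - Y m j\<bar> \<le> 1 / real (Suc m))"
    by metis
  obtain k where k: "strict_mono (k::nat\<Rightarrow>nat)" and lim: "\<And>j. \<exists>l. (\<lambda>m. Y (k m) j) \<longlonglongrightarrow> l"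
  proof (rule function_convergent_subsequence[of "UNIV :: nat set" Y 1])
    show "norm (Y m j) \<le> 1" for m j using Y[of m] by (simp add: cube_def)
  qed auto
  then obtain y where y: "\<And>j. (\<lambda>m. Y (k m) j) \<longlonglongrightarrow> y j" by metis
  have ycube: "0 \<le> y j \<and> y j \<le> 1" for j
    using Y LIMSEQ_le_const[OF y, of 0 j] LIMSEQ_le_const2[OF y, of j 1] by (auto simp: cube_def)
  have inv0: "(\<lambda>m. 1 / real (Suc (k m))) \<longlonglongrightarrow> 0"
    using LIMSEQ_subseq_LIMSEQ[OF LIMSEQ_inverse_real_of_nat k] by (simp add: o_def inverse_eq_divide)
  have close: "(\<lambda>m. Z m) \<longlonglongrightarrow> y j" if "\<And>m. \<bar>Z m - Y (k m) j\<bar> \<le> 1 / real (Suc (k m))" for Z j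
  proof -
    have "(\<lambda>m. Z m - Y (k m) j) \<longlonglongrightarrow> 0"
      by (rule Lim_null_comparison[OF _ inv0]) (use that in auto)
    from tendsto_add[OF this y[of j]] show ?thesis by simp
  qed
  have "f y i = y i" if i: "i < n" for i
  proof (rule antisym)
    have "(\<lambda>m. f (B (k m) i) i) \<longlonglongrightarrow> f y i"
      by (rule cont[OF _ _ i]) (use B[OF i] close in \<open>auto simp: cube_def\<close>)
    then show "f y i \<le> y i"
      by (rule LIMSEQ_le[OF _ close[of "\<lambda>m. B (k m) i i"]]) (use B[OF i] in auto)
    have "(\<lambda>m. f (A (k m) i) i) \<longlonglongrightarrow> f y i"
      by (rule cont[OF _ _ i]) (use A[OF i] close in \<open>auto simp: cube_def\<close>)
    from LIMSEQ_le[OF close[of "\<lambda>m. A (k m) i i"] this] show "y i \<le> f y i"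
      using A[OF i] by auto
  qed
  with ycube that show thesis by blast
qed

text \<open>Fatou's lemma gives one inequality. For the other, the bound \<open>B\<close> on a set
  \<open>A\<close> of finite measure permits dominated convergence there, and at most
  \<open>e\<close> is lost outside. Tightness thus takes the place of a global integrable
  majorant.\<close>

lemma nn_integral_eq_of_tight_limit:
  fixes f :: "nat \<Rightarrow> 'a \<Rightarrow> ennreal" and I :: "nat \<Rightarrow> real"
  assumes [measurable]: "\<And>n. f n \<in> borel_measurable M" "g \<in> borel_measurable M"
    and lim: "AE x in M. (\<lambda>n. f n x) \<longlonglongrightarrow> g x"
    and I: "eventually (\<lambda>n. (\<integral>\<^sup>+x. f n x \<partial>M) = ennreal (I n)) sequentially" "I \<longlonglongrightarrow> J" "\<And>n. I n \<ge> 0"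
    and tight: "\<And>e::real. e > 0 \<Longrightarrow> \<exists>A B. A \<in> sets M \<and> emeasure M A < \<infinity> \<and>
        eventually (\<lambda>n. (\<forall>x\<in>A. f n x \<le> ennreal B) \<and> (\<integral>\<^sup>+x. f n x * indicator (- A) x \<partial>M) \<le> ennreal e) sequentially"
  shows "(\<integral>\<^sup>+x. g x \<partial>M) = ennreal J"
proof (rule antisym)
  have J0: "J \<ge> 0" using I(2,3) by (meson LIMSEQ_le_const)
  have limI: "(\<lambda>n. \<integral>\<^sup>+x. f n x \<partial>M) \<longlonglongrightarrow> ennreal J"
    by (rule Lim_transform_eventually[OF tendsto_ennrealI[OF I(2)]]) (use I(1) in eventually_elim, simp)
  have "(\<integral>\<^sup>+x. g x \<partial>M) = (\<integral>\<^sup>+x. liminf (\<lambda>n. f n x) \<partial>M)"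
    by (rule nn_integral_cong_AE) (use lim in eventually_elim, auto dest: lim_imp_Liminf[rotated])
  also have "\<dots> \<le> liminf (\<lambda>n. \<integral>\<^sup>+x. f n x \<partial>M)"
    by (rule nn_integral_liminf) simp
  also have "\<dots> = ennreal J" using limI by (rule lim_imp_Liminf[rotated]) simp
  finally show "(\<integral>\<^sup>+x. g x \<partial>M) \<le> ennreal J" .
  show "ennreal J \<le> (\<integral>\<^sup>+x. g x \<partial>M)"
  proof (rule ennreal_le_epsilon)
    fix e :: real assume "e > 0"
    from tight[OF this] obtain A B where A[measurable]: "A \<in> sets M" and Af: "emeasure M A < \<infinity>"
      and ev: "eventually (\<lambda>n. (\<forall>x\<in>A. f n x \<le> ennreal B) \<and> (\<integral>\<^sup>+x. f n x * indicator (- A) x \<partial>M) \<le> ennreal e) sequentially"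
      by blast
    from ev obtain N where N: "\<And>n. n \<ge> N \<Longrightarrow> (\<forall>x\<in>A. f n x \<le> ennreal B) \<and> (\<integral>\<^sup>+x. f n x * indicator (- A) x \<partial>M) \<le> ennreal e"
      unfolding eventually_sequentially by blast
    have tA: "(\<lambda>n. \<integral>\<^sup>+x. f (n + N) x * indicator A x \<partial>M) \<longlonglongrightarrow> (\<integral>\<^sup>+x. g x * indicator A x \<partial>M)"
    proof (rule nn_integral_dominated_convergence[where w = "\<lambda>x. ennreal B * indicator A x"])
      show "AE x in M. f (n + N) x * indicator A x \<le> ennreal B * indicator A x" for n
        using N[of "n + N"] by (auto split: split_indicator)
      show "(\<integral>\<^sup>+x. ennreal B * indicator A x \<partial>M) < \<infinity>"
        using Af by (simp add: nn_integral_cmult_indicator ennreal_mult_less_top)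
      show "AE x in M. (\<lambda>n. f (n + N) x * indicator A x) \<longlonglongrightarrow> g x * indicator A x"
        using lim by eventually_elim (auto split: split_indicator dest: LIMSEQ_ignore_initial_segment)
    qed auto
    have "ennreal J \<le> (\<integral>\<^sup>+x. g x * indicator A x \<partial>M) + ennreal e"
    proof (rule LIMSEQ_le[OF LIMSEQ_ignore_initial_segment[OF limI, of N] tendsto_add[OF tA tendsto_const]])
      show "\<exists>n0. \<forall>n\<ge>n0. (\<integral>\<^sup>+x. f (n + N) x \<partial>M) \<le> (\<integral>\<^sup>+x. f (n + N) x * indicator A x \<partial>M) + ennreal e"
      proof (intro exI allI impI)
        fix n :: nat
        have "(\<integral>\<^sup>+x. f (n + N) x \<partial>M) = (\<integral>\<^sup>+x. f (n + N) x * indicator A x + f (n + N) x * indicator (- A) x \<partial>M)"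
          by (rule nn_integral_cong) (auto split: split_indicator)
        also have "\<dots> = (\<integral>\<^sup>+x. f (n + N) x * indicator A x \<partial>M) + (\<integral>\<^sup>+x. f (n + N) x * indicator (- A) x \<partial>M)"
          by (rule nn_integral_add) (auto intro!: borel_measurable_times_ennreal borel_measurable_indicator')
        also have "\<dots> \<le> (\<integral>\<^sup>+x. f (n + N) x * indicator A x \<partial>M) + ennreal e"
          using N[of "n + N"] by (intro add_left_mono) auto
        finally show "(\<integral>\<^sup>+x. f (n + N) x \<partial>M) \<le> (\<integral>\<^sup>+x. f (n + N) x * indicator A x \<partial>M) + ennreal e" .
      qed
    qed
    also have "\<dots> \<le> (\<integral>\<^sup>+x. g x \<partial>M) + ennreal e"
      by (intro add_right_mono nn_integral_mono) (auto split: split_indicator)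
    finally show "ennreal J \<le> (\<integral>\<^sup>+x. g x \<partial>M) + ennreal e" .
  qed
qed

text \<open>A version of Arzela-Ascoli for functions with jumps, such as lattice step functions: the
  modulus \<open>d\<close> has to hold only from some index \<open>N\<close> on, which may depend on
  \<open>e\<close>. A diagonal subsequence converges on the rationals, and the weak equicontinuity
  carries this to all points and makes the limit continuous.\<close>

lemma subsequence_asymptotically_equicontinuous:
  fixes f :: "nat \<Rightarrow> real \<Rightarrow> real"
  assumes bd: "\<And>n x. x > 0 \<Longrightarrow> \<bar>f n x\<bar> \<le> B x"
    and eq: "\<And>r R e. 0 < r \<Longrightarrow> r < R \<Longrightarrow> 0 < e \<Longrightarrow>
       \<exists>d>0. \<exists>N. \<forall>n\<ge>N. \<forall>x\<in>{r..R}. \<forall>y\<in>{r..R}. \<bar>x - y\<bar> < d \<longrightarrow> \<bar>f n x - f n y\<bar> \<le> e"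
  obtains k g where "strict_mono (k::nat\<Rightarrow>nat)" "\<And>x. x > 0 \<Longrightarrow> (\<lambda>n. f (k n) x) \<longlonglongrightarrow> g x"
    "continuous_on {0<..} g"
proof -
  define S where "S = \<rat> \<inter> {0::real<..}"
  have cS: "countable S" unfolding S_def by (intro countable_Int1 countable_rat)
  \<comment> \<open>Division by \<open>1 + \<bar>B x\<bar>\<close> supplies the single bound
    \<open>1\<close> that the diagonal argument asks for.\<close>
  obtain k where k: "strict_mono (k::nat\<Rightarrow>nat)"
    and lim: "\<And>x. x \<in> S \<Longrightarrow> \<exists>l. (\<lambda>n. f (k n) x / (1 + \<bar>B x\<bar>)) \<longlonglongrightarrow> l"
  proof (rule function_convergent_subsequence[of S "\<lambda>n x. f n x / (1 + \<bar>B x\<bar>)" 1])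
    show "norm (f n x / (1 + \<bar>B x\<bar>)) \<le> 1" if "x \<in> S" for n x
      using bd[of x n] that by (auto simp: S_def divide_le_eq_1)
  qed (use cS in auto)
  have CauchyS: "Cauchy (\<lambda>n. f (k n) x)" if "x \<in> S" for x
  proof -
    from lim[OF that] obtain l where "(\<lambda>n. f (k n) x / (1 + \<bar>B x\<bar>)) \<longlonglongrightarrow> l" ..
    from tendsto_mult[OF this tendsto_const[of "1 + \<bar>B x\<bar>"]] have "(\<lambda>n. f (k n) x) \<longlonglongrightarrow> l * (1 + \<bar>B x\<bar>)"
      by (simp add: nonzero_divide_eq_eq add_pos_nonneg order.strict_implies_not_eq[symmetric]) 
    then show ?thesis by (rule LIMSEQ_imp_Cauchy)
  qed
  have conv: "\<exists>l. (\<lambda>n. f (k n) x) \<longlonglongrightarrow> l" if x: "x > 0" for x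
  proof -
    have "Cauchy (\<lambda>n. f (k n) x)"
    proof (rule CauchyI)
      fix e :: real assume e: "e > 0"
      from eq[of "x/2" "2*x" "e/4"] x e obtain d N where d: "d > 0"
        and N: "\<And>n y. n \<ge> N \<Longrightarrow> y \<in> {x/2..2*x} \<Longrightarrow> \<bar>x - y\<bar> < d \<Longrightarrow> \<bar>f n x - f n y\<bar> \<le> e/4"
        by force
      obtain y where y: "y \<in> \<rat>" "x < y" "y < min (x + d) (2 * x)"
        using Rats_dense_in_real[of x "min (x + d) (2*x)"] x d by auto
      then have yS: "y \<in> S" and ynear: "y \<in> {x/2..2*x}" "\<bar>x - y\<bar> < d" using x by (auto simp: S_def)
      from CauchyD[OF CauchyS[OF yS], of "e/4"] e obtain M where
        M: "\<And>m n. m \<ge> M \<Longrightarrow> n \<ge> M \<Longrightarrow> \<bar>f (k m) y - f (k n) y\<bar> < e/4" by auto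
      have "\<bar>f (k m) x - f (k n) x\<bar> < e" if "m \<ge> max M N" "n \<ge> max M N" for m n
        using M[of m n] N[OF _ ynear, of "k m"] N[OF _ ynear, of "k n"] that seq_suble[OF k, of m] seq_suble[OF k, of n] e
        by (simp add: abs_real_def split: if_splits)
      then show "\<exists>M. \<forall>m\<ge>M. \<forall>n\<ge>M. norm (f (k m) x - f (k n) x) < e"
        by (intro exI[of _ "max M N"]) simp
    qed
    then show ?thesis using Cauchy_convergent_iff convergent_def by blast
  qed
  then obtain g where g: "\<And>x. x > 0 \<Longrightarrow> (\<lambda>n. f (k n) x) \<longlonglongrightarrow> g x" by metis
  have "isCont g x" if x: "x > 0" for x
    unfolding continuous_at_eps_delta
  proof (intro allI impI)
    fix e :: real assume e: "e > 0"
    from eq[of "x/2" "2*x" "e/2"] x e obtain d N where d: "d > 0"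
      and N: "\<And>n y. n \<ge> N \<Longrightarrow> y \<in> {x/2..2*x} \<Longrightarrow> \<bar>x - y\<bar> < d \<Longrightarrow> \<bar>f n x - f n y\<bar> \<le> e/2"
      by force
    have "\<bar>g x - g y\<bar> \<le> e/2" if y: "\<bar>y - x\<bar> < min d (x/2)" for y
    proof (rule LIMSEQ_le_const2)
      have yy: "y \<in> {x/2..2*x}" "y > 0" "\<bar>x - y\<bar> < d" using y x by (auto simp: abs_real_def split: if_splits)
      show "(\<lambda>n. \<bar>f (k n) x - f (k n) y\<bar>) \<longlonglongrightarrow> \<bar>g x - g y\<bar>"
        using x yy by (intro tendsto_intros g)
      show "\<exists>n0. \<forall>n\<ge>n0. \<bar>f (k n) x - f (k n) y\<bar> \<le> e/2"
        using N[OF _ yy(1,3)] seq_suble[OF k] by (metis le_trans)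
    qed
    then show "\<exists>d>0. \<forall>y. dist y x < d \<longrightarrow> dist (g y) (g x) < e"
      using d e x by (intro exI[of _ "min d (x/2)"]) (auto simp: dist_real_def abs_minus_commute, smt (verit) field_sum_of_halves)
  qed
  then have "continuous_on {0<..} g" by (simp add: continuous_at_imp_continuous_on)
  with k g that show thesis by blast
qed

section \<open>Quadratic Volterra recursions and powers\<close>

text \<open>Normalised to \<open>1\<close> at index \<open>1\<close>: the recursion is linear, so
  the amplitude can be adjusted afterwards.\<close>

fun volterra :: "(nat \<Rightarrow> nat \<Rightarrow> real) \<Rightarrow> nat \<Rightarrow> real" where
  "volterra c 0 = 0"
| "volterra c (Suc k) = (if k = 0 then 1 else (\<Sum>j=1..k. c k j * volterra c j))"

lemma volterra_nonneg:
  assumes "\<And>k j. c k j \<ge> 0"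
  shows "volterra c k \<ge> 0"
proof (induction k rule: less_induct)
  case (less k)
  then show ?case by (cases k) (auto intro!: sum_nonneg mult_nonneg_nonneg assms)
qed

lemma volterra_tendsto:
  assumes "\<And>k j. (\<lambda>m. c m k j) \<longlonglongrightarrow> c' k j"
  shows "(\<lambda>m. volterra (c m) k) \<longlonglongrightarrow> volterra c' k"
proof (induction k rule: less_induct)
  case (less k)
  then show ?case by (cases k) (auto intro!: tendsto_sum tendsto_mult assms)
qed

lemma quadratic_volterra_solution:
  fixes \<alpha> :: "nat \<Rightarrow> real" and W :: "nat \<Rightarrow> nat \<Rightarrow> nat \<Rightarrow> real" and A :: real and N :: nat
  assumes \<alpha>: "\<And>k. \<alpha> k \<ge> 0" and W: "\<And>k j z. W k j z \<ge> 0" and A: "A > 0" and N: "N \<ge> 1"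
  obtains h where "\<And>k. h k \<ge> 0" "h 0 = 0" "\<And>k. k > N \<Longrightarrow> h k = 0" "(\<Sum>k=1..N. h k) = A"
    "\<And>k. 1 \<le> k \<Longrightarrow> k < N \<Longrightarrow>
        h (Suc k) = \<alpha> k * (\<Sum>j=1..k. h j) + (\<Sum>j=1..k. \<Sum>z=1..N. W k j z * h j * h z)"
proof -
  define c where "c t k j = \<alpha> k + (\<Sum>z=1..N. W k j z * (A * t z))" for t :: "nat \<Rightarrow> real" and k j
  define p where "p t k = volterra (c t) k" for t k
  define P where "P t = (\<Sum>k=1..N. p t k)" for t
  define f where "f t i = (if 1 \<le> i \<and> i \<le> N then p t i / P t else 0)" for t i
  have c0: "c t k j \<ge> 0" if "\<And>j. 0 \<le> t j \<and> t j \<le> 1" for t k j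
    unfolding c_def using that A by (intro add_nonneg_nonneg \<alpha> sum_nonneg mult_nonneg_nonneg W) auto
  have p0: "p t k \<ge> 0" if "\<And>j. 0 \<le> t j \<and> t j \<le> 1" for t k
    unfolding p_def by (intro volterra_nonneg c0 that)
  have pP: "p t k \<le> P t" if "\<And>j. 0 \<le> t j \<and> t j \<le> 1" "1 \<le> k" "k \<le> N" for t k
    unfolding P_def using that p0[of t] by (intro member_le_sum) auto
  have P1: "P t \<ge> 1" if "\<And>j. 0 \<le> t j \<and> t j \<le> 1" for t
  proof -
    have "p t 1 = 1" by (simp add: p_def)
    with pP[of t 1] that N show ?thesis by auto
  qed
  have maps: "0 \<le> f t i \<and> f t i \<le> 1" if t: "\<And>j. 0 \<le> t j \<and> t j \<le> 1" for t i
    using p0[OF t] P1[of t, OF t] pP[of t i, OF t] by (auto simp: f_def divide_le_eq_1)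
  have ptend: "(\<lambda>m. p (X m) k) \<longlonglongrightarrow> p x k" if "\<And>j. (\<lambda>m. X m j) \<longlonglongrightarrow> x j" for X x k
    unfolding p_def c_def by (intro volterra_tendsto tendsto_intros that)
  \<comment> \<open>The dimension is \<open>Suc N\<close> so that the coordinates
    \<open>1..N\<close> are covered; coordinate \<open>0\<close> is mapped to
    \<open>0\<close>.\<close>
  obtain t where t: "\<And>j. 0 \<le> t j \<and> t j \<le> 1" and fix_t: "\<And>i. i < Suc N \<Longrightarrow> f t i = t i"
  proof (rule brouwer_nat_cube[of f "Suc N"])
    fix X :: "nat \<Rightarrow> nat \<Rightarrow> real" and x i
    assume X: "\<And>m j. 0 \<le> X m j \<and> X m j \<le> 1" and lim: "\<And>j. (\<lambda>m. X m j) \<longlonglongrightarrow> x j"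
    have x: "0 \<le> x j \<and> x j \<le> 1" for j
      using X LIMSEQ_le_const[OF lim, of 0 j] LIMSEQ_le_const2[OF lim, of j 1] by auto
    have "P x \<noteq> 0" using P1[of x, OF x] by auto
    then show "(\<lambda>m. f (X m) i) \<longlonglongrightarrow> f x i"
      by (auto simp: f_def P_def intro!: tendsto_divide tendsto_sum ptend lim)
  qed (use maps in auto)
  define h where "h k = (if 1 \<le> k \<and> k \<le> N then A * t k else 0)" for k
  have th: "t k = p t k / P t" if "1 \<le> k" "k \<le> N" for k
    using fix_t[of k] that by (simp add: f_def)
  have PP: "P t > 0" using P1[of t, OF t] by simp
  show thesis
  proof
    show "(\<Sum>k=1..N. h k) = A"
    proof -
      have "(\<Sum>k=1..N. h k) = (\<Sum>k=1..N. A / P t * p t k)"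
        by (rule sum.cong) (auto simp: h_def th)
      also have "\<dots> = A" unfolding sum_distrib_left[symmetric] P_def[symmetric] using PP by simp
      finally show ?thesis .
    qed
    fix k assume k: "1 \<le> k" "k < N"
    have hp: "h j = A / P t * p t j" if "1 \<le> j" "j \<le> N" for j
      using that by (simp add: h_def th)
    have "h (Suc k) = A / P t * (\<Sum>j=1..k. c t k j * p t j)"
      using k by (subst hp) (auto simp: p_def)
    also have "\<dots> = (\<Sum>j=1..k. c t k j * h j)"
      unfolding sum_distrib_left by (rule sum.cong) (use k hp in auto)
    also have "\<dots> = (\<Sum>j=1..k. \<alpha> k * h j + (\<Sum>z=1..N. W k j z * h j * h z))"
      by (rule sum.cong) (auto simp: c_def h_def algebra_simps sum_distrib_left sum_distrib_right)
    also have "\<dots> = \<alpha> k * (\<Sum>j=1..k. h j) + (\<Sum>j=1..k. \<Sum>z=1..N. W k j z * h j * h z)"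
      by (simp add: sum.distrib sum_distrib_left)
    finally show "h (Suc k) = \<dots>" .
  qed (use t A in \<open>auto simp: h_def\<close>)
qed

section \<open>Power inequalities and summation by parts\<close>

lemma powr_le_one_minus:
  fixes t p :: real
  assumes "0 < t"
  shows "1 - t powr p \<le> - p * ln t"
proof -
  have "1 + p * ln t \<le> exp (p * ln t)" by (rule exp_ge_add_one_self)
  moreover have "t powr p = exp (p * ln t)" using assms by (simp add: powr_def)
  ultimately show ?thesis by linarith
qed

text \<open>With \<open>t = x / y\<close>, both sides are compared with the logarithm: \<open>1 - t
  powr s \<le> - s * ln t \<le> s / d * (t powr (- d) - 1)\<close>. This is the comparison of the
  decreasing weight \<open>z powr (- s - d)\<close>, taken at the right endpoint, with its integral
  against the increment of \<open>z powr s\<close>.\<close>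

lemma powr_diff_telescope:
  fixes x y s d :: real
  assumes "0 < x" "x \<le> y" "0 < s" "0 < d"
  shows "y powr (- s - d) * (y powr s - x powr s) \<le> s / d * (x powr (- d) - y powr (- d))"
proof -
  define t where "t = x / y"
  have t: "0 < t" "t \<le> 1" and y: "y > 0" and x: "x = t * y" using assms by (auto simp: t_def)
  have "d * (1 - t powr s) \<le> d * (- s * ln t)" using powr_le_one_minus[OF t(1), of s] assms by (intro mult_left_mono) auto
  also have "\<dots> = s * (- d * ln t)" by simp
  also have "\<dots> \<le> s * (t powr (- d) - 1)" using powr_le_one_minus[OF t(1), of "- d"] assms by (intro mult_left_mono) auto
  finally have "1 - t powr s \<le> s / d * (t powr (- d) - 1)" using assms by (simp add: field_simps)
  then have "y powr (- d) * (1 - t powr s) \<le> y powr (- d) * (s / d * (t powr (- d) - 1))"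
    by (intro mult_left_mono) auto
  moreover have "y powr (- s - d) * (y powr s - x powr s) = y powr (- d) * (1 - t powr s)"
  proof -
    have "y powr (- s - d) * y powr s = y powr (- d)" by (simp add: powr_add[symmetric])
    then show ?thesis unfolding x using t y by (simp add: powr_mult algebra_simps)
  qed
  moreover have "y powr (- d) * (s / d * (t powr (- d) - 1)) = s / d * (x powr (- d) - y powr (- d))"
    unfolding x using t y by (simp add: powr_mult algebra_simps)
  ultimately show ?thesis by (simp only:)
qed

text \<open>Compares a left-endpoint Riemann term of \<open>z powr (- 1 - d)\<close> with the
  integral. The logarithm yields the right-endpoint version; \<open>y \<le> 2 * x\<close> permits
  the change of endpoint at the cost of \<open>2 powr (1 + d)\<close>.\<close>

lemma powr_minus_diff_ge:
  fixes x y d :: real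
  assumes "0 < x" "x \<le> y" "y \<le> 2 * x" "0 < d"
  shows "(y - x) * x powr (- 1 - d) \<le> 2 powr (1 + d) / d * (x powr (- d) - y powr (- d))"
proof -
  have y: "y > 0" using assms by simp
  have "d * (1 - x / y) \<le> d * (- ln (x / y))"
    using ln_le_minus_one[of "x / y"] assms y by (intro mult_left_mono) auto
  also have "\<dots> \<le> (x / y) powr (- d) - 1" using powr_le_one_minus[of "x / y" "- d"] assms y by auto
  finally have "y powr (- d) * (d * (1 - x / y)) \<le> y powr (- d) * ((x / y) powr (- d) - 1)"
    by (intro mult_left_mono) auto
  also have "\<dots> = x powr (- d) - y powr (- d)" using assms y by (simp add: powr_divide algebra_simps)
  also have "y powr (- d) * (d * (1 - x / y)) = d * (y powr (- 1 - d) * (y - x))"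
  proof -
    have "y powr (- 1 - d) * y = y powr (- d)" using y by (simp add: powr_mult_base mult.commute)
    then show ?thesis using y by (simp add: field_simps)
  qed
  finally have 1: "y powr (- 1 - d) * (y - x) \<le> (x powr (- d) - y powr (- d)) / d" using assms by (simp add: field_simps)
  have "x powr (- 1 - d) = 2 powr (1 + d) * (2 * x) powr (- 1 - d)"
  proof -
    have "(2::real) powr (1 + d) * 2 powr (- 1 - d) = 1" by (simp add: powr_add[symmetric])
    then show ?thesis using assms by (simp add: powr_mult)
  qed
  also have "\<dots> \<le> 2 powr (1 + d) * y powr (- 1 - d)"
    using assms y by (intro mult_left_mono powr_mono2') auto
  finally have "(y - x) * x powr (- 1 - d) \<le> (y - x) * (2 powr (1 + d) * y powr (- 1 - d))"
    using assms by (intro mult_left_mono) auto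
  also have "\<dots> = 2 powr (1 + d) * (y powr (- 1 - d) * (y - x))" by simp
  also have "\<dots> \<le> 2 powr (1 + d) * ((x powr (- d) - y powr (- d)) / d)" using 1 by (intro mult_left_mono) auto
  finally show ?thesis by simp
qed

text \<open>Summation by parts, arranged as an induction whose step is a pointwise inequality.\<close>
lemma weighted_tail_sum_le:
  fixes h x :: "nat \<Rightarrow> real" and s d :: real
  assumes s: "0 < s" and d: "0 < d" and x: "\<And>k. r \<le> k \<Longrightarrow> 0 < x k" "\<And>k. r \<le> k \<Longrightarrow> x k \<le> x (Suc k)"
    and h: "\<And>k. h k \<ge> 0" and H: "\<And>k. r \<le> k \<Longrightarrow> k \<le> M \<Longrightarrow> (\<Sum>j=1..k. h j) \<le> x k powr s" and r: "1 \<le> r" "r \<le> M"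
  shows "(\<Sum>z=r..M. x z powr (- s - d) * h z) \<le> (s + d) / d * x r powr (- d)"
proof -
  define \<phi> where "\<phi> k = x k powr (- s - d)" for k
  define H' where "H' k = (\<Sum>j=1..k. h j) - x k powr s" for k
  have "m \<le> M \<Longrightarrow> (\<Sum>z=r..m. \<phi> z * h z) \<le> \<phi> m * H' m + (1 + s / d) * x r powr (- d) - s / d * x m powr (- d)" if "r \<le> m" for m
    using that
  proof (induction m rule: dec_induct)
    case base
    have "h r \<le> (\<Sum>j=1..r. h j)" using r h by (intro member_le_sum) auto
    then have "\<phi> r * h r \<le> \<phi> r * (\<Sum>j=1..r. h j)" by (intro mult_left_mono) (auto simp: \<phi>_def)
    also have "\<dots> = \<phi> r * H' r + \<phi> r * x r powr s" by (simp add: H'_def algebra_simps)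
    also have "\<phi> r * x r powr s = x r powr (- d)" using x(1)[of r] by (simp add: \<phi>_def powr_add[symmetric])
    finally show ?case by (simp add: algebra_simps)
  next
    case (step m)
    have "\<phi> (Suc m) \<le> \<phi> m" using x[of m] step.hyps s d unfolding \<phi>_def by (intro powr_mono2') auto
    moreover have "H' m \<le> 0" using H[of m] step by (simp add: H'_def)
    ultimately have "\<phi> m * H' m \<le> \<phi> (Suc m) * H' m" by (rule mult_right_mono_neg)
    moreover have "\<phi> (Suc m) * H' m + \<phi> (Suc m) * h (Suc m)
      = \<phi> (Suc m) * H' (Suc m) + \<phi> (Suc m) * (x (Suc m) powr s - x m powr s)"
      by (simp add: H'_def algebra_simps)
    moreover have "\<phi> (Suc m) * (x (Suc m) powr s - x m powr s) \<le> s / d * (x m powr (- d) - x (Suc m) powr (- d))"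
      unfolding \<phi>_def using x[of m] step.hyps s d by (intro powr_diff_telescope) auto
    ultimately show ?case using step by (simp add: algebra_simps)
  qed
  from this[of M] r have "(\<Sum>z=r..M. \<phi> z * h z) \<le> \<phi> M * H' M + (1 + s / d) * x r powr (- d) - s / d * x M powr (- d)" by simp
  also have "\<phi> M * H' M \<le> 0" using H[of M] r by (simp add: H'_def \<phi>_def mult_nonneg_nonpos)
  finally have "(\<Sum>z=r..M. \<phi> z * h z) \<le> (1 + s / d) * x r powr (- d)" 
    using s d by (smt (verit) divide_nonneg_pos mult_nonneg_nonneg powr_ge_zero)
  also have "1 + s / d = (s + d) / d" using d by (simp add: field_simps)
  finally show ?thesis by (simp add: \<phi>_def)
qed

section \<open>A priori estimates on the lattice\<close>

locale coagulation_kernel =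
  fixes K :: "real \<Rightarrow> real \<Rightarrow> real" and \<gamma> C \<rho> :: real
  assumes gamma: "0 \<le> \<gamma>" "\<gamma> < 1"
    and K_cont: "continuous_on ({0<..} \<times> {0<..}) (\<lambda>(x, y). K x y)"
    and K_nonneg: "\<And>x y. x > 0 \<Longrightarrow> y > 0 \<Longrightarrow> K x y \<ge> 0"
    and C_pos: "C > 0"
    and K_bound: "\<And>x y. x > 0 \<Longrightarrow> y > 0 \<Longrightarrow> K x y \<le> C * (x powr \<gamma> + y powr \<gamma>)"
    and rho: "\<gamma> < \<rho>" "\<rho> < 1"
begin

abbreviation \<sigma> where "\<sigma> \<equiv> 1 - \<rho>"
abbreviation \<delta> where "\<delta> \<equiv> \<rho> - \<gamma>"

text \<open>Equal to \<open>(\<sigma> + \<delta>) / \<delta>\<close>, the constant that arises when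
  \<open>z powr (\<gamma> - 1)\<close> is summed by parts against a mass bounded by
  \<open>z powr \<sigma>\<close>; here \<open>\<gamma> - 1 = - \<sigma> - \<delta>\<close>.\<close>

definition tail_const :: real where "tail_const = (1 - \<gamma>) / \<delta>"

text \<open>The density is bounded by a multiple of this weight. The second factor is the price for the small
  \<open>cutoff\<close> needed near the origin; at infinity only \<open>y powr - \<rho>\<close> remains.\<close>
definition weight :: "real \<Rightarrow> real" where "weight y = y powr - \<rho> * (1 + y powr - (\<delta> / \<sigma>))"

text \<open>\<open>\<rho> + \<delta> / \<sigma>\<close> is the steeper of the two exponents in
  \<open>weight\<close>; halving the argument increases \<open>weight\<close> at most by this
  factor.\<close>

definition doubling :: real where "doubling = 2 powr (\<rho> + \<delta> / \<sigma>)"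

text \<open>The resulting smallness \<open>4 * C * \<delta> * doubling\<^sup>2 * cut powr \<sigma>
  \<le> 1\<close> is what allows the absorption in \<open>density_le\<close>, where doubling is used
  twice. The minimum with \<open>1/2\<close> keeps \<open>cutoff y\<close> below
  \<open>y / 2\<close>.\<close>

definition cut :: real where
  "cut = min (1/2) ((1 / (4 * C * \<delta> * doubling\<^sup>2)) powr (1 / \<sigma>))"

text \<open>Partners smaller than \<open>cutoff y\<close> contribute at most half of the bound at \<open>y\<close>.\<close>
definition cutoff :: "real \<Rightarrow> real" where "cutoff y = cut * y * min 1 y powr (\<delta> / \<sigma>)"

text \<open>The fixed point of the estimate \<open>M \<le> dens_const / 2 + M / 2\<close> produced
  in \<open>density_le\<close>. The summand \<open>1\<close> stands for the mass term of the
  recursion, the other summand for the far partners.\<close>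

definition dens_const :: real where
  "dens_const = 2 * doubling * (1 + 2 * C * \<delta> * tail_const * cut powr - \<rho>)"

text \<open>The near and the far part of the flux for the threshold \<open>y / 2\<close>, with the
  density bound inserted.\<close>

definition flux_bound :: "real \<Rightarrow> real" where
  "flux_bound y = 2 * C * doubling * dens_const * y powr (\<gamma> + \<sigma>) * weight y + 4 * C * tail_const * y powr (\<sigma> - \<delta>)"

definition flux_const :: real where
  "flux_const = 4 * C * doubling * dens_const + 4 * C * tail_const"

lemma sd: "\<sigma> > 0" "\<delta> > 0" "\<rho> > 0" "\<delta> / \<sigma> > 0"
  using gamma rho by auto

lemma tail_const_pos: "tail_const > 0"
  using gamma sd by (simp add: tail_const_def)

lemma doubling_ge_1: "doubling \<ge> 1"
  unfolding doubling_def using sd by (intro ge_one_powr_ge_zero) auto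

lemma weight_nonneg: "weight y \<ge> 0"
  by (simp add: weight_def)

lemma weight_pos: "y > 0 \<Longrightarrow> weight y > 0"
  by (simp add: weight_def add_pos_nonneg)

lemma powr_le_weight: "y powr - \<rho> \<le> weight y"
proof -
  have "y powr - \<rho> * 1 \<le> weight y" unfolding weight_def by (intro mult_left_mono) auto
  then show ?thesis by simp
qed

lemma weight_antimono: "0 < x \<Longrightarrow> x \<le> y \<Longrightarrow> weight y \<le> weight x"
  unfolding weight_def using sd by (intro mult_mono add_left_mono powr_mono2') auto

lemma weight_doubling:
  assumes "0 < x" "x \<le> 2 * y"
  shows "weight y \<le> doubling * weight x"
proof -
  have "weight y \<le> weight (x / 2)" using assms by (intro weight_antimono) auto
  also have "\<dots> = 2 powr \<rho> * x powr - \<rho> * (1 + 2 powr (\<delta> / \<sigma>) * x powr - (\<delta> / \<sigma>))"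
    using assms by (simp add: weight_def powr_divide powr_minus field_simps)
  also have "\<dots> \<le> 2 powr \<rho> * x powr - \<rho> * (2 powr (\<delta> / \<sigma>) * 1 + 2 powr (\<delta> / \<sigma>) * x powr - (\<delta> / \<sigma>))"
    using sd by (intro mult_left_mono add_right_mono) (auto intro!: ge_one_powr_ge_zero)
  also have "\<dots> = doubling * weight x" by (simp add: doubling_def weight_def powr_add algebra_simps)
  finally show ?thesis .
qed

lemma weight_le_2: "y \<ge> 1 \<Longrightarrow> weight y \<le> 2 * y powr - \<rho>"
proof -
  assume y: "y \<ge> 1"
  have "y powr - (\<delta> / \<sigma>) \<le> 1" using y sd powr_mono[of "- (\<delta> / \<sigma>)" 0 y] by simp
  then have "weight y \<le> y powr - \<rho> * 2" unfolding weight_def by (intro mult_left_mono) auto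
  then show ?thesis by simp
qed

lemma cut_bounds: "cut > 0" "cut \<le> 1/2" "4 * C * \<delta> * doubling\<^sup>2 * cut powr \<sigma> \<le> 1"
proof -
  define E where "E = 1 / (4 * C * \<delta> * doubling\<^sup>2)"
  have E: "E > 0" using C_pos sd doubling_ge_1 by (auto simp: E_def)
  have "E powr (1 / \<sigma>) > 0" using E by auto
  then show cut: "cut > 0" "cut \<le> 1/2" by (auto simp: cut_def E_def)
  have "cut powr \<sigma> \<le> (E powr (1 / \<sigma>)) powr \<sigma>"
    using cut sd by (intro powr_mono2) (auto simp: cut_def E_def)
  also have "\<dots> = E" using E sd by (simp add: powr_powr)
  finally show "4 * C * \<delta> * doubling\<^sup>2 * cut powr \<sigma> \<le> 1"
    using C_pos sd doubling_ge_1 by (simp add: E_def field_simps)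
qed

text \<open>These estimates dictate the exponents. The near part of the flux enters the density at
  \<open>x\<close> with the factor \<open>x powr (\<gamma> - 1) * cutoff x powr \<sigma>\<close>; as
  \<open>\<gamma> - 1 + \<sigma> = - \<delta>\<close>, it stays bounded near the origin only because
  of the extra factor \<open>x powr (\<delta> / \<sigma>)\<close> in \<open>cutoff\<close>. The far
  part then costs \<open>x powr - \<delta> * cutoff x powr - \<rho>\<close>, of order
  \<open>x powr (- \<rho> - \<delta> / \<sigma>)\<close> at the origin, which is the second term of
  \<open>weight\<close>.\<close>

lemma cutoff_bounds:
  assumes x: "x > 0"
  shows "cutoff x > 0" "cutoff x \<le> x / 2" "x powr (\<gamma> - 1) * cutoff x powr \<sigma> \<le> cut powr \<sigma>"
    "x powr - \<delta> * cutoff x powr - \<rho> \<le> cut powr - \<rho> * weight x"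
proof -
  note c = cut_bounds
  show "cutoff x > 0" using x c by (auto simp: cutoff_def)
  have le: "min 1 x powr (\<delta> / \<sigma>) \<le> 1" using x sd by (intro powr_le1) auto
  have "cut * x * min 1 x powr (\<delta> / \<sigma>) \<le> (1/2) * x * 1"
    using x c le by (intro mult_mono) auto
  then show "cutoff x \<le> x / 2" by (simp add: cutoff_def)
  show "x powr (\<gamma> - 1) * cutoff x powr \<sigma> \<le> cut powr \<sigma>"
  proof (cases "x \<ge> 1")
    case True
    have "x powr (\<gamma> - 1) * cutoff x powr \<sigma> = cut powr \<sigma> * x powr (\<gamma> - \<rho>)"
      using True x c by (simp add: cutoff_def powr_mult powr_add[symmetric])
    also have "x powr (\<gamma> - \<rho>) \<le> 1" using True sd powr_mono[of "\<gamma> - \<rho>" 0 x] by simp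
    finally show ?thesis using c by simp
  next
    case False
    have "x powr (\<gamma> - 1) * cutoff x powr \<sigma> = cut powr \<sigma> * (x powr (\<gamma> - 1) * x powr \<sigma> * x powr \<delta>)"
      using False x c sd by (simp add: cutoff_def powr_mult powr_powr)
    also have "x powr (\<gamma> - 1) * x powr \<sigma> * x powr \<delta> = 1" using x by (simp add: powr_add[symmetric])
    finally show ?thesis by simp
  qed
  show "x powr - \<delta> * cutoff x powr - \<rho> \<le> cut powr - \<rho> * weight x"
  proof (cases "x \<ge> 1")
    case True
    have "x powr - \<delta> * cutoff x powr - \<rho> = cut powr - \<rho> * (x powr - \<delta> * x powr - \<rho>)"
      using True x c by (simp add: cutoff_def powr_mult)
    also have "x powr - \<delta> * x powr - \<rho> \<le> 1 * x powr - \<rho>"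
      using True sd powr_mono[of "- \<delta>" 0 x] by (intro mult_right_mono) auto
    also have "\<dots> \<le> weight x" using powr_le_weight by simp
    finally show ?thesis by (simp add: mult_left_mono)
  next
    case False
    have "x powr - \<delta> * cutoff x powr - \<rho> = cut powr - \<rho> * (x powr - \<rho> * (x powr - \<delta> * x powr (\<delta> / \<sigma> * - \<rho>)))"
      using False x c by (simp add: cutoff_def powr_mult powr_powr)
    also have "x powr - \<delta> * x powr (\<delta> / \<sigma> * - \<rho>) = x powr - (\<delta> / \<sigma>)"
    proof -
      have "- \<delta> + \<delta> / \<sigma> * - \<rho> = - (\<delta> / \<sigma>)" using sd by (simp add: field_simps)
      then show ?thesis by (metis powr_add)
    qed
    also have "x powr - \<rho> * x powr - (\<delta> / \<sigma>) \<le> weight x" by (simp add: weight_def algebra_simps)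
    finally show ?thesis by (simp add: mult_left_mono)
  qed
qed

lemma dens_const_ge: "dens_const \<ge> 1"
proof -
  have "1 * 1 \<le> doubling * (1 + 2 * C * \<delta> * tail_const * cut powr - \<rho>)"
    using doubling_ge_1 C_pos sd tail_const_pos by (intro mult_mono) auto
  then show ?thesis by (simp add: dens_const_def)
qed

lemma flux_bound_large:
  assumes "y \<ge> 1"
  shows "flux_bound y \<le> flux_const * y powr (\<sigma> - \<delta>)"
proof -
  have "2 * C * doubling * dens_const * y powr (\<gamma> + \<sigma>) * weight y
      \<le> 2 * C * doubling * dens_const * y powr (\<gamma> + \<sigma>) * (2 * y powr - \<rho>)"
    using C_pos doubling_ge_1 dens_const_ge weight_le_2[OF assms] by (intro mult_left_mono) auto
  also have "\<dots> = 4 * C * doubling * dens_const * (y powr (\<gamma> + \<sigma>) * y powr - \<rho>)" by simp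
  also have "y powr (\<gamma> + \<sigma>) * y powr - \<rho> = y powr (\<sigma> - \<delta>)" by (simp add: powr_add[symmetric] algebra_simps)
  finally show ?thesis by (simp add: flux_bound_def flux_const_def algebra_simps)
qed

text \<open>Since \<open>x \<le> (X / \<eta>) * z\<close> and \<open>X / \<eta> \<ge> 1\<close>,
  both terms of the kernel bound are at most
  \<open>(X / \<eta>) powr \<gamma> * z powr \<gamma>\<close>.\<close>

lemma K_div_bound_far:
  assumes "0 < x" "0 < z" "0 < \<eta>" "x \<le> X" "\<eta> \<le> X" "\<eta> \<le> z"
  shows "K x z / z \<le> 2 * C * (X / \<eta>) powr \<gamma> * z powr (\<gamma> - 1)"
proof -
  have "x powr \<gamma> \<le> (X / \<eta>) powr \<gamma> * z powr \<gamma>"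
  proof -
    have "X * \<eta> \<le> X * z" using assms by (intro mult_left_mono) auto
    then have "x * \<eta> \<le> X * z" using assms by (smt (verit) mult_right_mono)
    then have "x \<le> (X / \<eta>) * z" using assms by (simp add: field_simps)
    then have "x powr \<gamma> \<le> ((X / \<eta>) * z) powr \<gamma>" using gamma assms by (intro powr_mono2) auto
    moreover have "((X / \<eta>) * z) powr \<gamma> = (X / \<eta>) powr \<gamma> * z powr \<gamma>"
      by (rule powr_mult)
    ultimately show ?thesis by (simp only:)
  qed
  moreover have "z powr \<gamma> \<le> (X / \<eta>) powr \<gamma> * z powr \<gamma>"
  proof -
    have "1 \<le> (X / \<eta>) powr \<gamma>" using assms gamma by (intro ge_one_powr_ge_zero) auto
    then have "1 * z powr \<gamma> \<le> (X / \<eta>) powr \<gamma> * z powr \<gamma>" by (intro mult_right_mono) auto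
    then show ?thesis by simp
  qed
  ultimately have "C * (x powr \<gamma> + z powr \<gamma>) \<le> C * (2 * ((X / \<eta>) powr \<gamma> * z powr \<gamma>))"
    using C_pos by (intro mult_left_mono) auto
  with K_bound[of x z] assms have "K x z \<le> 2 * C * (X / \<eta>) powr \<gamma> * z powr \<gamma>" by simp
  then have "K x z / z \<le> 2 * C * (X / \<eta>) powr \<gamma> * z powr \<gamma> / z" using assms by (intro divide_right_mono) auto
  also have "\<dots> = 2 * C * (X / \<eta>) powr \<gamma> * z powr (\<gamma> - 1)" using assms by (simp add: powr_diff)
  finally show ?thesis .
qed

lemma K_le_max:
  assumes "0 < x" "0 < z" "x \<le> X" "z \<le> X"
  shows "K x z \<le> 2 * C * X powr \<gamma>"
proof -
  have "x powr \<gamma> \<le> X powr \<gamma>" "z powr \<gamma> \<le> X powr \<gamma>" using assms gamma by (auto intro!: powr_mono2)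
  then have "C * (x powr \<gamma> + z powr \<gamma>) \<le> C * (2 * X powr \<gamma>)" using C_pos by (intro mult_left_mono) auto
  with K_bound[of x z] assms show ?thesis by simp
qed

text \<open>Bounds the total rate that partners \<open>z \<ge> \<eta>\<close> exert on a single
  argument below \<open>X\<close>: the factor from \<open>K_div_bound_far\<close> times the weighted
  tail of the mass.\<close>

definition far_const :: "real \<Rightarrow> real \<Rightarrow> real" where
  "far_const X \<eta> = 2 * C * (X / \<eta>) powr \<gamma> * (tail_const * \<eta> powr - \<delta>)"

lemma far_const_nonneg: "far_const X \<eta> \<ge> 0"
  unfolding far_const_def using C_pos tail_const_pos by simp

text \<open>Lipschitz constant of the far part of the flux on \<open>[r, R]\<close>. The first
  summand accounts for first arguments that enter the range of summation, the second for pairs whose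
  sum is passed.\<close>

definition modulus_const :: "real \<Rightarrow> real \<Rightarrow> real \<Rightarrow> real" where
  "modulus_const r R \<eta> = dens_const * weight (r / 2) * far_const R \<eta>
     + R powr \<sigma> * (2 * C * R powr \<gamma> / \<eta> * (dens_const * weight \<eta>))"

end

text \<open>\<open>h k\<close> is the mass at \<open>k / n\<close>, so the density is
  \<open>real n * h k\<close>. \<open>h_Suc\<close> discretises
  \<open>x H' = \<sigma> H + \<delta> J\<close> with the exact integrating factor: from
  \<open>k\<close> to \<open>k + 1\<close>, the quotient \<open>H / x powr \<sigma>\<close> changes
  by a flux term and nothing else. The last lattice point is \<open>n\<close> itself, where
  \<open>h_total\<close> prescribes the value \<open>1\<close> of this quotient.\<close>

locale lattice_solution = coagulation_kernel K \<gamma> C \<rho> for K \<gamma> C \<rho> +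
  fixes n :: nat and h :: "nat \<Rightarrow> real"
  assumes n_pos: "n \<ge> 1"
    and h_nonneg: "\<And>k. h k \<ge> 0" and h_0: "h 0 = 0" and h_beyond: "\<And>k. k > n\<^sup>2 \<Longrightarrow> h k = 0"
    and h_total: "(\<Sum>k=1..n\<^sup>2. h k) = real n powr (1 - \<rho>)"
    and h_Suc: "\<And>k. 1 \<le> k \<Longrightarrow> k < n\<^sup>2 \<Longrightarrow> h (Suc k) = ((1 + 1 / real k) powr (1 - \<rho>) - 1) * (\<Sum>j=1..k. h j)
      + (\<rho> - \<gamma>) / real k * (\<Sum>j=1..k. \<Sum>z=1..n\<^sup>2. if k < j + z
          then K (real j / real n) (real z / real n) / (real z / real n) * h j * h z else 0)"
begin

definition x :: "nat \<Rightarrow> real" where "x k = real k / real n"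
definition H :: "nat \<Rightarrow> real" where "H k = (\<Sum>j=1..k. h j)"
definition q :: "nat \<Rightarrow> nat \<Rightarrow> real" where "q j z = K (x j) (x z) / x z * h j * h z"
text \<open>The condition \<open>k < j + z\<close> selects the pairs that jump over
  \<open>x k\<close>; the predicate \<open>Q\<close> permits splitting them by the size of the
  partner.\<close>

definition J_part :: "(nat \<Rightarrow> bool) \<Rightarrow> nat \<Rightarrow> real" where
  "J_part Q k = (\<Sum>j=1..k. \<Sum>z=1..n\<^sup>2. if k < j + z \<and> Q z then q j z else 0)"
abbreviation J :: "nat \<Rightarrow> real" where "J \<equiv> J_part (\<lambda>_. True)"

lemma x_pos: "1 \<le> k \<Longrightarrow> x k > 0" and x_nonneg: "x k \<ge> 0"
  using n_pos by (auto simp: x_def)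

lemma x_le_iff: "x j \<le> x k \<longleftrightarrow> j \<le> k" and x_less_iff: "x j < x k \<longleftrightarrow> j < k"
  using n_pos by (auto simp: x_def divide_le_cancel divide_less_cancel)

lemma x_Suc: "x (Suc k) = x k + 1 / real n" by (simp add: x_def add_divide_distrib)

lemma x_Suc_mult: "1 \<le> k \<Longrightarrow> x (Suc k) = x k * (1 + 1 / real k)"
  by (simp add: x_def add_divide_distrib distrib_left)

lemma x_Suc_le: "1 \<le> k \<Longrightarrow> x (Suc k) \<le> 2 * x k"
  using n_pos by (simp add: x_def field_simps)

lemma x_last: "x (n\<^sup>2) = real n"
  using n_pos by (simp add: x_def power2_eq_square)

lemma H_Suc: "H (Suc k) = H k + h (Suc k)"
  by (simp add: H_def)

lemma H_mono: "k \<le> l \<Longrightarrow> H k \<le> H l"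
  unfolding H_def using h_nonneg by (intro sum_mono2) auto

lemma H_nonneg: "H k \<ge> 0"
  unfolding H_def using h_nonneg by (simp add: sum_nonneg)

lemma q_nonneg: "1 \<le> j \<Longrightarrow> 1 \<le> z \<Longrightarrow> q j z \<ge> 0"
  unfolding q_def by (intro mult_nonneg_nonneg divide_nonneg_nonneg h_nonneg K_nonneg x_pos x_nonneg)

lemma J_part_nonneg: "J_part Q k \<ge> 0"
  unfolding J_part_def by (intro sum_nonneg) (auto intro!: q_nonneg)

lemma recursion:
  assumes "1 \<le> k" "k < n\<^sup>2"
  shows "h (Suc k) = ((1 + 1 / real k) powr \<sigma> - 1) * H k + \<delta> / real k * J k"
  proof -
  have "J k = (\<Sum>j=1..k. \<Sum>z=1..n\<^sup>2. if k < j + z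
          then K (real j / real n) (real z / real n) / (real z / real n) * h j * h z else 0)"
    unfolding J_part_def q_def x_def by simp
  then show ?thesis unfolding H_def using h_Suc[OF assms] by (simp only:)
qed

text \<open>\<open>H k / x k powr \<sigma>\<close> is nondecreasing because the flux is nonnegative,
  and it is \<open>1\<close> at \<open>n\<^sup>2\<close>; hence the downward induction.\<close>

lemma H_le: "k \<le> n\<^sup>2 \<Longrightarrow> H k \<le> x k powr \<sigma>"
proof (induction k rule: inc_induct)
  case base
  then show ?case using h_total by (simp add: H_def x_last)
next
  case (step k)
  show ?case
  proof (cases "k = 0")
    case True then show ?thesis by (simp add: H_def)
  next
    case False
    then have k: "1 \<le> k" "k < n\<^sup>2" using step by auto
    have "\<delta> / real k * J k \<ge> 0" using sd J_part_nonneg by simp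
    then have "(1 + 1 / real k) powr \<sigma> * H k \<le> H (Suc k)"
      using recursion[OF k] by (simp add: H_Suc algebra_simps)
    also have "\<dots> \<le> x (Suc k) powr \<sigma>" using step by simp
    also have "\<dots> = (1 + 1 / real k) powr \<sigma> * x k powr \<sigma>"
      using k x_pos[OF k(1)] by (simp add: x_Suc_mult powr_mult)
    finally show ?thesis
    proof (rule mult_left_le_imp_le)
      have "0 < 1 + 1 / real k" by (simp add: add_pos_nonneg)
      then show "0 < (1 + 1 / real k) powr \<sigma>" by (metis powr_gt_zero less_irrefl)
    qed
  qed
qed

section \<open>Sums over near and far partners\<close>

lemma tail_sum:
  assumes "\<eta> > 0"
  shows "(\<Sum>z=1..n\<^sup>2. if \<eta> \<le> x z then x z powr (\<gamma> - 1) * h z else 0) \<le> tail_const * \<eta> powr - \<delta>"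
proof -
  \<comment> \<open>The first lattice index whose point is at least \<open>\<eta>\<close>; it may
    exceed \<open>n\<^sup>2\<close>, and then the sum is empty.\<close>
  define r where "r = nat \<lceil>\<eta> * real n\<rceil>"
  have r1: "1 \<le> r" using assms n_pos by (simp add: r_def Suc_le_eq)
  have iff: "\<eta> \<le> x z \<longleftrightarrow> r \<le> z" for z
    using n_pos by (simp add: x_def r_def field_simps ceiling_le_iff nat_le_iff)
  show ?thesis
  proof (cases "r \<le> n\<^sup>2")
    case True
    have "(\<Sum>z=1..n\<^sup>2. if \<eta> \<le> x z then x z powr (\<gamma> - 1) * h z else 0) = (\<Sum>z\<in>{z\<in>{1..n\<^sup>2}. r \<le> z}. x z powr (\<gamma> - 1) * h z)"
      unfolding iff by (rule sum.inter_filter[symmetric]) simp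
    also have "{z\<in>{1..n\<^sup>2}. r \<le> z} = {r..n\<^sup>2}" using r1 by auto
    also have "(\<Sum>z=r..n\<^sup>2. x z powr (\<gamma> - 1) * h z) = (\<Sum>z=r..n\<^sup>2. x z powr (- \<sigma> - \<delta>) * h z)"
      by (simp add: algebra_simps)
    also have "\<dots> \<le> (\<sigma> + \<delta>) / \<delta> * x r powr - \<delta>"
      using sd r1 True by (intro weighted_tail_sum_le x_pos h_nonneg H_le[unfolded H_def]) (auto simp: x_le_iff)
    also have "(\<sigma> + \<delta>) / \<delta> = tail_const" by (simp add: tail_const_def)
    also have "tail_const * x r powr - \<delta> \<le> tail_const * \<eta> powr - \<delta>"
      using tail_const_pos assms sd iff[of r] by (intro mult_left_mono powr_mono2') auto
    finally show ?thesis .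
  next
    case False
    then have "(\<Sum>z=1..n\<^sup>2. if \<eta> \<le> x z then x z powr (\<gamma> - 1) * h z else 0) = 0"
      unfolding iff by (intro sum.neutral) auto
    then show ?thesis using tail_const_pos by simp
  qed
qed

lemma head_sum:
  assumes "\<eta> > 0"
  shows "(\<Sum>z=1..n\<^sup>2. if x z < \<eta> then h z else 0) \<le> \<eta> powr \<sigma>"
proof -
  define Z where "Z = {z\<in>{1..n\<^sup>2}. x z < \<eta>}"
  have eq: "(\<Sum>z=1..n\<^sup>2. if x z < \<eta> then h z else 0) = (\<Sum>z\<in>Z. h z)"
    unfolding Z_def by (rule sum.inter_filter[symmetric]) simp
  show ?thesis
  proof (cases "Z = {}")
    case True then show ?thesis unfolding eq by simp
  next
    case False
    have "finite Z" by (simp add: Z_def)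
    then have m: "Max Z \<in> Z" "\<And>z. z \<in> Z \<Longrightarrow> z \<le> Max Z" using False by auto
    have "(\<Sum>z\<in>Z. h z) \<le> H (Max Z)"
      unfolding H_def using m h_nonneg by (intro sum_mono2) (auto simp: Z_def)
    also have "\<dots> \<le> x (Max Z) powr \<sigma>" using m by (intro H_le) (auto simp: Z_def)
    also have "\<dots> \<le> \<eta> powr \<sigma>" using m sd x_nonneg by (intro powr_mono2) (auto simp: Z_def)
    finally show ?thesis unfolding eq .
  qed
qed

lemma far_sum:
  assumes "1 \<le> j" "0 < \<eta>" "x j \<le> X" "\<eta> \<le> X"
  shows "(\<Sum>z=1..n\<^sup>2. if \<eta> \<le> x z then q j z else 0) \<le> h j * far_const X \<eta>"
proof -
  have "(\<Sum>z=1..n\<^sup>2. if \<eta> \<le> x z then q j z else 0)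
     \<le> (\<Sum>z=1..n\<^sup>2. h j * (2 * C * (X / \<eta>) powr \<gamma>) * (if \<eta> \<le> x z then x z powr (\<gamma> - 1) * h z else 0))"
  proof (rule sum_mono)
    fix z assume z: "z \<in> {1..n\<^sup>2}"
    show "(if \<eta> \<le> x z then q j z else 0)
      \<le> h j * (2 * C * (X / \<eta>) powr \<gamma>) * (if \<eta> \<le> x z then x z powr (\<gamma> - 1) * h z else 0)"
    proof (cases "\<eta> \<le> x z")
      case True
      have "K (x j) (x z) / x z * (h j * h z) \<le> 2 * C * (X / \<eta>) powr \<gamma> * x z powr (\<gamma> - 1) * (h j * h z)"
        using assms z True h_nonneg by (intro mult_right_mono K_div_bound_far x_pos) auto
      then show ?thesis using True by (simp add: q_def algebra_simps)
    qed simp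
  qed
  also have "\<dots> = h j * (2 * C * (X / \<eta>) powr \<gamma>) * (\<Sum>z=1..n\<^sup>2. if \<eta> \<le> x z then x z powr (\<gamma> - 1) * h z else 0)"
    by (simp add: sum_distrib_left)
  also have "\<dots> \<le> h j * (2 * C * (X / \<eta>) powr \<gamma>) * (tail_const * \<eta> powr - \<delta>)"
    using h_nonneg C_pos assms by (intro mult_left_mono tail_sum) auto
  finally show ?thesis by (simp add: far_const_def)
qed

text \<open>The first bound drops the jump condition altogether. In that form it also serves
  \<open>flux_sum_small_first\<close>, where the size of the partner has already been deduced from
  that condition.\<close>

lemma J_far:
  assumes "0 < \<eta>" "\<eta> \<le> X" "x k \<le> X"
  shows "(\<Sum>j\<in>{1..k}. \<Sum>z=1..n\<^sup>2. if \<eta> \<le> x z then q j z else 0) \<le> H k * far_const X \<eta>"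
    "J_part (\<lambda>z. \<eta> \<le> x z) k \<le> H k * far_const X \<eta>"
proof -
  have "x j \<le> X" if "j \<le> k" for j using assms that by (meson order_trans x_le_iff)
  then show 1: "(\<Sum>j\<in>{1..k}. \<Sum>z=1..n\<^sup>2. if \<eta> \<le> x z then q j z else 0) \<le> H k * far_const X \<eta>"
    unfolding H_def sum_distrib_right using assms by (intro sum_mono far_sum) auto
  have "J_part (\<lambda>z. \<eta> \<le> x z) k \<le> (\<Sum>j\<in>{1..k}. \<Sum>z=1..n\<^sup>2. if \<eta> \<le> x z then q j z else 0)"
    unfolding J_part_def by (intro sum_mono) (auto intro!: q_nonneg)
  with 1 show "J_part (\<lambda>z. \<eta> \<le> x z) k \<le> H k * far_const X \<eta>" by simp
qed

text \<open>A partner \<open>z\<close> lifts only the \<open>j\<close> in \<open>{k - z<..k}\<close> over \<open>k\<close>; their number cancels the factor \<open>1 / x z\<close>.\<close>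
lemma J_near:
  assumes eta: "0 < \<eta>" "\<eta> \<le> x k / 2" and M: "\<And>j. j \<le> k \<Longrightarrow> k < 2 * j \<Longrightarrow> real n * h j \<le> M"
  shows "J_part (\<lambda>z. x z < \<eta>) k \<le> 2 * C * x k powr \<gamma> * M * \<eta> powr \<sigma>"
proof -
  have k1: "1 \<le> k" using eta by (cases k) (auto simp: x_def)
  have M0: "M \<ge> 0" using M[of k] k1 h_nonneg[of k] by (smt (verit) le_refl mult_nonneg_nonneg of_nat_0_le_iff mult_2 less_add_same_cancel1 One_nat_def Suc_le_eq)
  define c where "c = 2 * C * x k powr \<gamma>"
  have c0: "c \<ge> 0" using C_pos by (simp add: c_def)
  have "J_part (\<lambda>z. x z < \<eta>) k = (\<Sum>z=1..n\<^sup>2. \<Sum>j=1..k. if k < j + z \<and> x z < \<eta> then q j z else 0)"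
    unfolding J_part_def by (rule sum.swap)
  also have "\<dots> \<le> (\<Sum>z=1..n\<^sup>2. c * M * (if x z < \<eta> then h z else 0))"
  proof (rule sum_mono)
    fix z assume z: "z \<in> {1..n\<^sup>2}"
    show "(\<Sum>j=1..k. if k < j + z \<and> x z < \<eta> then q j z else 0) \<le> c * M * (if x z < \<eta> then h z else 0)"
    proof (cases "x z < \<eta>")
      case True
      then have "x z < x k / 2" using eta by simp
      then have zk: "2 * z < k" using n_pos by (simp add: x_def field_simps)
      have xz: "x z > 0" using z by (intro x_pos) auto
      have "(\<Sum>j=1..k. if k < j + z \<and> x z < \<eta> then q j z else 0) = (\<Sum>j=1..k. if k < j + z then q j z else 0)"
        using True by simp
      also have "\<dots> = (\<Sum>j\<in>{j\<in>{1..k}. k < j + z}. q j z)"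
        by (rule sum.inter_filter[symmetric]) simp
      also have "\<dots> \<le> of_nat (card {j\<in>{1..k}. k < j + z}) * (c * M * h z / real z)"
      proof (rule sum_bounded_above)
        fix j assume j: "j \<in> {j\<in>{1..k}. k < j + z}"
        then have j': "1 \<le> j" "j \<le> k" "k < 2 * j" using zk by auto
        have "q j z = K (x j) (x z) / x z * (h j * h z)" by (simp add: q_def)
        also have "\<dots> \<le> c / x z * ((M / real n) * h z)"
        proof (intro mult_mono divide_right_mono)
          show "K (x j) (x z) \<le> c"
            unfolding c_def using j' z zk by (intro K_le_max x_pos) (auto simp: x_le_iff)
          show "h j \<le> M / real n" using M[OF j'(2,3)] n_pos by (simp add: field_simps)
        qed (use xz h_nonneg c0 M0 in \<open>auto simp: mult_nonneg_nonneg\<close>)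
        also have "\<dots> = c * M * h z / real z" using n_pos z by (simp add: x_def)
        finally show "q j z \<le> c * M * h z / real z" .
      qed
      also have "\<dots> \<le> of_nat z * (c * M * h z / real z)"
      proof (intro mult_right_mono)
        have "{j\<in>{1..k}. k < j + z} \<subseteq> {k - z<..k}" by auto
        then have "card {j\<in>{1..k}. k < j + z} \<le> card {k - z<..k}" by (intro card_mono) auto
        then show "real (card {j\<in>{1..k}. k < j + z}) \<le> real z" using zk by simp
      qed (use c0 M0 h_nonneg in auto)
      also have "\<dots> = c * M * (if x z < \<eta> then h z else 0)" using True z by simp
      finally show ?thesis .
    qed simp
  qed
  also have "\<dots> = c * M * (\<Sum>z=1..n\<^sup>2. if x z < \<eta> then h z else 0)" by (simp add: sum_distrib_left)
  also have "\<dots> \<le> c * M * \<eta> powr \<sigma>" using c0 M0 eta by (intro mult_left_mono head_sum) auto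
  finally show ?thesis by (simp add: c_def)
qed

lemma J_split: "J k = J_part (\<lambda>z. x z < \<eta>) k + J_part (\<lambda>z. \<eta> \<le> x z) k"
  unfolding J_part_def sum.distrib[symmetric] by (intro sum.cong) auto

section \<open>Bounds on density, flux and mass that are uniform in \<open>n\<close>\<close>

lemma J_le:
  assumes eta: "0 < \<eta>" "\<eta> \<le> x k / 2" and M: "\<And>j. j \<le> k \<Longrightarrow> k < 2 * j \<Longrightarrow> real n * h j \<le> M" and k: "k \<le> n\<^sup>2"
  shows "J k \<le> 2 * C * x k powr \<gamma> * M * \<eta> powr \<sigma> + 2 * C * tail_const * x k powr (\<sigma> + \<gamma>) * \<eta> powr - \<rho>"
proof -
  have xk: "x k > 0" using eta by simp
  have "J_part (\<lambda>z. \<eta> \<le> x z) k \<le> H k * far_const (x k) \<eta>"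
    using eta xk by (intro J_far(2)) auto
  also have "\<dots> \<le> x k powr \<sigma> * far_const (x k) \<eta>"
    by (intro mult_right_mono H_le k far_const_nonneg)
  also have "\<dots> = 2 * C * tail_const * (x k powr \<sigma> * x k powr \<gamma>) * (\<eta> powr - \<gamma> * \<eta> powr - \<delta>)"
    using eta xk by (simp add: far_const_def powr_divide powr_minus field_simps)
  also have "x k powr \<sigma> * x k powr \<gamma> = x k powr (\<sigma> + \<gamma>)" by (simp add: powr_add)
  also have "\<eta> powr - \<gamma> * \<eta> powr - \<delta> = \<eta> powr - \<rho>" by (simp add: powr_add[symmetric])
  finally show ?thesis using J_near[OF eta M] J_split[of k \<eta>] by simp
qed

lemma h_Suc_le:
  assumes k: "1 \<le> k" "k < n\<^sup>2"
  shows "real n * h (Suc k) \<le> x k powr - \<rho> + \<delta> * J k / x k"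
proof -
  have xk: "x k > 0" using k x_pos by simp
  have "(1 + 1 / real k) powr \<sigma> \<le> (1 + 1 / real k) powr 1" using sd by (intro powr_mono) auto
  then have "((1 + 1 / real k) powr \<sigma> - 1) * H k \<le> (1 / real k) * H k"
    using H_nonneg by (intro mult_right_mono) auto
  also have "\<dots> \<le> (1 / real k) * x k powr \<sigma>" using k by (intro mult_left_mono H_le) auto
  finally have "real n * h (Suc k) \<le> real n * ((1 / real k) * x k powr \<sigma> + \<delta> / real k * J k)"
    using recursion[OF k] by (intro mult_left_mono) auto
  also have "\<dots> = x k powr \<sigma> / x k + \<delta> * J k / x k" using k n_pos by (simp add: x_def field_simps)
  also have "x k powr \<sigma> / x k = x k powr - \<rho>" using xk by (simp add: powr_diff powr_minus field_simps)
  finally show ?thesis .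
qed

text \<open>A maximum principle for \<open>real n * h k / weight (x k)\<close>. The maximum
  \<open>M\<close> exists because the lattice is finite, and at a maximising index the recursion
  bounds it by \<open>dens_const / 2 + M / 2\<close>, where the constant does not depend on
  \<open>n\<close>.\<close>

lemma density_le:
  assumes "1 \<le> k" "k \<le> n\<^sup>2"
  shows "real n * h k \<le> dens_const * weight (x k)"
proof -
  define m where "m j = real n * h j / weight (x j)" for j
  define M where "M = Max (m ` {1..n\<^sup>2})"
  have N1: "n\<^sup>2 \<ge> 1" using n_pos by simp
  have fin: "finite (m ` {1..n\<^sup>2})" "m ` {1..n\<^sup>2} \<noteq> {}" using N1 by auto
  have mM: "m j \<le> M" if "1 \<le> j" "j \<le> n\<^sup>2" for j
    unfolding M_def using fin that by (intro Max_ge) auto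
  obtain l where l: "1 \<le> l" "l \<le> n\<^sup>2" "M = m l"
    using Max_in[OF fin] unfolding M_def by auto
  have m_nonneg: "m j \<ge> 0" for j unfolding m_def using h_nonneg weight_nonneg by simp
  have hM: "real n * h j \<le> M * weight (x j)" if "1 \<le> j" "j \<le> n\<^sup>2" for j
    using mM[OF that] weight_pos[OF x_pos[OF that(1)]] by (simp add: m_def field_simps)
  have "M \<le> dens_const"
  proof (cases "l = 1")
    case True
    \<comment> \<open>Index \<open>1\<close> is not produced by the recursion; the mass bound alone
      controls it.\<close>
    have "h 1 \<le> x 1 powr \<sigma>" using H_le[of 1] N1 by (simp add: H_def)
    then have "real n * h 1 \<le> real n * x 1 powr \<sigma>" by (intro mult_left_mono) auto
    also have "\<dots> = x 1 powr - \<rho>" using n_pos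
      by (simp add: x_def powr_divide powr_minus powr_diff field_simps)
    also have "\<dots> \<le> weight (x 1)" by (rule powr_le_weight)
    finally have "m 1 \<le> 1" using weight_pos[OF x_pos[of 1]] by (simp add: m_def)
    then show ?thesis using True l dens_const_ge by simp
  next
    case False
    then obtain k where lk: "l = Suc k" "1 \<le> k" using l by (cases l) auto
    then have k: "1 \<le> k" "k < n\<^sup>2" using l by auto
    define y where "y = x k"
    have y: "y > 0" using k x_pos by (simp add: y_def)
    define W where "W = weight y"
    have W: "W > 0" using y weight_pos by (simp add: W_def)
    note cb = cutoff_bounds[OF y]
    have M0: "M \<ge> 0" using l m_nonneg by simp
    \<comment> \<open>Partners below the cutoff lift only indices \<open>j\<close> with
      \<open>k < 2 * j\<close>, where the density is at most \<open>M * weight (x j)\<close>; one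
      use of doubling replaces the weight by the one at \<open>x k\<close>.\<close>
    have Jk: "J k \<le> 2 * C * y powr \<gamma> * (M * (doubling * W)) * cutoff y powr \<sigma>
        + 2 * C * tail_const * y powr (\<sigma> + \<gamma>) * cutoff y powr - \<rho>"
      unfolding y_def
    proof (rule J_le)
      fix j assume j: "j \<le> k" "k < 2 * j"
      then have "real n * h j \<le> M * weight (x j)" using k by (intro hM) auto
      also have "\<dots> \<le> M * (doubling * W)" unfolding W_def y_def
        using j n_pos k M0 x_pos[OF k(1)] by (intro mult_left_mono weight_doubling) (auto simp: x_def field_simps)
      finally show "real n * h j \<le> M * (doubling * W)" .
    qed (use cb k in \<open>auto simp: y_def\<close>)
    have "real n * h l \<le> y powr - \<rho> + \<delta> / y * J k"
      using h_Suc_le[OF k] lk by (simp add: y_def)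
    also have "\<dots> \<le> W + \<delta> / y * (2 * C * y powr \<gamma> * (M * (doubling * W)) * cutoff y powr \<sigma>
        + 2 * C * tail_const * y powr (\<sigma> + \<gamma>) * cutoff y powr - \<rho>)"
      using Jk y sd powr_le_weight[of y] unfolding W_def by (intro add_mono mult_left_mono) auto
    also have "\<dots> = W + 2 * C * \<delta> * M * doubling * W * (y powr \<gamma> / y * cutoff y powr \<sigma>)
        + 2 * C * \<delta> * tail_const * (y powr (\<sigma> + \<gamma>) / y * cutoff y powr - \<rho>)"
      using y by (simp add: field_simps)
    also have "y powr \<gamma> / y = y powr (\<gamma> - 1)" using y by (simp add: powr_diff)
    also have "y powr (\<sigma> + \<gamma>) / y = y powr - \<delta>"
    proof -
      have "y powr (\<sigma> + \<gamma> - 1) = y powr (\<sigma> + \<gamma>) / y powr 1" by (rule powr_diff)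
      moreover have "\<sigma> + \<gamma> - 1 = - \<delta>" "y powr 1 = y" using y by auto
      ultimately show ?thesis by (simp only:)
    qed
    also have "W + 2 * C * \<delta> * M * doubling * W * (y powr (\<gamma> - 1) * cutoff y powr \<sigma>)
        + 2 * C * \<delta> * tail_const * (y powr - \<delta> * cutoff y powr - \<rho>)
      \<le> W + 2 * C * \<delta> * M * doubling * W * cut powr \<sigma>
        + 2 * C * \<delta> * tail_const * (cut powr - \<rho> * W)"
      using cb C_pos sd M0 doubling_ge_1 W tail_const_pos unfolding W_def
      by (intro add_mono mult_left_mono) auto
    also have "\<dots> = (1 + 2 * C * \<delta> * M * doubling * cut powr \<sigma> + 2 * C * \<delta> * tail_const * cut powr - \<rho>) * W"
      by (simp add: algebra_simps)
    \<comment> \<open>The second use of doubling, from \<open>x k\<close> to the maximising point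
      \<open>x (Suc k)\<close>.\<close>
    also have "\<dots> \<le> (1 + 2 * C * \<delta> * M * doubling * cut powr \<sigma> + 2 * C * \<delta> * tail_const * cut powr - \<rho>)
        * (doubling * weight (x l))"
      unfolding W_def y_def lk(1) using C_pos sd M0 doubling_ge_1 tail_const_pos x_Suc_le[OF k(1)] x_pos[of "Suc k"]
      by (intro mult_left_mono weight_doubling add_nonneg_nonneg) auto
    also have "\<dots> = (dens_const / 2 + M / 2 * (4 * C * \<delta> * doubling\<^sup>2 * cut powr \<sigma>)) * weight (x l)"
      by (simp add: dens_const_def field_simps power2_eq_square)
    also have "\<dots> \<le> (dens_const / 2 + M / 2 * 1) * weight (x l)"
      using cut_bounds(3) M0 weight_nonneg by (intro mult_right_mono add_left_mono mult_left_mono) auto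
    finally have "m l \<le> dens_const / 2 + M / 2"
      using weight_pos[OF x_pos[OF l(1)]] by (simp add: m_def field_simps)
    then show ?thesis using l by simp
  qed
  then have "M * weight (x k) \<le> dens_const * weight (x k)" using weight_nonneg by (intro mult_right_mono)
  with hM[OF assms] show ?thesis by simp
qed

lemma density_le':
  assumes "0 < r" "r \<le> x j" "j \<le> n\<^sup>2"
  shows "real n * h j \<le> dens_const * weight r"
proof -
  have "1 \<le> j" using assms by (cases j) (auto simp: x_def)
  then have "real n * h j \<le> dens_const * weight (x j)" using assms by (intro density_le)
  also have "\<dots> \<le> dens_const * weight r" using dens_const_ge assms by (intro mult_left_mono weight_antimono) auto
  finally show ?thesis .
qed

text \<open>With the density already bounded there is nothing left to absorb, so the threshold can
  simply be half of \<open>x k\<close>.\<close>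

lemma J_le_flux_bound:
  assumes k: "1 \<le> k" "k \<le> n\<^sup>2"
  shows "J k \<le> flux_bound (x k)"
proof -
  define y where "y = x k"
  have y: "y > 0" using k x_pos by (simp add: y_def)
  have "J k \<le> 2 * C * y powr \<gamma> * (dens_const * (doubling * weight y)) * (y / 2) powr \<sigma>
        + 2 * C * tail_const * y powr (\<sigma> + \<gamma>) * (y / 2) powr - \<rho>"
    unfolding y_def
  proof (rule J_le)
    fix j assume j: "j \<le> k" "k < 2 * j"
    then have "real n * h j \<le> dens_const * weight (x j)" using k by (intro density_le) auto
    also have "\<dots> \<le> dens_const * (doubling * weight (x k))"
      using j n_pos k dens_const_ge x_pos[OF k(1)] by (intro mult_left_mono weight_doubling) (auto simp: x_def field_simps)
    finally show "real n * h j \<le> dens_const * (doubling * weight (x k))" .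
  qed (use y k in \<open>auto simp: y_def\<close>)
  also have "\<dots> \<le> 2 * C * y powr \<gamma> * (dens_const * (doubling * weight y)) * y powr \<sigma>
        + 2 * C * tail_const * y powr (\<sigma> + \<gamma>) * (2 * y powr - \<rho>)"
  proof (intro add_mono mult_left_mono)
    show "(y / 2) powr \<sigma> \<le> y powr \<sigma>" using y sd by (intro powr_mono2) auto
    have "2 powr \<rho> \<le> (2::real) powr 1" using rho by (intro powr_mono) auto
    then have "2 powr \<rho> * y powr - \<rho> \<le> 2 * y powr - \<rho>" by (intro mult_right_mono) auto
    then show "(y / 2) powr - \<rho> \<le> 2 * y powr - \<rho>" using y by (simp add: powr_divide powr_minus field_simps)
  qed (use C_pos dens_const_ge doubling_ge_1 weight_nonneg tail_const_pos in auto)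
  also have "\<dots> = 2 * C * doubling * dens_const * (y powr \<gamma> * y powr \<sigma>) * weight y
     + 4 * C * tail_const * (y powr (\<sigma> + \<gamma>) * y powr - \<rho>)" by simp
  also have "y powr \<gamma> * y powr \<sigma> = y powr (\<gamma> + \<sigma>)" by (simp add: powr_add)
  also have "y powr (\<sigma> + \<gamma>) * y powr - \<rho> = y powr (\<sigma> - \<delta>)"
    by (simp add: powr_add[symmetric] algebra_simps)
  finally show ?thesis by (simp add: flux_bound_def y_def)
qed

text \<open>Pulls the normalisation at \<open>n\<close> back to fixed points. Each increment of
  \<open>H / x powr \<sigma>\<close> is a flux term of order
  \<open>x powr (- 1 - \<delta>) / n\<close>, and these telescope to a multiple of
  \<open>x powr - \<delta>\<close>. The constant is independent of \<open>n\<close>, so the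
  normalisation is not lost in the limit.\<close>

lemma H_ge:
  assumes "1 \<le> x k" "k \<le> n\<^sup>2"
  shows "H k \<ge> x k powr \<sigma> * (1 - flux_const * 2 powr (1 + \<delta>) * x k powr - \<delta>)"
proof -
  define B where "B = flux_const * 2 powr (1 + \<delta>)"
  have FC: "flux_const \<ge> 0" using C_pos doubling_ge_1 dens_const_ge tail_const_pos by (simp add: flux_const_def)
  have "1 \<le> x k \<Longrightarrow> 1 \<le> H k / x k powr \<sigma> + B * x k powr - \<delta>"
    using assms(2)
  proof (induction k rule: inc_induct)
    case base
    have "H (n\<^sup>2) = real n powr \<sigma>" using h_total by (simp add: H_def)
    then have "H (n\<^sup>2) / x (n\<^sup>2) powr \<sigma> = 1" using n_pos by (simp add: x_last)
    moreover have "B * x (n\<^sup>2) powr - \<delta> \<ge> 0" using FC by (simp add: B_def)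
    ultimately show ?case by linarith
  next
    case (step k)
    have k: "1 \<le> k" using step.prems by (cases k) (auto simp: x_def)
    have xk: "x k > 0" "x (Suc k) > 0" using k x_pos by auto
    have x1: "1 \<le> x (Suc k)" "x k \<le> x (Suc k)" using step.prems x_le_iff[of k "Suc k"] by auto
    have "H (Suc k) / x (Suc k) powr \<sigma> = H k / x k powr \<sigma> + \<delta> / real k * J k / x (Suc k) powr \<sigma>"
    proof -
      have "H (Suc k) = (1 + 1 / real k) powr \<sigma> * H k + \<delta> / real k * J k"
        using recursion[of k] k step by (simp add: H_Suc algebra_simps)
      moreover have "x (Suc k) powr \<sigma> = (1 + 1 / real k) powr \<sigma> * x k powr \<sigma>"
        using k xk by (simp add: x_Suc_mult powr_mult)
      moreover have "(1 + 1 / real k) powr \<sigma> \<noteq> 0" using k by (simp add: add_pos_nonneg order.strict_implies_not_eq[symmetric])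
      ultimately show ?thesis by (simp add: add_divide_distrib)
    qed
    moreover have "\<delta> / real k * J k / x (Suc k) powr \<sigma> \<le> B * (x k powr - \<delta> - x (Suc k) powr - \<delta>)"
    proof -
      have "J k \<le> flux_const * x k powr (\<sigma> - \<delta>)"
        using J_le_flux_bound[of k] flux_bound_large[OF step.prems] k step by linarith
      then have "\<delta> / real k * J k \<le> \<delta> / real k * (flux_const * x k powr (\<sigma> - \<delta>))"
        using sd by (intro mult_left_mono) auto
      then have "\<delta> / real k * J k / x (Suc k) powr \<sigma> \<le> \<delta> / real k * (flux_const * x k powr (\<sigma> - \<delta>)) / x k powr \<sigma>"
        using sd xk x1 FC J_part_nonneg by (intro frac_le powr_mono2) auto
      also have "x k powr (\<sigma> - \<delta>) = x k powr \<sigma> * x k powr - \<delta>" by (simp add: powr_add[symmetric])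
      also have "\<delta> / real k * (flux_const * (x k powr \<sigma> * x k powr - \<delta>)) / x k powr \<sigma>
          = \<delta> * flux_const * (1 / real k * x k powr - \<delta>)"
        using xk by simp
      also have "1 / real k * x k powr - \<delta> = (x (Suc k) - x k) * x k powr (- 1 - \<delta>)"
      proof -
        have "x k powr (- \<delta> - 1) = x k powr - \<delta> / x k powr 1" by (rule powr_diff)
        then have "x k powr (- 1 - \<delta>) = x k powr - \<delta> / x k" using xk by (simp add: algebra_simps)
        moreover have "x (Suc k) - x k = x k / real k" unfolding x_Suc using k by (simp add: x_def)
        ultimately show ?thesis using xk by simp
      qed
      also have "\<delta> * flux_const * ((x (Suc k) - x k) * x k powr (- 1 - \<delta>))
          \<le> \<delta> * flux_const * (2 powr (1 + \<delta>) / \<delta> * (x k powr - \<delta> - x (Suc k) powr - \<delta>))"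
        using sd FC xk x1 x_Suc_le[OF k] by (intro mult_left_mono powr_minus_diff_ge) auto
      also have "\<dots> = B * (x k powr - \<delta> - x (Suc k) powr - \<delta>)" using sd by (simp add: B_def)
      finally show ?thesis .
    qed
    ultimately show ?case using step.IH[OF x1(1)] by (simp add: algebra_simps)
  qed
  then have "1 - B * x k powr - \<delta> \<le> H k / x k powr \<sigma>" using assms by simp
  moreover have "x k powr \<sigma> > 0" using assms by simp
  ultimately show ?thesis by (simp add: B_def field_simps)
qed

section \<open>Moduli of continuity of mass and flux, uniform in \<open>n\<close>\<close>

lemma H_diff:
  assumes "0 < r" "r \<le> x k" "k \<le> l" "l \<le> n\<^sup>2"
  shows "H l - H k \<le> dens_const * weight r * (x l - x k)"
  using assms(3,4)
proof (induction l rule: dec_induct)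
  case (step l)
  have "r \<le> x (Suc l)" using assms(2) step x_le_iff[of k "Suc l"] by simp
  then have "h (Suc l) \<le> dens_const * weight r * (1 / real n)"
    using density_le'[OF assms(1), of "Suc l"] step n_pos by (simp add: field_simps)
  with step show ?case by (simp add: H_Suc x_Suc algebra_simps)
qed simp

text \<open>The near part is merely bounded, by the first term, and becomes small through the later
  choice of \<open>\<eta>\<close>. From \<open>k\<close> to \<open>l\<close> the far part gains
  pairs with \<open>k < j\<close> and loses pairs with \<open>k < j + z \<le> l\<close>; both
  changes are proportional to \<open>x l - x k\<close>.\<close>

lemma J_diff:
  assumes r: "0 < r" "r \<le> x k" and kl: "k \<le> l" "l \<le> n\<^sup>2" and R: "x l \<le> R" and eta: "0 < \<eta>" "\<eta> \<le> r / 2"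
  shows "\<bar>J l - J k\<bar> \<le> 4 * C * R powr \<gamma> * (dens_const * weight (r / 2)) * \<eta> powr \<sigma>
           + modulus_const r R \<eta> * (x l - x k)"
proof -
  define M where "M = dens_const * weight (r / 2)"
  define c where "c = 2 * C * R powr \<gamma> * M * \<eta> powr \<sigma>"
  have M0: "M \<ge> 0" unfolding M_def using dens_const_ge weight_nonneg by simp
  have xkl: "x k \<le> x l" using kl x_le_iff by simp
  have near: "J_part (\<lambda>z. x z < \<eta>) m \<le> c" if m: "k \<le> m" "m \<le> l" for m
  proof -
    have xm: "r \<le> x m" "x m \<le> R" using m r R x_le_iff[of k m] x_le_iff[of m l] by auto
    have "J_part (\<lambda>z. x z < \<eta>) m \<le> 2 * C * x m powr \<gamma> * M * \<eta> powr \<sigma>"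
    proof (rule J_near)
      fix j assume j: "j \<le> m" "m < 2 * j"
      then have "x m < 2 * x j" using n_pos by (simp add: x_def field_simps)
      then show "real n * h j \<le> M" unfolding M_def using r xm j m kl by (intro density_le') auto
    qed (use eta r xm in auto)
    also have "\<dots> \<le> c" unfolding c_def
      using C_pos M0 xm r gamma by (intro mult_right_mono mult_left_mono powr_mono2) auto
    finally show ?thesis .
  qed
  \<comment> \<open>Moving \<open>j \<le> m\<close> into the summand turns the fluxes at
    \<open>k\<close> and \<open>l\<close> into sums over the same range \<open>1..l\<close>.\<close>
  define F where "F = (\<lambda>m j z. if j \<le> m \<and> m < j + z \<and> \<eta> \<le> x z then q j z else 0)"
  have JF: "J_part (\<lambda>z. \<eta> \<le> x z) m = (\<Sum>j=1..l. \<Sum>z=1..n\<^sup>2. F m j z)" if "m \<le> l" for m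
  proof -
    have "(\<Sum>j=1..l. \<Sum>z=1..n\<^sup>2. F m j z) = (\<Sum>j=1..m. \<Sum>z=1..n\<^sup>2. F m j z)"
      using that by (intro sum.mono_neutral_right) (auto simp: F_def)
    also have "\<dots> = J_part (\<lambda>z. \<eta> \<le> x z) m" unfolding J_part_def F_def by (intro sum.cong) auto
    finally show ?thesis ..
  qed
  define E1 where "E1 = (\<Sum>j=1..l. \<Sum>z=1..n\<^sup>2. if k < j \<and> \<eta> \<le> x z then q j z else 0)"
  define E2 where "E2 = (\<Sum>j=1..l. \<Sum>z=1..n\<^sup>2. if k < j + z \<and> j + z \<le> l \<and> \<eta> \<le> x z then q j z else 0)"
  have "\<bar>J_part (\<lambda>z. \<eta> \<le> x z) l - J_part (\<lambda>z. \<eta> \<le> x z) k\<bar> \<le> (\<Sum>j=1..l. \<Sum>z=1..n\<^sup>2. \<bar>F l j z - F k j z\<bar>)"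
    unfolding JF[OF order_refl] JF[OF kl(1)] sum_subtractf[symmetric]
    by (rule order_trans[OF sum_abs], rule sum_mono, rule sum_abs)
  also have "\<dots> \<le> E1 + E2"
    unfolding E1_def E2_def sum.distrib[symmetric]
  proof (intro sum_mono)
    fix j z assume "j \<in> {1..l}" "z \<in> {1..n\<^sup>2}"
    then have "q j z \<ge> 0" by (intro q_nonneg) auto
    with \<open>j \<in> {1..l}\<close> kl show "\<bar>F l j z - F k j z\<bar> \<le> (if k < j \<and> \<eta> \<le> x z then q j z else 0)
        + (if k < j + z \<and> j + z \<le> l \<and> \<eta> \<le> x z then q j z else 0)"
      by (auto simp: F_def)
  qed
  finally have diff: "\<bar>J_part (\<lambda>z. \<eta> \<le> x z) l - J_part (\<lambda>z. \<eta> \<le> x z) k\<bar> \<le> E1 + E2" .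
  have "E1 \<le> (\<Sum>j=1..l. if k < j then h j * far_const R \<eta> else 0)"
    unfolding E1_def
  proof (intro sum_mono)
    fix j assume j: "j \<in> {1..l}"
    have "x j \<le> R" using j R x_le_iff[of j l] by auto
    then show "(\<Sum>z=1..n\<^sup>2. if k < j \<and> \<eta> \<le> x z then q j z else 0) \<le> (if k < j then h j * far_const R \<eta> else 0)"
      using far_sum[of j \<eta> R] j eta r R xkl by auto
  qed
  also have "\<dots> = (\<Sum>j=1..l. if k < j then h j else 0) * far_const R \<eta>"
    by (simp add: sum_distrib_right if_distrib[of "\<lambda>t. t * _"] cong: if_cong)
  also have "(\<Sum>j=1..l. if k < j then h j else 0) = H l - H k"
  proof -
    have "H l = (\<Sum>j=1..l. (if k < j then h j else 0) + (if j \<le> k then h j else 0))"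
      unfolding H_def by (intro sum.cong) auto
    also have "\<dots> = (\<Sum>j=1..l. if k < j then h j else 0) + (\<Sum>j=1..l. if j \<le> k then h j else 0)"
      by (rule sum.distrib)
    also have "(\<Sum>j=1..l. if j \<le> k then h j else 0) = H k"
    proof -
      have "(\<Sum>j=1..l. if j \<le> k then h j else 0) = sum h {j\<in>{1..l}. j \<le> k}" by (rule sum.inter_filter[symmetric]) simp
      also have "{j\<in>{1..l}. j \<le> k} = {1..k}" using kl by auto
      finally show ?thesis by (simp add: H_def)
    qed
    finally show ?thesis by simp
  qed
  also have "(H l - H k) * far_const R \<eta> \<le> M * (x l - x k) * far_const R \<eta>"
    unfolding M_def using r kl H_diff[of "r/2" k l] by (intro mult_right_mono far_const_nonneg) auto
  finally have E1: "E1 \<le> M * far_const R \<eta> * (x l - x k)" by (simp add: algebra_simps)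
  define M2 where "M2 = dens_const * weight \<eta>"
  have M20: "M2 \<ge> 0" unfolding M2_def using dens_const_ge weight_nonneg by simp
  define b where "b = 2 * C * R powr \<gamma> / \<eta> * M2 / real n"
  have b0: "b \<ge> 0" unfolding b_def using C_pos eta M20 by simp
  \<comment> \<open>For fixed \<open>j\<close>, at most \<open>l - k\<close> partners bring the sum
    \<open>j + z\<close> into \<open>{k<..l}\<close>, and each carries mass at most
    \<open>M2 / real n\<close> because it lies beyond \<open>\<eta>\<close>.\<close>
  have "E2 \<le> (\<Sum>j=1..l. h j * (b * real (l - k)))"
    unfolding E2_def
  proof (intro sum_mono)
    fix j assume j: "j \<in> {1..l}"
    let ?Z = "{z\<in>{1..n\<^sup>2}. k < j + z \<and> j + z \<le> l \<and> \<eta> \<le> x z}"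
    have "(\<Sum>z=1..n\<^sup>2. if k < j + z \<and> j + z \<le> l \<and> \<eta> \<le> x z then q j z else 0) = (\<Sum>z\<in>?Z. q j z)"
      by (rule sum.inter_filter[symmetric]) simp
    also have "\<dots> \<le> of_nat (card ?Z) * (h j * b)"
    proof (rule sum_bounded_above)
      fix z assume z: "z \<in> ?Z"
      then have xz: "x z > 0" "x z \<le> R" "\<eta> \<le> x z" using eta R x_le_iff[of z l] by auto
      have xj: "x j > 0" "x j \<le> R" using j R x_le_iff[of j l] x_pos by auto
      have "q j z = h j * (K (x j) (x z) / x z * h z)" by (simp add: q_def)
      also have "\<dots> \<le> h j * (2 * C * R powr \<gamma> / \<eta> * (M2 / real n))"
      proof (intro mult_left_mono mult_mono frac_le)
        show "K (x j) (x z) \<le> 2 * C * R powr \<gamma>" using xz xj by (intro K_le_max)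
        show "h z \<le> M2 / real n"
          using density_le'[OF eta(1) xz(3)] z n_pos by (simp add: M2_def field_simps)
      qed (use xz xj h_nonneg K_nonneg C_pos eta in auto)
      finally show "q j z \<le> h j * b" by (simp add: b_def)
    qed
    also have "\<dots> \<le> of_nat (l - k) * (h j * b)"
    proof (intro mult_right_mono of_nat_mono)
      have "card ?Z = card ((\<lambda>z. j + z) ` ?Z)" by (intro card_image[symmetric]) (auto simp: inj_on_def)
      also have "\<dots> \<le> card {k<..l}" by (intro card_mono) auto
      finally show "card ?Z \<le> l - k" by simp
    qed (use h_nonneg b0 in auto)
    also have "\<dots> = h j * (b * real (l - k))" by simp
    finally show "(\<Sum>z=1..n\<^sup>2. if k < j + z \<and> j + z \<le> l \<and> \<eta> \<le> x z then q j z else 0) \<le> h j * (b * real (l - k))" .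
  qed
  also have "\<dots> = H l * (b * real (l - k))" by (simp add: H_def sum_distrib_right)
  also have "\<dots> \<le> R powr \<sigma> * (b * real (l - k))"
  proof (intro mult_right_mono)
    have "H l \<le> x l powr \<sigma>" using kl by (intro H_le)
    also have "\<dots> \<le> R powr \<sigma>" using R sd x_nonneg by (intro powr_mono2) auto
    finally show "H l \<le> R powr \<sigma>" .
  qed (use b0 in auto)
  also have "b * real (l - k) = 2 * C * R powr \<gamma> / \<eta> * M2 * (x l - x k)"
    using kl by (simp add: b_def x_def of_nat_diff diff_divide_distrib[symmetric])
  finally have E2: "E2 \<le> R powr \<sigma> * (2 * C * R powr \<gamma> / \<eta> * M2) * (x l - x k)" by (simp add: algebra_simps)
  have "\<bar>J l - J k\<bar> \<le> 2 * c + (E1 + E2)"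
    using near[of k] near[of l] kl J_part_nonneg[of "\<lambda>z. x z < \<eta>" k] J_part_nonneg[of "\<lambda>z. x z < \<eta>" l] diff
      J_split[of l \<eta>] J_split[of k \<eta>] by auto
  also have "\<dots> \<le> 2 * c + modulus_const r R \<eta> * (x l - x k)"
    using E1 E2 by (simp add: modulus_const_def M_def M2_def algebra_simps)
  also have "2 * c = 4 * C * R powr \<gamma> * (dens_const * weight (r / 2)) * \<eta> powr \<sigma>" by (simp add: c_def M_def)
  finally show ?thesis .
qed

end

lemma (in coagulation_kernel) lattice_solution_exists:
  assumes n: "n \<ge> 1"
  shows "\<exists>h. lattice_solution K \<gamma> C \<rho> n h"
proof -
  \<comment> \<open>The restriction to positive \<open>j\<close> and \<open>z\<close> makes
    \<open>W\<close> nonnegative at all indices, \<open>K\<close> being controlled only at positive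
    arguments.\<close>
  define W where "W k j z = (if 1 \<le> j \<and> 1 \<le> z \<and> k < j + z
      then \<delta> / real k * (K (real j / real n) (real z / real n) / (real z / real n)) else 0)" for k j z :: nat
  have W0: "W k j z \<ge> 0" for k j z
    unfolding W_def using sd n by (auto intro!: mult_nonneg_nonneg divide_nonneg_nonneg K_nonneg)
  have a0: "(1 + 1 / real k) powr \<sigma> - 1 \<ge> 0" for k
    using ge_one_powr_ge_zero[of "1 + 1 / real k" \<sigma>] sd by simp
  have n2: "n\<^sup>2 \<ge> 1" "real n powr \<sigma> > 0" using n by auto
  from quadratic_volterra_solution[of "\<lambda>k. (1 + 1 / real k) powr \<sigma> - 1" W "real n powr \<sigma>" "n\<^sup>2", OF a0 W0 n2(2,1)]
  obtain h where h: "\<And>k. h k \<ge> 0" "h 0 = 0" "\<And>k. k > n\<^sup>2 \<Longrightarrow> h k = 0" "(\<Sum>k=1..n\<^sup>2. h k) = real n powr \<sigma>"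
    "\<And>k. 1 \<le> k \<Longrightarrow> k < n\<^sup>2 \<Longrightarrow>
        h (Suc k) = ((1 + 1 / real k) powr \<sigma> - 1) * (\<Sum>j=1..k. h j) + (\<Sum>j=1..k. \<Sum>z=1..n\<^sup>2. W k j z * h j * h z)"
    by blast
  have "(\<Sum>j=1..k. \<Sum>z=1..n\<^sup>2. W k j z * h j * h z) = \<delta> / real k * (\<Sum>j=1..k. \<Sum>z=1..n\<^sup>2. if k < j + z
          then K (real j / real n) (real z / real n) / (real z / real n) * h j * h z else 0)" for k
    unfolding sum_distrib_left by (intro sum.cong) (auto simp: W_def mult_ac)
  with h have "lattice_solution K \<gamma> C \<rho> n h"
    by unfold_locales (use n in simp_all)
  then show ?thesis by blast
qed

section \<open>Lattice functions as functions on the half-line\<close>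

text \<open>For \<open>y \<ge> 0\<close> the index of the half-open cell
  \<open>[k/n, (k+1)/n)\<close> that contains \<open>y\<close>. Since \<open>nat\<close> sends every
  negative argument to \<open>0\<close>, the integrands below carry the condition
  \<open>0 \<le> y\<close>.\<close>

definition cell :: "nat \<Rightarrow> real \<Rightarrow> nat" where "cell n y = nat \<lfloor>real n * y\<rfloor>"

lemma cell_bounds:
  assumes "n \<ge> 1" "y \<ge> 0"
  shows "real (cell n y) / real n \<le> y" "y < real (Suc (cell n y)) / real n"
proof -
  have "real (cell n y) \<le> real n * y" "real n * y < real (cell n y) + 1"
    using assms by (auto simp: cell_def)
  then show "real (cell n y) / real n \<le> y" "y < real (Suc (cell n y)) / real n"
    using assms by (auto simp: field_simps)
qed

lemma cell_mono: "x \<le> y \<Longrightarrow> cell n x \<le> cell n y"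
  unfolding cell_def by (intro nat_mono floor_mono mult_left_mono) auto

lemma cell_eq_iff:
  assumes "n \<ge> 1" "y \<ge> 0"
  shows "cell n y = k \<longleftrightarrow> real k / real n \<le> y \<and> y < real (Suc k) / real n"
proof -
  have "cell n y = k \<longleftrightarrow> \<lfloor>real n * y\<rfloor> = int k" using assms by (auto simp: cell_def)
  also have "\<dots> \<longleftrightarrow> real k \<le> real n * y \<and> real n * y < real k + 1" by (simp add: floor_eq_iff)
  also have "\<dots> \<longleftrightarrow> real k / real n \<le> y \<and> y < real (Suc k) / real n" using assms by (simp add: field_simps)
  finally show ?thesis .
qed

lemma cell_measurable [measurable]: "cell n \<in> borel \<rightarrow>\<^sub>M count_space UNIV"
  unfolding cell_def by measurable

lemma cell_tendsto:
  assumes \<nu>: "filterlim \<nu> at_top sequentially" and y: "y \<ge> 0"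
  shows "(\<lambda>m. real (cell (\<nu> m) y) / real (\<nu> m)) \<longlonglongrightarrow> y"
    "(\<lambda>m. real (Suc (cell (\<nu> m) y)) / real (\<nu> m)) \<longlonglongrightarrow> y"
proof -
  have ev: "eventually (\<lambda>m. \<nu> m \<ge> 1) sequentially"
    using \<nu> by (simp add: filterlim_at_top)
  have inv: "(\<lambda>m. 1 / real (\<nu> m)) \<longlonglongrightarrow> 0"
    by (intro tendsto_divide_0[OF tendsto_const] filterlim_at_top_imp_at_infinity filterlim_compose[OF filterlim_real_sequentially \<nu>])
  show 1: "(\<lambda>m. real (cell (\<nu> m) y) / real (\<nu> m)) \<longlonglongrightarrow> y"
  proof (rule tendsto_sandwich)
    show "eventually (\<lambda>m. y - 1 / real (\<nu> m) \<le> real (cell (\<nu> m) y) / real (\<nu> m)) sequentially"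
      using ev by eventually_elim (use cell_bounds(2)[OF _ y] in \<open>fastforce simp: add_divide_distrib\<close>)
    show "eventually (\<lambda>m. real (cell (\<nu> m) y) / real (\<nu> m) \<le> y) sequentially"
      using ev by eventually_elim (rule cell_bounds(1)[OF _ y])
    show "(\<lambda>m. y - 1 / real (\<nu> m)) \<longlonglongrightarrow> y" using tendsto_diff[OF tendsto_const inv, of y] by simp
  qed simp
  from tendsto_add[OF 1 inv] show "(\<lambda>m. real (Suc (cell (\<nu> m) y)) / real (\<nu> m)) \<longlonglongrightarrow> y"
    by (simp add: add_divide_distrib add.commute)
qed

lemma eventually_cell_in_range:
  assumes \<nu>: "filterlim \<nu> at_top sequentially" and r: "0 < r" and d: "d > 0"
  shows "eventually (\<lambda>m. 1 \<le> \<nu> m \<and> 1 / real (\<nu> m) \<le> d \<and> (\<forall>y\<in>{r..R}. 1 \<le> cell (\<nu> m) y \<and>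
     cell (\<nu> m) y < (\<nu> m)\<^sup>2 \<and> y / 2 \<le> real (cell (\<nu> m) y) / real (\<nu> m))) sequentially"
proof -
  \<comment> \<open>\<open>2 / r\<close> makes the spacing at most \<open>r / 2\<close>, so rounding
    down keeps at least half of \<open>y\<close>; \<open>\<bar>R\<bar> + 1\<close> keeps the
    interval below the last lattice point.\<close>
  define b where "b = nat \<lceil>max (1 / d) (max (2 / r) (\<bar>R\<bar> + 1))\<rceil> + 1"
  have b: "1 / d \<le> real b" "2 / r \<le> real b" "\<bar>R\<bar> + 1 \<le> real b"
    unfolding b_def by linarith+
  have "eventually (\<lambda>m. \<nu> m \<ge> b) sequentially" using \<nu> by (simp add: filterlim_at_top)
  then show ?thesis
  proof eventually_elim
    case (elim m)
    then have n: "1 / d \<le> real (\<nu> m)" "2 / r \<le> real (\<nu> m)" "\<bar>R\<bar> + 1 \<le> real (\<nu> m)" using b by (auto intro: order_trans)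
    then have n1: "\<nu> m \<ge> 1" by linarith
    show ?case
    proof (intro conjI ballI n1)
      show "1 / real (\<nu> m) \<le> d" using n n1 d by (simp add: field_simps)
      fix y assume y: "y \<in> {r..R}"
      note cb = cell_bounds[OF n1, of y]
      have inv: "1 / real (\<nu> m) \<le> r / 2" using n n1 r by (simp add: field_simps)
      then show *: "y / 2 \<le> real (cell (\<nu> m) y) / real (\<nu> m)"
      proof -
        have "real (Suc (cell (\<nu> m) y)) / real (\<nu> m) = real (cell (\<nu> m) y) / real (\<nu> m) + 1 / real (\<nu> m)"
          by (simp add: add_divide_distrib)
        then show ?thesis using cb(2) inv y r by auto
      qed
      have "0 < y / 2" using r y by simp
      then have "0 < real (cell (\<nu> m) y) / real (\<nu> m)" using * by (rule less_le_trans)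
      then show "1 \<le> cell (\<nu> m) y" by (simp add: zero_less_divide_iff Suc_le_eq)
      have "real (cell (\<nu> m) y) / real (\<nu> m) < real (\<nu> m)" using cb y r n by simp
      then have "real (cell (\<nu> m) y) < real ((\<nu> m)\<^sup>2)" using n1 by (simp add: field_simps power2_eq_square)
      then show "cell (\<nu> m) y < (\<nu> m)\<^sup>2" by (simp only: of_nat_less_iff)
    qed
  qed
qed

lemma eventually_cell_less:
  assumes \<nu>: "filterlim \<nu> at_top sequentially" and xy: "0 \<le> x" "x < y"
  shows "eventually (\<lambda>m. cell (\<nu> m) x < cell (\<nu> m) y) sequentially"
proof -
  have "eventually (\<lambda>m. real (cell (\<nu> m) x) / real (\<nu> m) < (x + y) / 2) sequentially"
    using xy by (intro order_tendstoD(2)[OF cell_tendsto(1)[OF \<nu>]]) auto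
  moreover have "eventually (\<lambda>m. (x + y) / 2 < real (cell (\<nu> m) y) / real (\<nu> m)) sequentially"
    using xy by (intro order_tendstoD(1)[OF cell_tendsto(1)[OF \<nu>]]) auto
  moreover have "eventually (\<lambda>m. \<nu> m \<ge> 1) sequentially" using \<nu> by (simp add: filterlim_at_top)
  ultimately show ?thesis
  proof eventually_elim
    case (elim m)
    then have "real (cell (\<nu> m) x) / real (\<nu> m) < real (cell (\<nu> m) y) / real (\<nu> m)" by linarith
    then show ?case using elim by (simp add: divide_less_cancel)
  qed
qed

lemma nn_integral_cell:
  fixes f :: "nat \<Rightarrow> ennreal"
  assumes n: "n \<ge> 1"
  shows "(\<integral>\<^sup>+y. (if 0 \<le> y \<and> cell n y < N then f (cell n y) else 0) \<partial>lborel) = (\<Sum>k<N. f k * ennreal (1 / real n))"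
proof -
  have "(\<integral>\<^sup>+y. (if 0 \<le> y \<and> cell n y < N then f (cell n y) else 0) \<partial>lborel)
    = (\<integral>\<^sup>+y. (\<Sum>k<N. f k * indicator {real k / real n..<real (Suc k) / real n} y) \<partial>lborel)"
  proof (rule nn_integral_cong)
    fix y :: real
    show "(if 0 \<le> y \<and> cell n y < N then f (cell n y) else 0)
      = (\<Sum>k<N. f k * indicator {real k / real n..<real (Suc k) / real n} y)"
    proof (cases "0 \<le> y")
      case True
      have "(\<Sum>k<N. f k * indicator {real k / real n..<real (Suc k) / real n} y) = (\<Sum>k<N. if k = cell n y then f k else 0)"
      proof (rule sum.cong[OF refl])
        fix k
        show "f k * indicator {real k / real n..<real (Suc k) / real n} y = (if k = cell n y then f k else 0)"
          using cell_eq_iff[OF n True, of k] by (auto simp: indicator_def simp del: of_nat_Suc)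
      qed
      then show ?thesis using True by simp
    next
      case False
      have "(\<Sum>k<N. f k * indicator {real k / real n..<real (Suc k) / real n} y) = 0"
      proof (intro sum.neutral ballI)
        fix k
        have "\<not> real k / real n \<le> y"
          using False by (meson divide_nonneg_nonneg of_nat_0_le_iff order_trans)
        then have "y \<notin> {real k / real n..<real (Suc k) / real n}" using False by auto
        then show "f k * indicator {real k / real n..<real (Suc k) / real n} y = 0" by simp
      qed
      then show ?thesis using False by simp
    qed
  qed
  also have "\<dots> = (\<Sum>k<N. \<integral>\<^sup>+y. f k * indicator {real k / real n..<real (Suc k) / real n} y \<partial>lborel)"
    by (rule nn_integral_sum) simp
  also have "\<dots> = (\<Sum>k<N. f k * ennreal (1 / real n))"
  proof (rule sum.cong[OF refl])
    fix k
    have "real k / real n \<le> real (Suc k) / real n" by (intro divide_right_mono) auto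
    then have "emeasure lborel {real k / real n..<real (Suc k) / real n} = ennreal (1 / real n)"
      by (simp add: add_divide_distrib)
    then show "(\<integral>\<^sup>+y. f k * indicator {real k / real n..<real (Suc k) / real n} y \<partial>lborel) = f k * ennreal (1 / real n)"
      by (simp add: nn_integral_cmult_indicator)
  qed
  finally show ?thesis .
qed

lemma cell_pair_measurable:
  fixes F :: "nat \<Rightarrow> nat \<Rightarrow> ennreal"
  shows "(\<lambda>p. if 0 \<le> fst p \<and> 0 \<le> snd p \<and> cell n (fst p) < N1 \<and> cell n (snd p) < N2 then F (cell n (fst p)) (cell n (snd p)) else 0)
    \<in> borel_measurable (lborel \<Otimes>\<^sub>M lborel)"
proof -
  have "(\<lambda>p. F (cell n (fst p)) (cell n (snd p))) \<in> borel_measurable (lborel \<Otimes>\<^sub>M lborel)"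
  proof (rule measurable_compose_countable[of "\<lambda>i p. F i (cell n (snd p))"])
    fix i
    show "(\<lambda>p. F i (cell n (snd p))) \<in> borel_measurable (lborel \<Otimes>\<^sub>M lborel)"
      by (rule measurable_compose_countable[of "\<lambda>i' p. F i i'"]) measurable
  qed measurable
  then show ?thesis by measurable
qed

lemma nn_integral_cell_pair:
  fixes F :: "nat \<Rightarrow> nat \<Rightarrow> real"
  assumes n: "n \<ge> 1" and F: "\<And>a b. F a b \<ge> 0"
  shows "(\<integral>\<^sup>+p. (if 0 \<le> fst p \<and> 0 \<le> snd p \<and> cell n (fst p) < N1 \<and> cell n (snd p) < N2
             then ennreal (F (cell n (fst p)) (cell n (snd p))) else 0) \<partial>(lborel \<Otimes>\<^sub>M lborel))
     = ennreal (\<Sum>a<N1. \<Sum>b<N2. F a b / (real n)\<^sup>2)"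
proof -
  have "(\<integral>\<^sup>+p. (if 0 \<le> fst p \<and> 0 \<le> snd p \<and> cell n (fst p) < N1 \<and> cell n (snd p) < N2
             then ennreal (F (cell n (fst p)) (cell n (snd p))) else 0) \<partial>(lborel \<Otimes>\<^sub>M lborel))
     = (\<integral>\<^sup>+y. \<integral>\<^sup>+z. (if 0 \<le> y \<and> 0 \<le> z \<and> cell n y < N1 \<and> cell n z < N2
             then ennreal (F (cell n y) (cell n z)) else 0) \<partial>lborel \<partial>lborel)"
    using lborel.nn_integral_fst[OF cell_pair_measurable[of n N1 N2 "\<lambda>a b. ennreal (F a b)"], symmetric]
    by (simp only: fst_conv snd_conv)
  also have "\<dots> = (\<integral>\<^sup>+y. (if 0 \<le> y \<and> cell n y < N1 then
        (\<integral>\<^sup>+z. (if 0 \<le> z \<and> cell n z < N2 then ennreal (F (cell n y) (cell n z)) else 0) \<partial>lborel) else 0) \<partial>lborel)"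
    by (intro nn_integral_cong) auto
  also have "\<dots> = (\<integral>\<^sup>+y. (if 0 \<le> y \<and> cell n y < N1 then
        (\<Sum>b<N2. ennreal (F (cell n y) b) * ennreal (1 / real n)) else 0) \<partial>lborel)"
  proof (rule nn_integral_cong)
    fix y
    show "(if 0 \<le> y \<and> cell n y < N1 then
        (\<integral>\<^sup>+z. (if 0 \<le> z \<and> cell n z < N2 then ennreal (F (cell n y) (cell n z)) else 0) \<partial>lborel) else 0)
      = (if 0 \<le> y \<and> cell n y < N1 then (\<Sum>b<N2. ennreal (F (cell n y) b) * ennreal (1 / real n)) else 0)"
      using nn_integral_cell[OF n, of N2 "\<lambda>b. ennreal (F (cell n y) b)"] by simp
  qed
  also have "\<dots> = (\<Sum>a<N1. (\<Sum>b<N2. ennreal (F a b) * ennreal (1 / real n)) * ennreal (1 / real n))"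
    by (rule nn_integral_cell[OF n, of N1 "\<lambda>a. \<Sum>b<N2. ennreal (F a b) * ennreal (1 / real n)"])
  also have "\<dots> = ennreal (\<Sum>a<N1. \<Sum>b<N2. F a b / (real n)\<^sup>2)"
    using F by (simp add: ennreal_mult[symmetric] sum_nonneg sum_divide_distrib[symmetric] power2_eq_square)
  finally show ?thesis .
qed

text \<open>The step functions are equicontinuous up to one cell, and cells eventually become
  shorter than any modulus. The hypothesis allows an error \<open>e\<close> besides the Lipschitz
  term, because the near part of the flux is small but not known to be Lipschitz.\<close>

lemma lattice_functions_subsequence:
  fixes F :: "nat \<Rightarrow> nat \<Rightarrow> real"
  assumes \<nu>: "filterlim \<nu> at_top sequentially"
    and bd: "\<And>m k. 1 \<le> k \<Longrightarrow> k \<le> (\<nu> m)\<^sup>2 \<Longrightarrow> \<bar>F m k\<bar> \<le> B (real k / real (\<nu> m))" and B: "continuous_on {0<..} B"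
    and modulus: "\<And>r R e. 0 < r \<Longrightarrow> r < R \<Longrightarrow> e > 0 \<Longrightarrow> \<exists>A. \<forall>m k l. r \<le> real k / real (\<nu> m) \<longrightarrow> k \<le> l \<longrightarrow> l \<le> (\<nu> m)\<^sup>2 \<longrightarrow>
       real l / real (\<nu> m) \<le> R \<longrightarrow> \<bar>F m l - F m k\<bar> \<le> e + A * (real l / real (\<nu> m) - real k / real (\<nu> m))"
  obtains k g where "strict_mono (k::nat\<Rightarrow>nat)"
    "\<And>x. x > 0 \<Longrightarrow> (\<lambda>m. F (k m) (cell (\<nu> (k m)) x)) \<longlonglongrightarrow> g x" "continuous_on {0<..} g"
proof -
  define good where "good m x \<longleftrightarrow> 1 \<le> \<nu> m \<and> 1 \<le> cell (\<nu> m) x \<and> cell (\<nu> m) x < (\<nu> m)\<^sup>2 \<and> x / 2 \<le> real (cell (\<nu> m) x) / real (\<nu> m)" for m x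
  \<comment> \<open>Replaced by \<open>0\<close> where the cell leaves the lattice or is rounded
    down too far, so that a pointwise bound holds for all \<open>m\<close> and not only
    eventually.\<close>
  define f where "f m x = (if good m x then F m (cell (\<nu> m) x) else 0)" for m x
  have ev_good: "eventually (\<lambda>m. good m x) sequentially" if "x > 0" for x
    using eventually_cell_in_range[OF \<nu> that zero_less_one, of x] by eventually_elim (auto simp: good_def)
  have "\<forall>x. \<exists>b. x > 0 \<longrightarrow> (\<forall>m. \<bar>f m x\<bar> \<le> b)"
  proof
    fix x :: real
    show "\<exists>b. x > 0 \<longrightarrow> (\<forall>m. \<bar>f m x\<bar> \<le> b)"
    proof (cases "x > 0")
      case True
      have "\<exists>y\<in>{x/2..x}. \<forall>z\<in>{x/2..x}. B z \<le> B y"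
        using True by (intro continuous_attains_sup continuous_on_subset[OF B]) auto
      then obtain b where b: "\<And>z. z \<in> {x/2..x} \<Longrightarrow> B z \<le> b" by blast
      have "\<bar>f m x\<bar> \<le> max 0 b" for m
      proof (cases "good m x")
        case g: True
        then have "\<bar>F m (cell (\<nu> m) x)\<bar> \<le> B (real (cell (\<nu> m) x) / real (\<nu> m))" by (intro bd) (auto simp: good_def)
        also have "\<dots> \<le> b" using g True cell_bounds(1)[of "\<nu> m" x] by (intro b) (auto simp: good_def)
        finally show ?thesis using g by (simp add: f_def)
      qed (simp add: f_def)
      then show ?thesis by blast
    qed simp
  qed
  then obtain b where b: "\<And>m x. x > 0 \<Longrightarrow> \<bar>f m x\<bar> \<le> b x" by metis
  have eq: "\<exists>d>0. \<exists>N. \<forall>n\<ge>N. \<forall>x\<in>{r..R}. \<forall>y\<in>{r..R}. \<bar>x - y\<bar> < d \<longrightarrow> \<bar>f n x - f n y\<bar> \<le> e"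
    if r: "0 < r" "r < R" "0 < e" for r R e
  proof -
    from modulus[of "r/2" R "e/2"] r obtain A where A: "\<And>m k l. r / 2 \<le> real k / real (\<nu> m) \<Longrightarrow> k \<le> l \<Longrightarrow> l \<le> (\<nu> m)\<^sup>2 \<Longrightarrow>
       real l / real (\<nu> m) \<le> R \<Longrightarrow> \<bar>F m l - F m k\<bar> \<le> e / 2 + A * (real l / real (\<nu> m) - real k / real (\<nu> m))"
      by force
    \<comment> \<open>Points at distance below \<open>d\<close> have rounded values at distance at
      most \<open>2 * d\<close> once the spacing is at most \<open>d\<close>, and
      \<open>\<bar>A\<bar> * (2 * d) \<le> e / 2\<close>.\<close>
    define d where "d = e / (4 * (\<bar>A\<bar> + 1))"
    have d: "d > 0" using r by (simp add: d_def)
    have "eventually (\<lambda>m. \<forall>x\<in>{r..R}. \<forall>y\<in>{r..R}. \<bar>x - y\<bar> < d \<longrightarrow> \<bar>f m x - f m y\<bar> \<le> e) sequentially"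
      using eventually_cell_in_range[OF \<nu> r(1) d, of R]
    proof eventually_elim
      case (elim m)
      have main: "\<bar>f m x - f m y\<bar> \<le> e" if xy: "x \<in> {r..R}" "y \<in> {r..R}" "x \<le> y" "\<bar>x - y\<bar> < d" for x y
      proof -
        let ?c = "\<lambda>x. real (cell (\<nu> m) x) / real (\<nu> m)"
        have n1: "\<nu> m \<ge> 1" using elim by auto
        have gd: "good m x" "good m y"
          using elim xy by (auto simp: good_def)
        note cx = cell_bounds[OF n1, of x] and cy = cell_bounds[OF n1, of y]
        have le: "cell (\<nu> m) x \<le> cell (\<nu> m) y" using xy by (intro cell_mono)
        then have c0: "?c x \<le> ?c y" by (intro divide_right_mono) auto
        have inv: "1 / real (\<nu> m) \<le> d" using elim by auto
        have c1: "?c y - ?c x \<le> 2 * d" using cx cy xy r inv by (simp add: add_divide_distrib)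
        have "r / 2 \<le> ?c x" "?c y \<le> R" using gd xy cy r by (auto simp: good_def)
        then have "\<bar>F m (cell (\<nu> m) y) - F m (cell (\<nu> m) x)\<bar> \<le> e / 2 + A * (?c y - ?c x)"
          using gd le by (intro A) (auto simp: good_def)
        also have "A * (?c y - ?c x) \<le> \<bar>A\<bar> * (2 * d)" using c0 c1 by (intro mult_mono) auto
        also have "\<dots> \<le> (\<bar>A\<bar> + 1) * (2 * d)" using d by (intro mult_right_mono) auto
        also have "\<dots> = e / 2" by (simp add: d_def field_simps)
        finally show ?thesis using gd by (simp add: f_def abs_minus_commute)
      qed
      show ?case
      proof (intro ballI impI)
        fix x y assume "x \<in> {r..R}" "y \<in> {r..R}" "\<bar>x - y\<bar> < d"
        then show "\<bar>f m x - f m y\<bar> \<le> e"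
          using main[of x y] main[of y x] by (cases "x \<le> y") (auto simp: abs_minus_commute)
      qed
    qed
    then show ?thesis
      using d by (auto simp: eventually_sequentially)
  qed
  obtain k g where k: "strict_mono (k::nat\<Rightarrow>nat)" and g: "\<And>x. x > 0 \<Longrightarrow> (\<lambda>m. f (k m) x) \<longlonglongrightarrow> g x" "continuous_on {0<..} g"
    using subsequence_asymptotically_equicontinuous[of f b, OF b eq] by blast
  have "(\<lambda>m. F (k m) (cell (\<nu> (k m)) x)) \<longlonglongrightarrow> g x" if x: "x > 0" for x
  proof (rule Lim_transform_eventually[OF g(1)[OF x]])
    have "eventually (\<lambda>m. good (k m) x) sequentially"
      using ev_good[OF x] k by (rule eventually_subseq[rotated])
    then show "eventually (\<lambda>m. f (k m) x = F (k m) (cell (\<nu> (k m)) x)) sequentially"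
      by eventually_elim (simp add: f_def)
  qed
  with k g that show thesis by blast
qed

section \<open>Passage to the limit\<close>

locale lattice_limit = coagulation_kernel K \<gamma> C \<rho> for K \<gamma> C \<rho> +
  fixes \<nu> :: "nat \<Rightarrow> nat" and h :: "nat \<Rightarrow> nat \<Rightarrow> real" and Hl Jl :: "real \<Rightarrow> real"
  assumes solution: "\<And>m. lattice_solution K \<gamma> C \<rho> (\<nu> m) (h m)"
    and \<nu>: "filterlim \<nu> at_top sequentially"
    and H_lim: "\<And>x. x > 0 \<Longrightarrow> (\<lambda>m. lattice_solution.H (h m) (cell (\<nu> m) x)) \<longlonglongrightarrow> Hl x"
    and J_lim: "\<And>x. x > 0 \<Longrightarrow> (\<lambda>m. lattice_solution.J_part K (\<nu> m) (h m) (\<lambda>_. True) (cell (\<nu> m) x)) \<longlonglongrightarrow> Jl x"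
    and Hl_cont: "continuous_on {0<..} Hl" and Jl_cont: "continuous_on {0<..} Jl"

lemma (in coagulation_kernel) small_powr:
  assumes "e > 0" "c \<ge> 0" "b > 0"
  obtains \<eta> where "0 < \<eta>" "\<eta> \<le> b" "c * \<eta> powr \<sigma> \<le> e"
proof -
  have E: "e / (c + 1) > 0" using assms by simp
  define \<eta> where "\<eta> = min b ((e / (c + 1)) powr (1 / \<sigma>))"
  have "(e / (c + 1)) powr (1 / \<sigma>) > 0" using E by (metis less_irrefl powr_gt_zero)
  then have eta: "0 < \<eta>" "\<eta> \<le> b" using assms by (auto simp: \<eta>_def)
  have "\<eta> powr \<sigma> \<le> ((e / (c + 1)) powr (1 / \<sigma>)) powr \<sigma>"
    using eta sd by (intro powr_mono2) (auto simp: \<eta>_def)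
  also have "\<dots> = e / (c + 1)" using E sd assms by (simp add: powr_powr)
  finally have "c * \<eta> powr \<sigma> \<le> c * (e / (c + 1))" using assms by (intro mult_left_mono)
  also have "\<dots> \<le> e" using assms by (simp add: field_simps)
  finally show thesis using that eta by blast
qed

lemma (in coagulation_kernel) lattice_limit_exists:
  "\<exists>\<nu> h Hl Jl. lattice_limit K \<gamma> C \<rho> \<nu> h Hl Jl"
proof -
  have "\<forall>m. \<exists>h. lattice_solution K \<gamma> C \<rho> (Suc m) h" by (intro allI lattice_solution_exists) simp
  from choice[OF this] obtain h where h: "\<And>m. lattice_solution K \<gamma> C \<rho> (Suc m) (h m)" by blast
  obtain k1 Hl where k1: "strict_mono (k1::nat\<Rightarrow>nat)"
    and Hl: "\<And>x. x > 0 \<Longrightarrow> (\<lambda>m. lattice_solution.H (h (k1 m)) (cell (Suc (k1 m)) x)) \<longlonglongrightarrow> Hl x"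
      "continuous_on {0<..} Hl"
  proof (rule lattice_functions_subsequence[of Suc "\<lambda>m. lattice_solution.H (h m)" "\<lambda>y. y powr \<sigma>"])
    show "filterlim Suc at_top sequentially" by (rule filterlim_Suc)
    show "\<bar>lattice_solution.H (h m) k\<bar> \<le> (real k / real (Suc m)) powr \<sigma>" if "1 \<le> k" "k \<le> (Suc m)\<^sup>2" for m k
    proof -
      interpret L: lattice_solution K \<gamma> C \<rho> "Suc m" "h m" by (rule h)
      show ?thesis using L.H_le[OF that(2)] L.H_nonneg by (simp add: L.x_def)
    qed
    show "continuous_on {0<..} (\<lambda>y::real. y powr \<sigma>)" by (intro continuous_intros) auto
    fix r R e :: real assume r: "0 < r" "r < R" "0 < e"
    show "\<exists>A. \<forall>m k l. r \<le> real k / real (Suc m) \<longrightarrow> k \<le> l \<longrightarrow> l \<le> (Suc m)\<^sup>2 \<longrightarrow> real l / real (Suc m) \<le> R \<longrightarrow>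
      \<bar>lattice_solution.H (h m) l - lattice_solution.H (h m) k\<bar> \<le> e + A * (real l / real (Suc m) - real k / real (Suc m))"
    proof (rule exI[of _ "dens_const * weight r"], intro allI impI)
      fix m k l assume a: "r \<le> real k / real (Suc m)" "k \<le> l" "l \<le> (Suc m)\<^sup>2"
      interpret L: lattice_solution K \<gamma> C \<rho> "Suc m" "h m" by (rule h)
      show "\<bar>L.H l - L.H k\<bar> \<le> e + dens_const * weight r * (real l / real (Suc m) - real k / real (Suc m))"
        using L.H_diff[OF r(1), of k l] a L.H_mono[OF a(2)] r(3) by (simp add: L.x_def)
    qed
  qed blast
  have \<nu>1: "filterlim (\<lambda>m. Suc (k1 m)) at_top sequentially"
    by (intro filterlim_compose[OF filterlim_Suc] filterlim_subseq k1)
  obtain k2 Jl where k2: "strict_mono (k2::nat\<Rightarrow>nat)"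
    and Jl: "\<And>x. x > 0 \<Longrightarrow> (\<lambda>m. lattice_solution.J_part K (Suc (k1 (k2 m))) (h (k1 (k2 m))) (\<lambda>_. True)
          (cell (Suc (k1 (k2 m))) x)) \<longlonglongrightarrow> Jl x" "continuous_on {0<..} Jl"
  proof (rule lattice_functions_subsequence[of "\<lambda>m. Suc (k1 m)"
        "\<lambda>m. lattice_solution.J_part K (Suc (k1 m)) (h (k1 m)) (\<lambda>_. True)" flux_bound, OF \<nu>1])
    show "\<bar>lattice_solution.J_part K (Suc (k1 m)) (h (k1 m)) (\<lambda>_. True) k\<bar> \<le> flux_bound (real k / real (Suc (k1 m)))"
      if "1 \<le> k" "k \<le> (Suc (k1 m))\<^sup>2" for m k
    proof -
      interpret L: lattice_solution K \<gamma> C \<rho> "Suc (k1 m)" "h (k1 m)" by (rule h)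
      show ?thesis using L.J_le_flux_bound[OF that] L.J_part_nonneg by (simp add: L.x_def)
    qed
    show "continuous_on {0<..} flux_bound"
      unfolding flux_bound_def weight_def by (intro continuous_intros) auto
    fix r R e :: real assume r: "0 < r" "r < R" "0 < e"
    define c where "c = 4 * C * R powr \<gamma> * (dens_const * weight (r / 2))"
    have c: "c \<ge> 0" unfolding c_def using C_pos dens_const_ge weight_nonneg by simp
    \<comment> \<open>\<open>\<eta>\<close> makes the near part at most \<open>e\<close>; the
      Lipschitz constant may then depend on \<open>e\<close> through \<open>\<eta>\<close>.\<close>
    obtain \<eta> where eta: "0 < \<eta>" "\<eta> \<le> r / 2" and ce: "c * \<eta> powr \<sigma> \<le> e"
      using small_powr[OF r(3) c, of "r / 2"] r by auto
    show "\<exists>A. \<forall>m k l. r \<le> real k / real (Suc (k1 m)) \<longrightarrow> k \<le> l \<longrightarrow> l \<le> (Suc (k1 m))\<^sup>2 \<longrightarrow> real l / real (Suc (k1 m)) \<le> R \<longrightarrow>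
      \<bar>lattice_solution.J_part K (Suc (k1 m)) (h (k1 m)) (\<lambda>_. True) l - lattice_solution.J_part K (Suc (k1 m)) (h (k1 m)) (\<lambda>_. True) k\<bar>
        \<le> e + A * (real l / real (Suc (k1 m)) - real k / real (Suc (k1 m)))"
    proof (rule exI[of _ "modulus_const r R \<eta>"], intro allI impI)
      fix m k l assume a: "r \<le> real k / real (Suc (k1 m))" "k \<le> l" "l \<le> (Suc (k1 m))\<^sup>2" "real l / real (Suc (k1 m)) \<le> R"
      interpret L: lattice_solution K \<gamma> C \<rho> "Suc (k1 m)" "h (k1 m)" by (rule h)
      have "\<bar>L.J l - L.J k\<bar> \<le> c * \<eta> powr \<sigma> + modulus_const r R \<eta> * (L.x l - L.x k)"
        unfolding c_def using a r eta by (intro L.J_diff) (auto simp: L.x_def)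
      with ce show "\<bar>L.J l - L.J k\<bar> \<le> e + modulus_const r R \<eta> * (real l / real (Suc (k1 m)) - real k / real (Suc (k1 m)))"
        by (simp add: L.x_def)
    qed
  qed blast
  have "lattice_limit K \<gamma> C \<rho> (\<lambda>m. Suc (k1 (k2 m))) (\<lambda>m. h (k1 (k2 m))) Hl Jl"
  proof (intro lattice_limit.intro lattice_limit_axioms.intro coagulation_kernel_axioms, goal_cases)
    case (1 m) show ?case by (rule h)
  next
    case 2 show ?case by (rule filterlim_compose[OF \<nu>1 filterlim_subseq[OF k2]])
  next
    case (3 x) then show ?case using LIMSEQ_subseq_LIMSEQ[OF Hl(1) k2] by (simp add: o_def)
  qed (use Hl Jl in auto)
  then show ?thesis by blast
qed

text \<open>The difference quotient of \<open>z powr s\<close> at \<open>1\<close> with increment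
  \<open>1 / k\<close>.\<close>

lemma binomial_powr_limit:
  fixes s :: real
  assumes "filterlim k at_top sequentially"
  shows "(\<lambda>m. real (k m) * ((1 + 1 / real (k m)) powr s - 1)) \<longlonglongrightarrow> s"
proof -
  have "((\<lambda>z::real. z powr s) has_real_derivative s * 1 powr (s - 1)) (at 1)"
    by (rule has_real_derivative_powr) simp
  then have d: "((\<lambda>t. ((1 + t) powr s - 1) / t) \<longlongrightarrow> s) (at 0)" by (simp add: DERIV_def)
  have rk: "filterlim (\<lambda>m. real (k m)) at_top sequentially"
    by (rule filterlim_compose[OF filterlim_real_sequentially assms])
  have "(\<lambda>m. 1 / real (k m)) \<longlonglongrightarrow> 0"
    by (intro tendsto_divide_0[OF tendsto_const] filterlim_at_top_imp_at_infinity rk)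
  moreover have "eventually (\<lambda>m. k m \<ge> 1) sequentially" using assms by (simp add: filterlim_at_top)
  then have "eventually (\<lambda>m. 1 / real (k m) \<noteq> 0) sequentially" by eventually_elim auto
  ultimately have "filterlim (\<lambda>m. 1 / real (k m)) (at 0) sequentially" by (simp add: filterlim_at)
  from filterlim_compose[OF d this] show ?thesis by (simp add: mult.commute)
qed

section \<open>The limit density and its mass\<close>

context lattice_limit
begin

sublocale L: lattice_solution K \<gamma> C \<rho> "\<nu> m" "h m" for m
  by (rule solution)

text \<open>The integrated equation solved for the density. The value \<open>0\<close> for
  \<open>y \<le> 0\<close> makes \<open>u\<close> nonnegative and Borel measurable on the whole
  line.\<close>

definition u :: "real \<Rightarrow> real" where "u y = (if y > 0 then (\<sigma> * Hl y + \<delta> * Jl y) / y else 0)"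

text \<open>The mass at index \<open>k + 1\<close> is spread over the cell \<open>k\<close>. With
  this shift the integral over the first \<open>N\<close> cells is exactly \<open>H N\<close>, and
  the recursion expresses the density on cell \<open>k\<close> through \<open>H k\<close> and
  \<open>J k\<close>.\<close>

definition density :: "nat \<Rightarrow> real \<Rightarrow> real" where "density m y = real (\<nu> m) * h m (Suc (cell (\<nu> m) y))"

lemma ev_range:
  assumes "0 < y"
  shows "eventually (\<lambda>m. 1 \<le> cell (\<nu> m) y \<and> cell (\<nu> m) y < (\<nu> m)\<^sup>2 \<and> y / 2 \<le> L.x m (cell (\<nu> m) y)) sequentially"
  using eventually_cell_in_range[OF \<nu> assms zero_less_one, of y] by eventually_elim (auto simp: L.x_def)

lemma x_cell_tendsto:
  assumes "0 \<le> y"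
  shows "(\<lambda>m. L.x m (cell (\<nu> m) y)) \<longlonglongrightarrow> y" "(\<lambda>m. L.x m (Suc (cell (\<nu> m) y))) \<longlonglongrightarrow> y"
  using cell_tendsto[OF \<nu> assms] by (simp_all add: L.x_def)

lemma x_cell: "0 \<le> y \<Longrightarrow> L.x m (cell (\<nu> m) y) \<le> y" "0 \<le> y \<Longrightarrow> y < L.x m (Suc (cell (\<nu> m) y))"
  using cell_bounds[OF L.n_pos] by (simp_all add: L.x_def)

lemma Hl_nonneg: "y > 0 \<Longrightarrow> Hl y \<ge> 0"
  by (rule LIMSEQ_le_const[OF H_lim]) (auto intro: L.H_nonneg)

lemma Jl_nonneg: "y > 0 \<Longrightarrow> Jl y \<ge> 0"
  by (rule LIMSEQ_le_const[OF J_lim]) (auto intro: L.J_part_nonneg)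

lemma u_nonneg: "u y \<ge> 0"
  using Hl_nonneg Jl_nonneg sd by (auto simp: u_def)

lemma density_nonneg: "density m y \<ge> 0"
  unfolding density_def using L.h_nonneg by simp

lemma u_cont: "continuous_on {0<..} u"
proof -
  have "continuous_on {0<..} (\<lambda>y. (\<sigma> * Hl y + \<delta> * Jl y) / y)"
    by (intro continuous_intros Hl_cont Jl_cont) auto
  then show ?thesis by (rule continuous_on_cong[THEN iffD1, rotated 2]) (auto simp: u_def)
qed

lemma u_measurable [measurable]: "u \<in> borel_measurable borel"
proof -
  have "(\<lambda>y. indicator {0<..} y *\<^sub>R u y) \<in> borel_measurable borel"
    by (intro borel_measurable_continuous_on_indicator u_cont) auto
  also have "(\<lambda>y. indicator {0<..} y *\<^sub>R u y) = u" by (auto simp: u_def indicator_def)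
  finally show ?thesis .
qed

lemma density_tendsto:
  assumes y: "y > 0"
  shows "(\<lambda>m. density m y) \<longlonglongrightarrow> u y"
proof -
  let ?k = "\<lambda>m. cell (\<nu> m) y"
  let ?g = "\<lambda>m. (real (?k m) * ((1 + 1 / real (?k m)) powr \<sigma> - 1)) * L.H m (?k m) / L.x m (?k m) + \<delta> * L.J m (?k m) / L.x m (?k m)"
  have k: "filterlim ?k at_top sequentially"
  proof -
    have "filterlim (\<lambda>m. real (\<nu> m)) at_top sequentially"
      by (rule filterlim_compose[OF filterlim_real_sequentially \<nu>])
    from filterlim_tendsto_pos_mult_at_top[OF x_cell_tendsto(1) y this] y
    have "filterlim (\<lambda>m. L.x m (?k m) * real (\<nu> m)) at_top sequentially" by simp
    also have "(\<lambda>m. L.x m (?k m) * real (\<nu> m)) = (\<lambda>m. real (?k m))"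
      using L.n_pos by (auto simp: L.x_def fun_eq_iff Suc_le_eq)
    finally show ?thesis by (simp add: filterlim_sequentially_iff_filterlim_real)
  qed
  have "?g \<longlonglongrightarrow> \<sigma> * Hl y / y + \<delta> * Jl y / y"
    using y by (intro tendsto_intros binomial_powr_limit k H_lim J_lim x_cell_tendsto) auto
  moreover have "eventually (\<lambda>m. ?g m = density m y) sequentially"
    using ev_range[OF y]
  proof eventually_elim
    case (elim m)
    have n: "\<nu> m > 0" using L.n_pos[of m] by simp
    have algebra: "k * P * H / (k / n) + d * J / (k / n) = n * (P * H + d / k * J)" if "k > 0" "n > 0" for k n P H d J :: real
      using that by (simp add: field_simps)
    show ?case using elim n
      by (subst algebra[of "real (?k m)" "real (\<nu> m)", folded L.x_def]) (auto simp: density_def L.recursion)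
  qed
  ultimately have "(\<lambda>m. density m y) \<longlonglongrightarrow> \<sigma> * Hl y / y + \<delta> * Jl y / y" by (rule Lim_transform_eventually)
  then show ?thesis using y by (simp add: u_def add_divide_distrib)
qed

lemma Hl_le: "y > 0 \<Longrightarrow> Hl y \<le> y powr \<sigma>"
proof (rule tendsto_le[OF _ _ H_lim])
  assume y: "y > 0"
  show "(\<lambda>m. L.x m (cell (\<nu> m) y) powr \<sigma>) \<longlonglongrightarrow> y powr \<sigma>"
    using y by (intro tendsto_intros x_cell_tendsto) auto
  show "eventually (\<lambda>m. L.H m (cell (\<nu> m) y) \<le> L.x m (cell (\<nu> m) y) powr \<sigma>) sequentially"
    using ev_range[OF y] by eventually_elim (auto intro: L.H_le)
qed auto

lemma Hl_ge: "y > 1 \<Longrightarrow> y powr \<sigma> * (1 - flux_const * 2 powr (1 + \<delta>) * y powr - \<delta>) \<le> Hl y"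
proof (rule tendsto_le[OF _ H_lim])
  assume y: "y > 1"
  show "(\<lambda>m. L.x m (cell (\<nu> m) y) powr \<sigma> * (1 - flux_const * 2 powr (1 + \<delta>) * L.x m (cell (\<nu> m) y) powr - \<delta>))
    \<longlonglongrightarrow> y powr \<sigma> * (1 - flux_const * 2 powr (1 + \<delta>) * y powr - \<delta>)"
    using y by (intro tendsto_intros x_cell_tendsto) auto
  have "eventually (\<lambda>m. 1 < L.x m (cell (\<nu> m) y)) sequentially"
    using y by (intro order_tendstoD(1)[OF x_cell_tendsto(1)]) auto
  moreover have "eventually (\<lambda>m. cell (\<nu> m) y < (\<nu> m)\<^sup>2) sequentially"
    using ev_range[of y] y by (auto elim: eventually_mono)
  ultimately show "eventually (\<lambda>m. L.x m (cell (\<nu> m) y) powr \<sigma> *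
      (1 - flux_const * 2 powr (1 + \<delta>) * L.x m (cell (\<nu> m) y) powr - \<delta>) \<le> L.H m (cell (\<nu> m) y)) sequentially"
    by eventually_elim (intro L.H_ge, auto)
qed auto

lemma Jl_le: "y > 1 \<Longrightarrow> Jl y \<le> flux_const * y powr (\<sigma> - \<delta>)"
proof (rule tendsto_le[OF _ _ J_lim])
  assume y: "y > 1"
  show "(\<lambda>m. flux_const * L.x m (cell (\<nu> m) y) powr (\<sigma> - \<delta>)) \<longlonglongrightarrow> flux_const * y powr (\<sigma> - \<delta>)"
    using y by (intro tendsto_intros x_cell_tendsto) auto
  have "eventually (\<lambda>m. 1 < L.x m (cell (\<nu> m) y)) sequentially"
    using y by (intro order_tendstoD(1)[OF x_cell_tendsto(1)]) auto
  moreover have "eventually (\<lambda>m. 1 \<le> cell (\<nu> m) y \<and> cell (\<nu> m) y < (\<nu> m)\<^sup>2) sequentially"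
    using ev_range[of y] y by (auto elim: eventually_mono)
  ultimately show "eventually (\<lambda>m. L.J m (cell (\<nu> m) y) \<le> flux_const * L.x m (cell (\<nu> m) y) powr (\<sigma> - \<delta>)) sequentially"
  proof eventually_elim
    case (elim m)
    then show ?case
      using L.J_le_flux_bound[of "cell (\<nu> m) y" m] flux_bound_large[of "L.x m (cell (\<nu> m) y)"] by linarith
  qed
qed auto

lemma density_on_interval:
  assumes "0 < \<eta>" "\<eta> \<le> y"
  shows "density m y \<le> dens_const * weight \<eta>"
proof (cases "Suc (cell (\<nu> m) y) \<le> (\<nu> m)\<^sup>2")
  case True
  then show ?thesis unfolding density_def
    using assms x_cell(2)[of y m] by (intro L.density_le') auto
next
  case False
  then show ?thesis unfolding density_def
    using L.h_beyond[of m] dens_const_ge weight_nonneg by simp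
qed

lemma ev_le:
  assumes "d > 0"
  shows "eventually (\<lambda>m. 1 / real (\<nu> m) \<le> d) sequentially"
  using eventually_cell_in_range[OF \<nu> zero_less_one assms, of 0] by eventually_elim auto

lemma H_cell_sum: "(\<Sum>k<N. (real (\<nu> m) * h m (Suc k)) / real (\<nu> m)) = L.H m N"
  using L.n_pos[of m] by (simp add: L.H_def sum.atLeast1_atMost_eq)

lemma nn_integral_density:
  "(\<integral>\<^sup>+y. (if 0 \<le> y \<and> cell (\<nu> m) y < N then ennreal (density m y) else 0) \<partial>lborel) = ennreal (L.H m N)"
proof -
  have "(\<integral>\<^sup>+y. (if 0 \<le> y \<and> cell (\<nu> m) y < N then ennreal (density m y) else 0) \<partial>lborel)
     = (\<Sum>k<N. ennreal (real (\<nu> m) * h m (Suc k)) * ennreal (1 / real (\<nu> m)))"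
    using nn_integral_cell[OF L.n_pos, of m N "\<lambda>k. ennreal (real (\<nu> m) * h m (Suc k))"] by (simp only: density_def)
  also have "\<dots> = ennreal (\<Sum>k<N. (real (\<nu> m) * h m (Suc k)) / real (\<nu> m))"
    using L.h_nonneg by (subst sum_ennreal[symmetric]) (auto simp: ennreal_mult[symmetric] intro!: sum.cong)
  finally show ?thesis unfolding H_cell_sum .
qed

lemma density_measurable [measurable]: "density m \<in> borel_measurable borel"
  unfolding density_def by measurable

text \<open>On \<open>[\<eta>, x]\<close> the densities are uniformly bounded, and for large
  \<open>m\<close> the mass below \<open>\<eta>\<close> is at most
  \<open>2 * \<eta> powr \<sigma>\<close>. No mass concentrates at the origin.\<close>

lemma nn_integral_u:
  assumes x: "x > 0"
  shows "(\<integral>\<^sup>+y\<in>{0<..<x}. ennreal (u y) \<partial>lborel) = ennreal (Hl x)"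
proof (rule nn_integral_eq_of_tight_limit[where I = "\<lambda>m. L.H m (cell (\<nu> m) x)"
      and f = "\<lambda>m y. if 0 \<le> y \<and> cell (\<nu> m) y < cell (\<nu> m) x then ennreal (density m y) else 0"])
  show "AE y in lborel. (\<lambda>m. if 0 \<le> y \<and> cell (\<nu> m) y < cell (\<nu> m) x then ennreal (density m y) else 0)
      \<longlonglongrightarrow> ennreal (u y) * indicator {0<..<x} y"
    using AE_lborel_singleton[of 0] AE_lborel_singleton[of x]
  proof eventually_elim
    case (elim y)
    consider "y < 0" | "0 < y" "y < x" | "x < y" using elim by fastforce
    then show ?case
    proof cases
      case 2
      have "eventually (\<lambda>m. ennreal (density m y) = (if 0 \<le> y \<and> cell (\<nu> m) y < cell (\<nu> m) x then ennreal (density m y) else 0)) sequentially"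
        using eventually_cell_less[OF \<nu>, of y x] 2 by (auto elim: eventually_mono)
      from Lim_transform_eventually[OF tendsto_ennrealI[OF density_tendsto[OF 2(1)]] this] 2 show ?thesis by simp
    next
      case 3
      have "cell (\<nu> m) x \<le> cell (\<nu> m) y" for m using 3 by (intro cell_mono) auto
      then show ?thesis using 3 by (auto simp: not_less[symmetric])
    qed simp
  qed
  show "eventually (\<lambda>m. (\<integral>\<^sup>+y. (if 0 \<le> y \<and> cell (\<nu> m) y < cell (\<nu> m) x then ennreal (density m y) else 0) \<partial>lborel)
      = ennreal (L.H m (cell (\<nu> m) x))) sequentially"
    by (simp only: nn_integral_density) simp
  fix e :: real assume e: "e > 0"
  obtain \<eta> where eta: "0 < \<eta>" "\<eta> \<le> 1" "2 * \<eta> powr \<sigma> \<le> e" using small_powr[OF e, of 2 1] by auto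
  let ?f = "\<lambda>m y. if 0 \<le> y \<and> cell (\<nu> m) y < cell (\<nu> m) x then ennreal (density m y) else 0"
  show "\<exists>A B. A \<in> sets lborel \<and> emeasure lborel A < \<infinity> \<and>
      eventually (\<lambda>m. (\<forall>y\<in>A. ?f m y \<le> ennreal B) \<and> (\<integral>\<^sup>+y. ?f m y * indicator (- A) y \<partial>lborel) \<le> ennreal e) sequentially"
  proof (intro exI[of _ "{\<eta>..x}"] exI[of _ "dens_const * weight \<eta>"] conjI)
    show "emeasure lborel {\<eta>..x} < \<infinity>" using emeasure_lborel_cbox_finite[of \<eta> x] by (simp add: cbox_interval)
    show "eventually (\<lambda>m. (\<forall>y\<in>{\<eta>..x}. ?f m y \<le> ennreal (dens_const * weight \<eta>))
       \<and> (\<integral>\<^sup>+y. ?f m y * indicator (- {\<eta>..x}) y \<partial>lborel) \<le> ennreal e) sequentially"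
      using ev_le[OF eta(1)] ev_range[OF eta(1)]
    proof eventually_elim
      case (elim m)
      have "(\<integral>\<^sup>+y. ?f m y * indicator (- {\<eta>..x}) y \<partial>lborel)
        \<le> (\<integral>\<^sup>+y. (if 0 \<le> y \<and> cell (\<nu> m) y < Suc (cell (\<nu> m) \<eta>) then ennreal (density m y) else 0) \<partial>lborel)"
      proof (rule nn_integral_mono)
        fix y
        have "cell (\<nu> m) x \<le> cell (\<nu> m) y" if "x < y" using that by (intro cell_mono) auto
        moreover have "cell (\<nu> m) y \<le> cell (\<nu> m) \<eta>" if "y < \<eta>" using that by (intro cell_mono) auto
        ultimately show "?f m y * indicator (- {\<eta>..x}) y
          \<le> (if 0 \<le> y \<and> cell (\<nu> m) y < Suc (cell (\<nu> m) \<eta>) then ennreal (density m y) else 0)"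
          by (auto simp: indicator_def less_Suc_eq_le)
      qed
      also have "\<dots> = ennreal (L.H m (Suc (cell (\<nu> m) \<eta>)))" by (rule nn_integral_density)
      also have "L.H m (Suc (cell (\<nu> m) \<eta>)) \<le> L.x m (Suc (cell (\<nu> m) \<eta>)) powr \<sigma>"
        using elim by (intro L.H_le) auto
      also have "L.x m (Suc (cell (\<nu> m) \<eta>)) powr \<sigma> \<le> (2 * \<eta>) powr \<sigma>"
        using elim x_cell(1)[of \<eta> m] eta sd L.x_nonneg by (intro powr_mono2) (auto simp: L.x_Suc)
      also have "\<dots> = 2 powr \<sigma> * \<eta> powr \<sigma>" by (rule powr_mult)
      also have "\<dots> \<le> 2 powr 1 * \<eta> powr \<sigma>" using rho gamma by (intro mult_right_mono powr_mono) auto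
      also have "\<dots> \<le> e" using eta by simp
      finally have "(\<integral>\<^sup>+y. ?f m y * indicator (- {\<eta>..x}) y \<partial>lborel) \<le> ennreal e" using ennreal_leI by (simp add: ennreal_leI)
      moreover have "\<forall>y\<in>{\<eta>..x}. ?f m y \<le> ennreal (dens_const * weight \<eta>)"
        using density_on_interval[OF eta(1)] by (auto intro!: ennreal_leI)
      ultimately show ?case by blast
    qed
  qed auto
qed (use x H_lim L.H_nonneg in auto)

section \<open>Convergence of the flux\<close>

lemma far_const_diag: "Z > 0 \<Longrightarrow> far_const Z Z = 2 * C * tail_const * Z powr - \<delta>"
  by (simp add: far_const_def)

text \<open>A first argument of size at most \<open>2 * \<eta>\<close> passes \<open>x k\<close>
  only with a partner beyond \<open>x / 4\<close>, because
  \<open>x / 2 - 2 * \<eta> \<ge> x / 4\<close>. The mass of such first arguments is small while the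
  far rate stays bounded.\<close>

lemma flux_sum_small_first:
  assumes eta: "0 < \<eta>" "\<eta> \<le> x / 16"
    and k: "k \<le> (\<nu> m)\<^sup>2" "x / 2 \<le> L.x m k" "L.x m k \<le> x" and c: "L.x m (Suc c) \<le> 2 * \<eta>"
  shows "(\<Sum>j=1..k. \<Sum>z=1..(\<nu> m)\<^sup>2. if k < j + z \<and> j \<le> Suc c then L.q m j z else 0)
    \<le> 2 * \<eta> powr \<sigma> * far_const x (x / 4)"
proof -
  have x: "x > 0" using eta by linarith
  have ck: "Suc c \<le> k" using c k eta L.x_le_iff[of m "Suc c" k] by linarith
  have "(\<Sum>j=1..k. \<Sum>z=1..(\<nu> m)\<^sup>2. if k < j + z \<and> j \<le> Suc c then L.q m j z else 0)
    = (\<Sum>j=1..Suc c. \<Sum>z=1..(\<nu> m)\<^sup>2. if k < j + z \<and> j \<le> Suc c then L.q m j z else 0)"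
    using ck by (intro sum.mono_neutral_right) auto
  also have "\<dots> \<le> (\<Sum>j=1..Suc c. \<Sum>z=1..(\<nu> m)\<^sup>2. if x / 4 \<le> L.x m z then L.q m j z else 0)"
  proof (intro sum_mono)
    fix j z assume jz: "j \<in> {1..Suc c}" "z \<in> {1..(\<nu> m)\<^sup>2}"
    have "x / 4 \<le> L.x m z" if "k < j + z"
    proof -
      have "L.x m k \<le> L.x m (j + z)" using that L.x_le_iff by simp
      also have "\<dots> = L.x m j + L.x m z" by (simp add: L.x_def add_divide_distrib)
      also have "L.x m j \<le> L.x m (Suc c)" using jz L.x_le_iff by simp
      finally show ?thesis using c k eta by linarith
    qed
    then show "(if k < j + z \<and> j \<le> Suc c then L.q m j z else 0) \<le> (if x / 4 \<le> L.x m z then L.q m j z else 0)"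
      using jz L.q_nonneg[of j z m] by auto
  qed
  also have "\<dots> \<le> L.H m (Suc c) * far_const x (x / 4)"
    using x c eta by (intro L.J_far(1)) auto
  also have "\<dots> \<le> (2 * \<eta> powr \<sigma>) * far_const x (x / 4)"
  proof (intro mult_right_mono far_const_nonneg)
    have "L.H m (Suc c) \<le> L.x m (Suc c) powr \<sigma>" using ck k by (intro L.H_le) auto
    also have "\<dots> \<le> (2 * \<eta>) powr \<sigma>" using c sd L.x_nonneg by (intro powr_mono2) auto
    also have "\<dots> = 2 powr \<sigma> * \<eta> powr \<sigma>" by (rule powr_mult)
    also have "\<dots> \<le> 2 powr 1 * \<eta> powr \<sigma>" using rho gamma by (intro mult_right_mono powr_mono) auto
    finally show "L.H m (Suc c) \<le> 2 * \<eta> powr \<sigma>" by simp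
  qed
  finally show ?thesis .
qed

text \<open>An instance of \<open>J_near\<close>. The threshold is \<open>3 * \<eta>\<close> because
  that lemma takes partners strictly below its threshold, while here they may reach
  \<open>2 * \<eta>\<close>.\<close>

lemma flux_sum_small_second:
  assumes eta: "0 < \<eta>" "\<eta> \<le> x / 16"
    and k: "k \<le> (\<nu> m)\<^sup>2" "x / 2 \<le> L.x m k" "L.x m k \<le> x" and c: "L.x m (Suc c) \<le> 2 * \<eta>"
  shows "(\<Sum>j=1..k. \<Sum>z=1..(\<nu> m)\<^sup>2. if k < j + z \<and> z \<le> Suc c then L.q m j z else 0)
    \<le> 2 * C * x powr \<gamma> * (dens_const * weight (x / 4)) * (3 * \<eta> powr \<sigma>)"
proof -
  have x: "x > 0" using eta by linarith
  have "(\<Sum>j=1..k. \<Sum>z=1..(\<nu> m)\<^sup>2. if k < j + z \<and> z \<le> Suc c then L.q m j z else 0)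
    \<le> L.J_part m (\<lambda>z. L.x m z < 3 * \<eta>) k"
    unfolding L.J_part_def
  proof (intro sum_mono)
    fix j z assume jz: "j \<in> {1..k}" "z \<in> {1..(\<nu> m)\<^sup>2}"
    have "L.x m z < 3 * \<eta>" if "z \<le> Suc c"
      using that c eta L.x_le_iff[of m z "Suc c"] by linarith
    then show "(if k < j + z \<and> z \<le> Suc c then L.q m j z else 0) \<le> (if k < j + z \<and> L.x m z < 3 * \<eta> then L.q m j z else 0)"
      using jz L.q_nonneg[of j z m] by auto
  qed
  also have "\<dots> \<le> 2 * C * L.x m k powr \<gamma> * (dens_const * weight (x / 4)) * (3 * \<eta>) powr \<sigma>"
  proof (rule L.J_near)
    fix j assume j: "j \<le> k" "k < 2 * j"
    then have "L.x m k < 2 * L.x m j" using L.n_pos[of m] by (simp add: L.x_def field_simps)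
    then show "real (\<nu> m) * h m j \<le> dens_const * weight (x / 4)" using x j k by (intro L.density_le') auto
  qed (use eta k in auto)
  also have "\<dots> \<le> 2 * C * x powr \<gamma> * (dens_const * weight (x / 4)) * (3 * \<eta> powr \<sigma>)"
  proof (intro mult_mono mult_left_mono mult_right_mono powr_mono2)
    have "(3 * \<eta>) powr \<sigma> = 3 powr \<sigma> * \<eta> powr \<sigma>" by (rule powr_mult)
    also have "\<dots> \<le> 3 powr 1 * \<eta> powr \<sigma>" using rho gamma by (intro mult_right_mono powr_mono) auto
    finally show "(3 * \<eta>) powr \<sigma> \<le> 3 * \<eta> powr \<sigma>" by simp
  qed (use k C_pos gamma L.x_nonneg dens_const_ge weight_nonneg in auto)
  finally show ?thesis .
qed

text \<open>With both parameters of \<open>far_const\<close> equal to \<open>Z\<close>, the ratio in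
  it is \<open>1\<close> and the decay \<open>Z powr - \<delta>\<close> is all that remains.\<close>

lemma flux_sum_large_second:
  assumes x: "x > 0" and Z: "x \<le> Z" and k: "k \<le> (\<nu> m)\<^sup>2" "L.x m k \<le> x" and c: "Z \<le> L.x m (Suc c)"
  shows "(\<Sum>j=1..k. \<Sum>z=1..(\<nu> m)\<^sup>2. if k < j + z \<and> Suc c \<le> z then L.q m j z else 0)
    \<le> x powr \<sigma> * (2 * C * tail_const * Z powr - \<delta>)"
proof -
  have "(\<Sum>j=1..k. \<Sum>z=1..(\<nu> m)\<^sup>2. if k < j + z \<and> Suc c \<le> z then L.q m j z else 0)
    \<le> L.J_part m (\<lambda>z. Z \<le> L.x m z) k"
    unfolding L.J_part_def
  proof (intro sum_mono)
    fix j z assume jz: "j \<in> {1..k}" "z \<in> {1..(\<nu> m)\<^sup>2}"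
    have "Z \<le> L.x m z" if "Suc c \<le> z"
      using that c L.x_le_iff[of m "Suc c" z] by linarith
    then show "(if k < j + z \<and> Suc c \<le> z then L.q m j z else 0) \<le> (if k < j + z \<and> Z \<le> L.x m z then L.q m j z else 0)"
      using jz L.q_nonneg[of j z m] by auto
  qed
  also have "\<dots> \<le> L.H m k * far_const Z Z"
    using x Z k by (intro L.J_far(2)) auto
  also have "\<dots> \<le> x powr \<sigma> * far_const Z Z"
  proof (intro mult_right_mono far_const_nonneg)
    have "L.H m k \<le> L.x m k powr \<sigma>" using k by (intro L.H_le) auto
    also have "\<dots> \<le> x powr \<sigma>" using k sd L.x_nonneg by (intro powr_mono2) auto
    finally show "L.H m k \<le> x powr \<sigma>" .
  qed
  finally show ?thesis using far_const_diag x Z by simp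
qed

definition flux_integrand :: "real \<Rightarrow> real \<times> real \<Rightarrow> ennreal" where
  "flux_integrand x p = (if 0 < fst p \<and> fst p < x \<and> x - fst p < snd p
     then ennreal (K (fst p) (snd p) / snd p * u (snd p) * u (fst p)) else 0)"

text \<open>The flux sum as a step function of two variables, both indices shifted by one as in
  \<open>density\<close>. \<open>Q\<close> receives the unshifted cell indices; it serves to cut out
  regions of small or large arguments.\<close>

definition lattice_integrand :: "real \<Rightarrow> nat \<Rightarrow> (nat \<Rightarrow> nat \<Rightarrow> bool) \<Rightarrow> real \<times> real \<Rightarrow> ennreal" where
  "lattice_integrand x m Q p = (if 0 \<le> fst p \<and> 0 \<le> snd p \<and> cell (\<nu> m) (fst p) < cell (\<nu> m) x \<and> cell (\<nu> m) (snd p) < (\<nu> m)\<^sup>2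
     then ennreal (if cell (\<nu> m) x < Suc (cell (\<nu> m) (fst p)) + Suc (cell (\<nu> m) (snd p)) \<and> Q (cell (\<nu> m) (fst p)) (cell (\<nu> m) (snd p))
        then (real (\<nu> m))\<^sup>2 * L.q m (Suc (cell (\<nu> m) (fst p))) (Suc (cell (\<nu> m) (snd p))) else 0) else 0)"

lemma lattice_integrand_measurable [measurable]:
  "lattice_integrand x m Q \<in> borel_measurable (lborel \<Otimes>\<^sub>M lborel)"
  unfolding lattice_integrand_def
  by (rule cell_pair_measurable[of "\<nu> m" "cell (\<nu> m) x" "(\<nu> m)\<^sup>2"
        "\<lambda>a b. ennreal (if cell (\<nu> m) x < Suc a + Suc b \<and> Q a b then (real (\<nu> m))\<^sup>2 * L.q m (Suc a) (Suc b) else 0)"])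

lemma nn_integral_lattice_integrand:
  "(\<integral>\<^sup>+p. lattice_integrand x m Q p \<partial>(lborel \<Otimes>\<^sub>M lborel)) =
     ennreal (\<Sum>j=1..cell (\<nu> m) x. \<Sum>z=1..(\<nu> m)\<^sup>2. if cell (\<nu> m) x < j + z \<and> Q (j - 1) (z - 1) then L.q m j z else 0)"
proof -
  let ?F = "\<lambda>a b. if cell (\<nu> m) x < Suc a + Suc b \<and> Q a b then (real (\<nu> m))\<^sup>2 * L.q m (Suc a) (Suc b) else 0"
  have "(\<integral>\<^sup>+p. lattice_integrand x m Q p \<partial>(lborel \<Otimes>\<^sub>M lborel))
     = ennreal (\<Sum>a<cell (\<nu> m) x. \<Sum>b<(\<nu> m)\<^sup>2. ?F a b / (real (\<nu> m))\<^sup>2)"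
    unfolding lattice_integrand_def
    by (rule nn_integral_cell_pair[OF L.n_pos, of ?F]) (auto intro!: mult_nonneg_nonneg L.q_nonneg)
  also have "(\<Sum>a<cell (\<nu> m) x. \<Sum>b<(\<nu> m)\<^sup>2. ?F a b / (real (\<nu> m))\<^sup>2)
    = (\<Sum>j=1..cell (\<nu> m) x. \<Sum>z=1..(\<nu> m)\<^sup>2. if cell (\<nu> m) x < j + z \<and> Q (j - 1) (z - 1) then L.q m j z else 0)"
    unfolding One_nat_def sum.atLeast1_atMost_eq using L.n_pos[of m] by (intro sum.cong) auto
  finally show ?thesis .
qed

text \<open>\<open>K\<close> is continuous only on the open quadrant, so it is cut off there. The
  conditions of the integrand force both arguments to be positive, hence nothing changes.\<close>

lemma flux_integrand_measurable [measurable]: "flux_integrand x \<in> borel_measurable (lborel \<Otimes>\<^sub>M lborel)"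
proof -
  let ?S = "{0<..} \<times> {0<..} :: (real \<times> real) set"
  have [measurable]: "(\<lambda>p. indicator ?S p *\<^sub>R (case p of (y, z) \<Rightarrow> K y z)) \<in> borel_measurable (lborel \<Otimes>\<^sub>M lborel)"
    using borel_measurable_continuous_on_indicator[OF _ K_cont] by (simp add: lborel_prod open_Times)
  have "flux_integrand x = (\<lambda>p. if 0 < fst p \<and> fst p < x \<and> x - fst p < snd p
     then ennreal (indicator ?S p *\<^sub>R (case p of (y, z) \<Rightarrow> K y z) / snd p * u (snd p) * u (fst p)) else 0)"
    by (auto simp: flux_integrand_def fun_eq_iff indicator_def)
  also have "\<dots> \<in> borel_measurable (lborel \<Otimes>\<^sub>M lborel)" by measurable
  finally show ?thesis .
qed

lemma lattice_integrand_eq: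
  "(real (\<nu> m))\<^sup>2 * L.q m (Suc (cell (\<nu> m) y)) (Suc (cell (\<nu> m) z))
    = K (L.x m (Suc (cell (\<nu> m) y))) (L.x m (Suc (cell (\<nu> m) z))) / L.x m (Suc (cell (\<nu> m) z)) * density m z * density m y"
  by (simp add: L.q_def density_def power2_eq_square)

text \<open>The excluded lines are exactly where the discrete and the continuous range conditions
  may disagree for infinitely many \<open>m\<close>, and they form a null set.\<close>

lemma lattice_integrand_tendsto:
  assumes x: "x > 0" and p: "y \<noteq> 0" "y \<noteq> x" "z \<noteq> 0" "y + z \<noteq> x"
  shows "(\<lambda>m. lattice_integrand x m (\<lambda>_ _. True) (y, z)) \<longlonglongrightarrow> flux_integrand x (y, z)"
proof -
  consider "y < 0 \<or> z < 0" | "0 < y" "x < y" | "0 < y" "0 < z" "y < x" "y + z < x" | "0 < y" "0 < z" "y < x" "x < y + z"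
    using p by linarith
  then show ?thesis
  proof cases
    case 1
    then show ?thesis by (auto simp: lattice_integrand_def flux_integrand_def)
  next
    case 2
    have "cell (\<nu> m) x \<le> cell (\<nu> m) y" for m using 2 by (intro cell_mono) auto
    then have "lattice_integrand x m (\<lambda>_ _. True) (y, z) = 0" for m by (auto simp: lattice_integrand_def not_less[symmetric])
    then show ?thesis using 2 by (simp add: flux_integrand_def)
  next
    case 3
    have l: "(\<lambda>m. L.x m (cell (\<nu> m) x) - (L.x m (Suc (cell (\<nu> m) y)) + L.x m (Suc (cell (\<nu> m) z)))) \<longlonglongrightarrow> x - (y + z)"
      using 3 x by (intro tendsto_intros x_cell_tendsto) auto
    have "eventually (\<lambda>m. 0 < L.x m (cell (\<nu> m) x) - (L.x m (Suc (cell (\<nu> m) y)) + L.x m (Suc (cell (\<nu> m) z)))) sequentially"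
      using 3 by (intro order_tendstoD(1)[OF l]) auto
    then have "eventually (\<lambda>m. flux_integrand x (y, z) = lattice_integrand x m (\<lambda>_ _. True) (y, z)) sequentially"
    proof eventually_elim
      case (elim m)
      then have "L.x m (Suc (cell (\<nu> m) y) + Suc (cell (\<nu> m) z)) < L.x m (cell (\<nu> m) x)"
        by (simp add: L.x_def add_divide_distrib)
      then have "Suc (cell (\<nu> m) y) + Suc (cell (\<nu> m) z) < cell (\<nu> m) x" by (simp only: L.x_less_iff)
      then show ?case using 3 by (simp add: lattice_integrand_def flux_integrand_def)
    qed
    then show ?thesis by (rule Lim_transform_eventually[OF tendsto_const])
  next
    case 4
    let ?g = "\<lambda>m. K (L.x m (Suc (cell (\<nu> m) y))) (L.x m (Suc (cell (\<nu> m) z))) / L.x m (Suc (cell (\<nu> m) z)) * density m z * density m y"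
    have "(\<lambda>m. case (L.x m (Suc (cell (\<nu> m) y)), L.x m (Suc (cell (\<nu> m) z))) of (y, z) \<Rightarrow> K y z) \<longlonglongrightarrow> (case (y, z) of (y, z) \<Rightarrow> K y z)"
      using 4 by (intro continuous_on_tendsto_compose[OF K_cont] tendsto_Pair x_cell_tendsto) (auto intro!: always_eventually L.x_pos)
    then have Kl: "(\<lambda>m. K (L.x m (Suc (cell (\<nu> m) y))) (L.x m (Suc (cell (\<nu> m) z)))) \<longlonglongrightarrow> K y z" by simp
    have "?g \<longlonglongrightarrow> K y z / z * u z * u y"
      using 4 by (intro tendsto_intros Kl x_cell_tendsto density_tendsto) auto
    then have gl: "(\<lambda>m. ennreal (?g m)) \<longlonglongrightarrow> flux_integrand x (y, z)"
      using 4 by (simp add: flux_integrand_def tendsto_ennrealI)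
    have "eventually (\<lambda>m. ennreal (?g m) = lattice_integrand x m (\<lambda>_ _. True) (y, z)) sequentially"
      using eventually_cell_less[OF \<nu> less_imp_le[OF 4(1)] 4(3)] ev_range[OF 4(2)]
    proof eventually_elim
      case (elim m)
      have "L.x m (cell (\<nu> m) x) < L.x m (Suc (cell (\<nu> m) y)) + L.x m (Suc (cell (\<nu> m) z))"
        using x_cell(1)[of x m] x_cell(2)[of y m] x_cell(2)[of z m] x 4 by linarith
      then have "L.x m (cell (\<nu> m) x) < L.x m (Suc (cell (\<nu> m) y) + Suc (cell (\<nu> m) z))"
        by (simp add: L.x_def add_divide_distrib)
      then have "cell (\<nu> m) x < Suc (cell (\<nu> m) y) + Suc (cell (\<nu> m) z)" by (simp only: L.x_less_iff)
      then show ?case using 4 elim by (simp add: lattice_integrand_def lattice_integrand_eq)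
    qed
    from Lim_transform_eventually[OF gl this] show ?thesis .
  qed
qed

text \<open>\<open>X + 1\<close> leaves room for the shift of the arguments by up to one cell, of
  length at most \<open>1\<close>.\<close>

lemma lattice_integrand_le:
  assumes \<eta>: "0 < \<eta>" and p: "p \<in> {\<eta>..X} \<times> {\<eta>..X}"
  shows "lattice_integrand x m Q p \<le> ennreal (2 * C * (X + 1) powr \<gamma> / \<eta> * (dens_const * weight \<eta>) * (dens_const * weight \<eta>))"
proof -
  obtain y z where yz: "p = (y, z)" "\<eta> \<le> y" "y \<le> X" "\<eta> \<le> z" "z \<le> X" using p by (cases p) auto
  have n1: "1 / real (\<nu> m) \<le> 1" using L.n_pos[of m] by simp
  define Y where "Y = L.x m (Suc (cell (\<nu> m) y))"
  define Z where "Z = L.x m (Suc (cell (\<nu> m) z))"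
  have YZ: "0 < Y" "Y \<le> X + 1" "\<eta> \<le> Z" "Z \<le> X + 1"
    using x_cell[of y m] x_cell[of z m] yz \<eta> n1 by (auto simp: Y_def Z_def L.x_Suc)
  have "K Y Z / Z * density m z * density m y \<le> 2 * C * (X + 1) powr \<gamma> / \<eta> * (dens_const * weight \<eta>) * (dens_const * weight \<eta>)"
    using YZ \<eta> yz C_pos dens_const_ge weight_nonneg density_nonneg K_nonneg[of Y Z]
    by (intro mult_mono frac_le K_le_max density_on_interval) auto
  then have "(real (\<nu> m))\<^sup>2 * L.q m (Suc (cell (\<nu> m) y)) (Suc (cell (\<nu> m) z))
     \<le> 2 * C * (X + 1) powr \<gamma> / \<eta> * (dens_const * weight \<eta>) * (dens_const * weight \<eta>)"
    unfolding lattice_integrand_eq Y_def Z_def .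
  moreover have "0 \<le> 2 * C * (X + 1) powr \<gamma> / \<eta> * (dens_const * weight \<eta>) * (dens_const * weight \<eta>)"
    using C_pos \<eta> dens_const_ge weight_nonneg by simp
  ultimately show ?thesis unfolding lattice_integrand_def yz fst_conv snd_conv by (auto intro!: ennreal_leI)
qed

text \<open>Tightness holds on the square with sides \<open>{\<eta>..Z}\<close>. Outside it the
  first argument is small, or the partner is small, or the partner is large; a first argument beyond
  \<open>Z\<close> contributes nothing because \<open>x \<le> Z\<close>. The choice of
  \<open>\<eta>\<close> handles the first two regions and that of \<open>Z\<close> the third, for
  all large \<open>m\<close> at once.\<close>

lemma nn_integral_flux_integrand:
  assumes x: "x > 0"
  shows "(\<integral>\<^sup>+p. flux_integrand x p \<partial>(lborel \<Otimes>\<^sub>M lborel)) = ennreal (Jl x)"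
proof (rule nn_integral_eq_of_tight_limit[where I = "\<lambda>m. L.J m (cell (\<nu> m) x)" and f = "\<lambda>m. lattice_integrand x m (\<lambda>_ _. True)"])
  show "AE p in lborel \<Otimes>\<^sub>M lborel. (\<lambda>m. lattice_integrand x m (\<lambda>_ _. True) p) \<longlonglongrightarrow> flux_integrand x p"
  proof -
    have "AE p in lborel \<Otimes>\<^sub>M lborel. fst p \<noteq> 0 \<and> fst p \<noteq> x \<and> snd p \<noteq> 0 \<and> fst p + snd p \<noteq> x"
    proof (rule lborel_pair.AE_pair_measure)
      show "{p \<in> space (lborel \<Otimes>\<^sub>M lborel). fst p \<noteq> 0 \<and> fst p \<noteq> x \<and> snd p \<noteq> 0 \<and> fst p + snd p \<noteq> x} \<in> sets (lborel \<Otimes>\<^sub>M lborel)"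
        by measurable
      show "AE y in lborel. AE z in lborel. fst (y, z) \<noteq> 0 \<and> fst (y, z) \<noteq> x \<and> snd (y, z) \<noteq> 0 \<and> fst (y, z) + snd (y, z) \<noteq> x"
        using AE_lborel_singleton[of 0] AE_lborel_singleton[of x]
      proof eventually_elim
        case (elim y)
        show ?case using AE_lborel_singleton[of 0] AE_lborel_singleton[of "x - y"]
          by eventually_elim (use elim in auto)
      qed
    qed
    then show ?thesis
      by eventually_elim (use lattice_integrand_tendsto[OF x] in \<open>auto split: prod.splits\<close>)
  qed
  show "eventually (\<lambda>m. (\<integral>\<^sup>+p. lattice_integrand x m (\<lambda>_ _. True) p \<partial>(lborel \<Otimes>\<^sub>M lborel)) = ennreal (L.J m (cell (\<nu> m) x))) sequentially"
    unfolding nn_integral_lattice_integrand L.J_part_def by simp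
  fix e :: real assume e: "e > 0"
  \<comment> \<open>The coefficient of \<open>\<eta> powr \<sigma>\<close> in the sum of the bounds
    from \<open>flux_sum_small_first\<close> and \<open>flux_sum_small_second\<close>.\<close>
  define c1 where "c1 = 2 * far_const x (x / 4) + 2 * C * x powr \<gamma> * (dens_const * weight (x / 4)) * 3"
  have c1: "c1 \<ge> 0" unfolding c1_def using far_const_nonneg C_pos dens_const_ge weight_nonneg by simp
  obtain \<eta> where eta: "0 < \<eta>" "\<eta> \<le> x / 16" "c1 * \<eta> powr \<sigma> \<le> e / 2"
    using small_powr[of "e/2" c1 "x / 16"] e c1 x by auto
  define c2 where "c2 = x powr \<sigma> * (2 * C * tail_const)"
  have "((\<lambda>Z. c2 * Z powr - \<delta>) \<longlongrightarrow> c2 * 0) at_top"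
    using sd by (intro tendsto_mult tendsto_const tendsto_neg_powr filterlim_ident) auto
  then have "eventually (\<lambda>Z. c2 * Z powr - \<delta> < e / 2) at_top"
    using e by (intro order_tendstoD(2)) auto
  from eventually_happens[OF eventually_conj[OF this eventually_ge_at_top[of x]]]
  obtain Z where Z: "c2 * Z powr - \<delta> < e / 2" "x \<le> Z" by auto
  define A where "A = {\<eta>..Z} \<times> {\<eta>..Z}"
  define B where "B = 2 * C * (Z + 1) powr \<gamma> / \<eta> * (dens_const * weight \<eta>) * (dens_const * weight \<eta>)"
  show "\<exists>A B. A \<in> sets (lborel \<Otimes>\<^sub>M lborel) \<and> emeasure (lborel \<Otimes>\<^sub>M lborel) A < \<infinity> \<and>
      eventually (\<lambda>m. (\<forall>p\<in>A. lattice_integrand x m (\<lambda>_ _. True) p \<le> ennreal B) \<and>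
        (\<integral>\<^sup>+p. lattice_integrand x m (\<lambda>_ _. True) p * indicator (- A) p \<partial>(lborel \<Otimes>\<^sub>M lborel)) \<le> ennreal e) sequentially"
  proof (intro exI[of _ A] exI[of _ B] conjI)
    show "A \<in> sets (lborel \<Otimes>\<^sub>M lborel)" unfolding A_def by measurable
    have "A = cbox (\<eta>, \<eta>) (Z, Z)" unfolding A_def cbox_Pair_eq box_real(2) by (rule refl)
    then show "emeasure (lborel \<Otimes>\<^sub>M lborel) A < \<infinity>"
      using emeasure_lborel_cbox_finite[of "(\<eta>, \<eta>)" "(Z, Z)"] by (simp add: lborel_prod)
    show "eventually (\<lambda>m. (\<forall>p\<in>A. lattice_integrand x m (\<lambda>_ _. True) p \<le> ennreal B) \<and>
        (\<integral>\<^sup>+p. lattice_integrand x m (\<lambda>_ _. True) p * indicator (- A) p \<partial>(lborel \<Otimes>\<^sub>M lborel)) \<le> ennreal e) sequentially"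
      using ev_range[OF x] ev_le[OF eta(1)]
    proof eventually_elim
      case (elim m)
      define k where "k = cell (\<nu> m) x"
      define c where "c = cell (\<nu> m) \<eta>"
      define d where "d = cell (\<nu> m) Z"
      have k: "k \<le> (\<nu> m)\<^sup>2" "x / 2 \<le> L.x m k" "L.x m k \<le> x" using elim x_cell(1)[of x m] x by (auto simp: k_def)
      have c: "L.x m (Suc c) \<le> 2 * \<eta>" using x_cell(1)[of \<eta> m] eta elim by (simp add: c_def L.x_Suc)
      have d: "Z \<le> L.x m (Suc d)" using x_cell(2)[of Z m] x Z by (simp add: d_def)
      have xZ: "cell (\<nu> m) x \<le> cell (\<nu> m) y" if "Z < y" for y using that Z by (intro cell_mono) auto
      have "(\<integral>\<^sup>+p. lattice_integrand x m (\<lambda>_ _. True) p * indicator (- A) p \<partial>(lborel \<Otimes>\<^sub>M lborel))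
        \<le> (\<integral>\<^sup>+p. lattice_integrand x m (\<lambda>a b. a \<le> c) p + lattice_integrand x m (\<lambda>a b. b \<le> c) p
             + lattice_integrand x m (\<lambda>a b. d \<le> b) p \<partial>(lborel \<Otimes>\<^sub>M lborel))"
      proof (rule nn_integral_mono)
        fix p :: "real \<times> real"
        obtain y z where p: "p = (y, z)" by (cases p)
        have 1: "cell (\<nu> m) y \<le> c" if "y < \<eta>" using that unfolding c_def by (intro cell_mono) auto
        have 2: "cell (\<nu> m) z \<le> c" if "z < \<eta>" using that unfolding c_def by (intro cell_mono) auto
        have 3: "d \<le> cell (\<nu> m) z" if "Z < z" using that unfolding d_def by (intro cell_mono) auto
        have eq: "lattice_integrand x m Q (y, z) = lattice_integrand x m (\<lambda>_ _. True) (y, z)" if "Q (cell (\<nu> m) y) (cell (\<nu> m) z)" for Q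
          using that by (simp add: lattice_integrand_def)
        have "p \<in> A \<or> y < \<eta> \<or> z < \<eta> \<or> Z < y \<or> Z < z" by (simp add: A_def p) linarith
        then consider "p \<in> A" | "y < \<eta>" | "z < \<eta>" | "Z < y" | "Z < z" by blast
        then show "lattice_integrand x m (\<lambda>_ _. True) p * indicator (- A) p
           \<le> lattice_integrand x m (\<lambda>a b. a \<le> c) p + lattice_integrand x m (\<lambda>a b. b \<le> c) p + lattice_integrand x m (\<lambda>a b. d \<le> b) p"
        proof cases
          case 2
          then have "lattice_integrand x m (\<lambda>_ _. True) p = lattice_integrand x m (\<lambda>a b. a \<le> c) p" using eq[of "\<lambda>a b. a \<le> c"] 1 p by metis
          then show ?thesis by (auto simp: indicator_def add_increasing2)
        next
          case 3
          then have "lattice_integrand x m (\<lambda>_ _. True) p = lattice_integrand x m (\<lambda>a b. b \<le> c) p" using eq[of "\<lambda>a b. b \<le> c"] 2 p by metis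
          then show ?thesis by (auto simp: indicator_def add_increasing2 add_increasing)
        next
          case 4
          then have "lattice_integrand x m (\<lambda>_ _. True) p = 0" using xZ[of y] p by (simp add: lattice_integrand_def)
          then show ?thesis by simp
        next
          case 5
          then have "lattice_integrand x m (\<lambda>_ _. True) p = lattice_integrand x m (\<lambda>a b. d \<le> b) p" using eq[of "\<lambda>a b. d \<le> b"] 3 p by metis
          then show ?thesis by (auto simp: indicator_def add_increasing)
        qed simp
      qed
      also have "\<dots> = (\<integral>\<^sup>+p. lattice_integrand x m (\<lambda>a b. a \<le> c) p \<partial>(lborel \<Otimes>\<^sub>M lborel))
          + (\<integral>\<^sup>+p. lattice_integrand x m (\<lambda>a b. b \<le> c) p \<partial>(lborel \<Otimes>\<^sub>M lborel))
          + (\<integral>\<^sup>+p. lattice_integrand x m (\<lambda>a b. d \<le> b) p \<partial>(lborel \<Otimes>\<^sub>M lborel))"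
        by (simp add: nn_integral_add)
      also have "\<dots> \<le> ennreal (2 * \<eta> powr \<sigma> * far_const x (x / 4))
          + ennreal (2 * C * x powr \<gamma> * (dens_const * weight (x / 4)) * (3 * \<eta> powr \<sigma>))
          + ennreal (x powr \<sigma> * (2 * C * tail_const * Z powr - \<delta>))"
        unfolding nn_integral_lattice_integrand k_def[symmetric]
      proof (intro add_mono ennreal_leI)
        have "(\<Sum>j=1..k. \<Sum>z=1..(\<nu> m)\<^sup>2. if k < j + z \<and> j - 1 \<le> c then L.q m j z else 0)
          = (\<Sum>j=1..k. \<Sum>z=1..(\<nu> m)\<^sup>2. if k < j + z \<and> j \<le> Suc c then L.q m j z else 0)"
          by (intro sum.cong) auto
        also have "\<dots> \<le> 2 * \<eta> powr \<sigma> * far_const x (x / 4)"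
          using elim eta k c by (intro flux_sum_small_first) auto
        finally show "(\<Sum>j=1..k. \<Sum>z=1..(\<nu> m)\<^sup>2. if k < j + z \<and> j - 1 \<le> c then L.q m j z else 0) \<le> \<dots>" .
        have "(\<Sum>j=1..k. \<Sum>z=1..(\<nu> m)\<^sup>2. if k < j + z \<and> z - 1 \<le> c then L.q m j z else 0)
          = (\<Sum>j=1..k. \<Sum>z=1..(\<nu> m)\<^sup>2. if k < j + z \<and> z \<le> Suc c then L.q m j z else 0)"
          by (intro sum.cong) auto
        also have "\<dots> \<le> 2 * C * x powr \<gamma> * (dens_const * weight (x / 4)) * (3 * \<eta> powr \<sigma>)"
          using eta k c by (intro flux_sum_small_second) auto
        finally show "(\<Sum>j=1..k. \<Sum>z=1..(\<nu> m)\<^sup>2. if k < j + z \<and> z - 1 \<le> c then L.q m j z else 0) \<le> \<dots>" .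
        have "(\<Sum>j=1..k. \<Sum>z=1..(\<nu> m)\<^sup>2. if k < j + z \<and> d \<le> z - 1 then L.q m j z else 0)
          = (\<Sum>j=1..k. \<Sum>z=1..(\<nu> m)\<^sup>2. if k < j + z \<and> Suc d \<le> z then L.q m j z else 0)"
          by (intro sum.cong) auto
        also have "\<dots> \<le> x powr \<sigma> * (2 * C * tail_const * Z powr - \<delta>)"
          using x Z k d by (intro flux_sum_large_second) auto
        finally show "(\<Sum>j=1..k. \<Sum>z=1..(\<nu> m)\<^sup>2. if k < j + z \<and> d \<le> z - 1 then L.q m j z else 0) \<le> \<dots>" .
      qed
      also have "\<dots> = ennreal (2 * \<eta> powr \<sigma> * far_const x (x / 4)
          + 2 * C * x powr \<gamma> * (dens_const * weight (x / 4)) * (3 * \<eta> powr \<sigma>)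
          + x powr \<sigma> * (2 * C * tail_const * Z powr - \<delta>))"
        using far_const_nonneg C_pos dens_const_ge weight_nonneg tail_const_pos by (simp add: ennreal_plus[symmetric] del: ennreal_plus)
      also have "\<dots> = ennreal (c1 * \<eta> powr \<sigma> + c2 * Z powr - \<delta>)"
        by (simp add: c1_def c2_def algebra_simps)
      also have "\<dots> \<le> ennreal e" using eta Z by (intro ennreal_leI) auto
      finally have "(\<integral>\<^sup>+p. lattice_integrand x m (\<lambda>_ _. True) p * indicator (- A) p \<partial>(lborel \<Otimes>\<^sub>M lborel)) \<le> ennreal e" .
      moreover have "\<forall>p\<in>A. lattice_integrand x m (\<lambda>_ _. True) p \<le> ennreal B"
        unfolding A_def B_def using lattice_integrand_le[OF eta(1)] by blast
      ultimately show ?case by blast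
    qed
  qed
qed (use x J_lim L.J_part_nonneg in auto)

end

section \<open>The weak formulation\<close>

lemma set_integrable_continuous_cutoff:
  fixes g w :: "real \<Rightarrow> real"
  assumes g: "continuous_on {0..} g" "\<forall>x>R. g x = 0" and w: "w absolutely_integrable_on {0..R}"
  shows "(\<lambda>x. g x * w x) absolutely_integrable_on {0..}"
    "(LINT x:{0..}|lebesgue. g x * w x) = (LINT x:{0..R}|lebesgue. g x * w x)"
proof -
  have gR: "continuous_on {0..R} g" using g(1) by (rule continuous_on_subset) auto
  have "(\<lambda>x. g x * w x) absolutely_integrable_on {0..R}"
  proof (rule absolutely_integrable_bounded_measurable_product_real[OF _ _ _ w])
    show "g \<in> borel_measurable (lebesgue_on {0..R})"
      using gR by (rule continuous_imp_measurable_on_sets_lebesgue) auto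
    show "bounded (g ` {0..R})" using gR by (intro compact_imp_bounded compact_continuous_image) auto
  qed auto
  moreover have eq: "(\<lambda>x. indicator {0..} x *\<^sub>R (g x * w x)) = (\<lambda>x. indicator {0..R} x *\<^sub>R (g x * w x))"
    using g(2) by (auto simp: indicator_def fun_eq_iff not_le)
  ultimately show "(\<lambda>x. g x * w x) absolutely_integrable_on {0..}" by (simp add: set_integrable_def)
  show "(LINT x:{0..}|lebesgue. g x * w x) = (LINT x:{0..R}|lebesgue. g x * w x)"
    by (simp only: set_lebesgue_integral_def eq)
qed

lemma locally_integrable_onI:
  assumes "\<And>R. f absolutely_integrable_on {0..R}"
  shows "locally_integrable_on {0..} f"
  unfolding locally_integrable_on_def
proof (intro allI impI)
  fix A :: "real set" assume A: "compact A \<and> A \<subseteq> {0..}"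
  then obtain R where "\<And>x. x \<in> A \<Longrightarrow> norm x \<le> R" using compact_imp_bounded bounded_iff by metis
  then have R: "x \<le> R" if "x \<in> A" for x using that by (auto simp: abs_le_iff)
  have "A \<subseteq> {0..}" using A by blast
  with R have sub: "A \<subseteq> {0..R}" by (metis atLeastAtMost_iff atLeast_iff subset_iff)
  have "A \<in> sets lebesgue" using A by (intro sets_completionI_sets) (simp add: borel_compact)
  then show "f absolutely_integrable_on A" by (rule set_integrable_subset[OF assms[of R] _ sub])
qed

lemma C1_compact_supportE:
  assumes "C1_compact_support \<psi>"
  obtains R where "R > 0" "\<forall>x>R. \<psi> x = 0 \<and> deriv0 \<psi> x = 0"
    "\<forall>x\<ge>0. (\<psi> has_vector_derivative deriv0 \<psi> x) (at x within {0..})"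
    "continuous_on {0..} \<psi>" "continuous_on {0..} (deriv0 \<psi>)"
    "\<forall>x\<ge>0. deriv0 (\<lambda>t. t * \<psi> t) x = \<psi> x + x * deriv0 \<psi> x"
proof -
  have diff: "\<psi> differentiable_on {0..}" and cont': "continuous_on {0..} (deriv0 \<psi>)"
    and cpt: "compact (closure (support_on {0..} \<psi>))" using assms by (auto simp: C1_compact_support_def)
  from compact_imp_bounded[OF cpt] have "bounded (support_on {0..} \<psi>)"
    by (rule bounded_subset) (rule closure_subset)
  then obtain R0 where R0: "\<And>x. x \<in> support_on {0..} \<psi> \<Longrightarrow> norm x \<le> R0" by (auto simp: bounded_iff)
  define R where "R = max R0 1"
  have R: "R > 0" by (simp add: R_def)
  have z: "\<psi> x = 0" if "x > R" for x
    using R0[of x] that R by (force simp: support_on_def R_def)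
  have D: "(\<psi> has_vector_derivative deriv0 \<psi> x) (at x within {0..})" if "x \<ge> 0" for x
    unfolding deriv0_def using diff that by (auto simp: differentiable_on_def vector_derivative_works[symmetric])
  \<comment> \<open>The one-sided neighbourhood filter is nontrivial even at the origin; this makes
    the derivative unique and lets \<open>deriv0\<close> be computed.\<close>
  have nb: "at x within {0..} \<noteq> bot" if "x \<ge> 0" for x :: real
  proof -
    have "at x within {x..x + 1} \<le> at x within {0..}" using that by (intro at_le) auto
    moreover have "at x within {x..x + 1} \<noteq> bot" by (simp add: trivial_limit_within islimpt_Icc)
    ultimately show ?thesis using le_bot by fastforce
  qed
  have z': "deriv0 \<psi> x = 0" if "x > R" for x
    unfolding deriv0_def
  proof (rule vector_derivative_within[OF nb])
    show "x \<ge> 0" using that R by simp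
    have "((\<lambda>_. 0) has_vector_derivative 0) (at x)" by simp
    then have "(\<psi> has_vector_derivative 0) (at x)"
      by (rule has_vector_derivative_transform_within_open[where S = "{R<..}"]) (use that z in auto)
    then show "(\<psi> has_vector_derivative 0) (at x within {0..})" by (rule has_vector_derivative_at_within)
  qed
  have m: "deriv0 (\<lambda>t. t * \<psi> t) x = \<psi> x + x * deriv0 \<psi> x" if x: "x \<ge> 0" for x
    unfolding deriv0_def[of "\<lambda>t. t * \<psi> t"]
  proof (rule vector_derivative_within[OF nb[OF x]])
    show "((\<lambda>t. t * \<psi> t) has_vector_derivative \<psi> x + x * deriv0 \<psi> x) (at x within {0..})"
      using has_vector_derivative_mult[OF has_vector_derivative_id[of "at x within {0..}"] D[OF x]]
      by (simp add: add.commute)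
  qed
  show thesis
    using that[of R] R z z' D differentiable_imp_continuous_on[OF diff] cont' m by simp
qed

section \<open>Verification of the weak equation and of the asymptotics\<close>

context lattice_limit
begin

text \<open>\<open>Hl\<close> is prescribed only on the open half-line. The extension by
  \<open>0\<close> is the primitive of \<open>u\<close> and is continuous up to the origin.\<close>

definition H0 :: "real \<Rightarrow> real" where "H0 y = (if y > 0 then Hl y else 0)"

lemma flux_u: "flux K u x = (if x > 0 then ennreal (Jl x) else 0)"
proof (cases "x > 0")
  case True
  have "flux K u x = (\<integral>\<^sup>+y. \<integral>\<^sup>+z. flux_integrand x (y, z) \<partial>lborel \<partial>lborel)"
    unfolding flux_def nn_integral_completion
  proof (rule nn_integral_cong)
    fix y
    show "(\<integral>\<^sup>+z\<in>{x - y<..}. ennreal (K y z / z * u z * u y) \<partial>lborel) * indicator {0<..<x} y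
       = (\<integral>\<^sup>+z. flux_integrand x (y, z) \<partial>lborel)"
    proof (cases "y \<in> {0<..<x}")
      case True
      then show ?thesis by (auto simp: flux_integrand_def indicator_def intro!: nn_integral_cong)
    next
      case False
      then have "flux_integrand x (y, z) = 0" for z by (auto simp: flux_integrand_def)
      with False show ?thesis by simp
    qed
  qed
  also have "\<dots> = ennreal (Jl x)"
    using lborel.nn_integral_fst[OF flux_integrand_measurable, of x] nn_integral_flux_integrand[OF True] by simp
  finally show ?thesis using True by simp
next
  case False
  then have "{0<..<x} = {}" by auto
  then show ?thesis using False by (simp add: flux_def)
qed

lemma u_has_integral: "x > 0 \<Longrightarrow> (u has_integral Hl x) {0..x}"
proof -
  assume x: "x > 0"
  let ?f = "\<lambda>y. if y \<in> {0<..<x} then u y else 0"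
  have "(?f has_integral Hl x) UNIV"
  proof (subst has_integral_iff_nn_integral_lebesgue)
    have "(\<integral>\<^sup>+y. ennreal (?f y) \<partial>lebesgue) = (\<integral>\<^sup>+y\<in>{0<..<x}. ennreal (u y) \<partial>lborel)"
      unfolding nn_integral_completion by (intro nn_integral_cong) (auto simp: indicator_def)
    moreover have "?f \<in> borel_measurable borel" by measurable
    then have "?f \<in> lebesgue \<rightarrow>\<^sub>M borel" by (intro measurable_completion) simp
    ultimately show "?f \<in> lebesgue \<rightarrow>\<^sub>M borel \<and> (\<integral>\<^sup>+y. ennreal (?f y) \<partial>lebesgue) = ennreal (Hl x) \<and> 0 \<le> Hl x"
      using nn_integral_u[OF x] Hl_nonneg[OF x] by simp
  qed (use u_nonneg in auto)
  then have "(u has_integral Hl x) {0<..<x}" by (simp only: has_integral_restrict_UNIV)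
  then show ?thesis by (simp add: has_integral_Icc_iff_Ioo)
qed

lemma integral_u: "x \<ge> 0 \<Longrightarrow> integral {0..x} u = H0 x"
  using integral_unique[OF u_has_integral[of x]] by (cases "x = 0") (auto simp: H0_def)

lemma u_integrable: "u absolutely_integrable_on {0..R}"
proof (cases "R > 0")
  case True
  then show ?thesis
    using u_has_integral[OF True] u_nonneg by (intro nonnegative_absolutely_integrable_1) (auto simp: integrable_on_def)
next
  case False
  then have "{0..R} = {} \<or> {0..R} = {0}" by auto
  then have "u integrable_on {0..R}" using integrable_on_refl[of u 0] by auto
  then show ?thesis using u_nonneg by (intro nonnegative_absolutely_integrable_1) auto
qed

lemma H0_cont: "continuous_on {0..} H0"
proof -
  have icc: "continuous_on {0..R} H0" for R
  proof -
    have "u integrable_on {0..R}" using u_integrable set_lebesgue_integral_eq_integral(1) by blast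
    from indefinite_integral_continuous_1[OF this] show ?thesis
      by (rule continuous_on_cong[THEN iffD1, rotated 2]) (auto simp: integral_u)
  qed
  have "continuous (at x within {0..}) H0" if "x \<ge> 0" for x
  proof -
    have "continuous (at x within {0..x + 1}) H0"
      using icc[of "x + 1"] that by (simp add: continuous_on_eq_continuous_within)
    moreover have "at x within {0..x + 1} = at x within {0..}"
      by (rule at_within_nhd[of x "{..<x + 1}"]) auto
    ultimately show ?thesis by simp
  qed
  then show ?thesis by (simp add: continuous_on_eq_continuous_within)
qed

lemma H0_deriv:
  assumes "x > 0"
  shows "(H0 has_vector_derivative u x) (at x)"
proof -
  define a where "a = x / 2"
  define b where "b = x + 1"
  have ab: "0 < a" "a < x" "x < b" using assms by (auto simp: a_def b_def)
  have "continuous_on {a..b} u" using u_cont by (rule continuous_on_subset) (use ab in auto)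
  from integral_has_real_derivative[OF this, of x]
  have "((\<lambda>x. integral {a..x} u) has_real_derivative u x) (at x within {a..b})" using ab by auto
  then have "((\<lambda>x. integral {a..x} u) has_real_derivative u x) (at x)"
    using ab by (simp add: at_within_Icc_at)
  then have "((\<lambda>x. H0 a + integral {a..x} u) has_vector_derivative u x) (at x)"
    by (auto simp: has_real_derivative_iff_has_vector_derivative[symmetric] intro!: derivative_eq_intros)
  then show ?thesis
  proof (rule has_vector_derivative_transform_within_open[where S = "{a<..<b}"])
    fix y assume y: "y \<in> {a<..<b}"
    have "u integrable_on {0..y}" using u_integrable set_lebesgue_integral_eq_integral(1) by blast
    from Henstock_Kurzweil_Integration.integral_combine[OF _ _ this, of a] y ab
    have "integral {0..a} u + integral {a..y} u = integral {0..y} u" by auto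
    then show "H0 a + integral {a..y} u = H0 y" using integral_u[of a] integral_u[of y] ab y by simp
  qed (use ab in auto)
qed

text \<open>By the choice of \<open>u\<close>, the flux is
  \<open>\<beta> * (x * u x - \<sigma> * H0 x)\<close>. Inserted into the weak equation, the terms
  \<open>x * deriv0 \<psi> x * u x\<close> cancel, and what remains is
  \<open>- (\<beta> * \<sigma>)\<close> times the integral of the derivative of
  \<open>\<psi> x * H0 x\<close>. It vanishes by the compact support of \<open>\<psi>\<close> and by
  \<open>H0 0 = 0\<close>, whatever the value of \<open>\<psi>\<close> at the origin.\<close>

lemma weak_stationary_solution_u:
  assumes beta: "\<beta> = 1 / (\<rho> - \<gamma>)"
  shows "weak_stationary_solution K \<beta> \<rho> u"
proof -
  have bd: "\<beta> * \<delta> = 1" using sd by (simp add: beta)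
  have flux_eq: "enn2real (flux K u x) = \<beta> * (x * u x - \<sigma> * H0 x)" if "x \<ge> 0" for x
  proof (cases "x > 0")
    case True
    have "x * u x = \<sigma> * Hl x + \<delta> * Jl x" using True by (simp add: u_def)
    then have "\<beta> * (x * u x - \<sigma> * H0 x) = (\<beta> * \<delta>) * Jl x" using True by (simp add: H0_def)
    then show ?thesis using True Jl_nonneg bd by (simp add: flux_u)
  qed (use that in \<open>simp add: flux_u H0_def\<close>)
  have J_int: "(\<lambda>x. enn2real (flux K u x)) absolutely_integrable_on {0..R}" for R
  proof -
    have "(\<lambda>x. x * u x) absolutely_integrable_on {0..R}"
      using u_integrable[of R] by (intro absolutely_integrable_bounded_measurable_product_real
          continuous_imp_measurable_on_sets_lebesgue compact_imp_bounded compact_continuous_image continuous_intros) auto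
    moreover have "H0 absolutely_integrable_on {0..R}"
      using continuous_on_subset[OF H0_cont, of "{0..R}"] by (intro absolutely_integrable_continuous_real) auto
    ultimately have "(\<lambda>x. \<beta> * (x * u x - \<sigma> * H0 x)) absolutely_integrable_on {0..R}"
      by (intro set_integrable_mult_right set_integral_diff) auto
    then show ?thesis
      by (rule set_integrable_cong[THEN iffD1, rotated -1]) (auto simp: flux_eq)
  qed
  have weak: "(LINT x:{0..}|lebesgue. deriv0 \<psi> x * enn2real (flux K u x))
        - \<beta> * (LINT x:{0..}|lebesgue. deriv0 (\<lambda>t. t * \<psi> t) x * u x)
        + \<beta> * \<rho> * (LINT x:{0..}|lebesgue. \<psi> x * u x) = 0" if psi: "C1_compact_support \<psi>" for \<psi>
  proof -
    obtain R where R: "R > 0" and z: "\<forall>x>R. \<psi> x = 0 \<and> deriv0 \<psi> x = 0"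
      and D: "\<forall>x\<ge>0. (\<psi> has_vector_derivative deriv0 \<psi> x) (at x within {0..})"
      and cont: "continuous_on {0..} \<psi>" "continuous_on {0..} (deriv0 \<psi>)"
      and m: "\<forall>x\<ge>0. deriv0 (\<lambda>t. t * \<psi> t) x = \<psi> x + x * deriv0 \<psi> x"
      by (rule C1_compact_supportE[OF psi])
    \<comment> \<open>The vanishing is known strictly beyond \<open>R\<close>, so the endpoint
      \<open>R + 1\<close> is used, where \<open>\<psi>\<close> itself is \<open>0\<close>.\<close>
    have z': "\<forall>x>R + 1. \<psi> x = 0" "\<forall>x>R + 1. deriv0 \<psi> x = 0" using z by auto
    note c1 = set_integrable_continuous_cutoff[OF cont(2) z'(2) J_int]
    note c2 = set_integrable_continuous_cutoff[OF cont(1) z'(1) u_integrable]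
    have cm: "continuous_on {0..} (\<lambda>x. \<psi> x + x * deriv0 \<psi> x)" by (intro continuous_intros cont)
    have c3: "(\<lambda>x. (\<psi> x + x * deriv0 \<psi> x) * u x) absolutely_integrable_on {0..}"
      by (rule set_integrable_continuous_cutoff[OF cm _ u_integrable, of "R + 1"]) (use z' in auto)
    have e3: "(LINT x:{0..}|lebesgue. deriv0 (\<lambda>t. t * \<psi> t) x * u x) = (LINT x:{0..}|lebesgue. (\<psi> x + x * deriv0 \<psi> x) * u x)"
      by (rule set_lebesgue_integral_cong) (auto simp: m)
    have "(LINT x:{0..}|lebesgue. deriv0 \<psi> x * enn2real (flux K u x))
        - \<beta> * (LINT x:{0..}|lebesgue. deriv0 (\<lambda>t. t * \<psi> t) x * u x)
        + \<beta> * \<rho> * (LINT x:{0..}|lebesgue. \<psi> x * u x)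
      = (LINT x:{0..}|lebesgue. deriv0 \<psi> x * enn2real (flux K u x) - \<beta> * ((\<psi> x + x * deriv0 \<psi> x) * u x) + \<beta> * \<rho> * (\<psi> x * u x))"
    proof -
      note i2 = set_integrable_mult_right[OF c2(1), of "\<beta> * \<rho>"] and i3 = set_integrable_mult_right[OF c3, of \<beta>]
      note i13 = set_integral_diff[OF c1(1) i3]
      show ?thesis
        using set_integral_add(2)[OF i13(1) i2] i13(2) by (simp add: e3)
    qed
    also have "\<dots> = (LINT x:{0..}|lebesgue. - (\<beta> * \<sigma>) * (deriv0 \<psi> x * H0 x + \<psi> x * u x))"
      by (rule set_lebesgue_integral_cong) (auto simp: flux_eq algebra_simps)
    also have "\<dots> = - (\<beta> * \<sigma>) * (LINT x:{0..}|lebesgue. deriv0 \<psi> x * H0 x + \<psi> x * u x)"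
      by (rule set_integral_mult_right)
    also have "(LINT x:{0..}|lebesgue. deriv0 \<psi> x * H0 x + \<psi> x * u x) = 0"
    proof -
      have H0i: "H0 absolutely_integrable_on {0..R + 1}"
        using continuous_on_subset[OF H0_cont, of "{0..R + 1}"] by (intro absolutely_integrable_continuous_real) auto
      note c4 = set_integrable_continuous_cutoff[OF cont(2) z'(2) H0i]
      have sub: "f absolutely_integrable_on {0..} \<Longrightarrow> f absolutely_integrable_on {0..R + 1}" for f :: "real \<Rightarrow> real"
        by (rule set_integrable_subset) auto
      have "(LINT x:{0..}|lebesgue. deriv0 \<psi> x * H0 x + \<psi> x * u x)
        = (LINT x:{0..R + 1}|lebesgue. deriv0 \<psi> x * H0 x + \<psi> x * u x)"
        using set_integral_add(2)[OF c4(1) c2(1)] set_integral_add(2)[OF sub[OF c4(1)] sub[OF c2(1)]] c4(2) c2(2) by simp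
      also have "\<dots> = integral {0..R + 1} (\<lambda>x. deriv0 \<psi> x * H0 x + \<psi> x * u x)"
        by (rule set_lebesgue_integral_eq_integral(2)[OF set_integral_add(1)[OF sub[OF c4(1)] sub[OF c2(1)]]])
      \<comment> \<open>The fundamental theorem is used with interior derivatives: at the origin
        \<open>H0\<close> is only known to be continuous, and \<open>u\<close> may be unbounded near
        it.\<close>
      also have "\<dots> = \<psi> (R + 1) * H0 (R + 1) - \<psi> 0 * H0 0"
      proof (rule integral_unique, rule fundamental_theorem_of_calculus_interior)
        show "continuous_on {0..R + 1} (\<lambda>x. \<psi> x * H0 x)"
          by (intro continuous_intros continuous_on_subset[OF cont(1)] continuous_on_subset[OF H0_cont]) auto
        fix x assume x: "x \<in> {0<..<R + 1}"
        have "at x within {0..} = at x" using x by (intro at_within_interior) (auto simp: interior_real_atLeast)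
        then have "(\<psi> has_vector_derivative deriv0 \<psi> x) (at x)" using D[rule_format, of x] x by simp
        from has_vector_derivative_mult[OF this H0_deriv[of x]] x
        show "((\<lambda>x. \<psi> x * H0 x) has_vector_derivative deriv0 \<psi> x * H0 x + \<psi> x * u x) (at x)"
          by (simp add: add.commute)
      qed (use R in auto)
      also have "\<dots> = 0" using z by (simp add: H0_def)
      finally show ?thesis .
    qed
    finally show ?thesis by simp
  qed
  show ?thesis
    unfolding weak_stationary_solution_def
    using u_nonneg weak J_int u_integrable
    by (auto intro!: locally_integrable_onI simp: flux_u)
qed

text \<open>After division by \<open>\<sigma> * x powr - \<rho>\<close> the mass term of
  \<open>u\<close> lies between \<open>1 - B * x powr - \<delta>\<close> and \<open>1\<close>, and
  the flux term is nonnegative and of order \<open>x powr - \<delta>\<close>.\<close>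

lemma u_asymptotics: "((\<lambda>x. u x / ((1 - \<rho>) * x powr (- \<rho>))) \<longlongrightarrow> 1) at_top"
proof -
  define B where "B = flux_const * 2 powr (1 + \<delta>)"
  have p0: "((\<lambda>x::real. x powr - \<delta>) \<longlongrightarrow> 0) at_top"
    using sd by (intro tendsto_neg_powr filterlim_ident) auto
  have lo: "((\<lambda>x::real. 1 - B * x powr - \<delta>) \<longlongrightarrow> 1 - B * 0) at_top" by (intro tendsto_intros p0)
  have hi: "((\<lambda>x::real. 1 + \<delta> / \<sigma> * flux_const * x powr - \<delta>) \<longlongrightarrow> 1 + \<delta> / \<sigma> * flux_const * 0) at_top" by (intro tendsto_intros p0)
  have eq: "u x / (\<sigma> * x powr (- \<rho>)) = Hl x / x powr \<sigma> + \<delta> / \<sigma> * (Jl x / x powr \<sigma>)" if "x > 1" for x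
  proof -
    have "x * x powr - \<rho> = x powr \<sigma>" using that by (simp add: powr_mult_base)
    then have "u x / (\<sigma> * x powr (- \<rho>)) = (\<sigma> * Hl x + \<delta> * Jl x) / (\<sigma> * x powr \<sigma>)" using that by (simp add: u_def mult.left_commute)
    then show ?thesis using sd by (simp add: add_divide_distrib)
  qed
  show ?thesis
  proof (rule tendsto_sandwich)
    show "eventually (\<lambda>x. 1 - B * x powr - \<delta> \<le> u x / ((1 - \<rho>) * x powr (- \<rho>))) at_top"
      using eventually_gt_at_top[of 1]
    proof eventually_elim
      case (elim x)
      have "1 - B * x powr - \<delta> \<le> Hl x / x powr \<sigma>" using Hl_ge[OF elim] elim by (simp add: B_def field_simps)
      moreover have "0 \<le> \<delta> / \<sigma> * (Jl x / x powr \<sigma>)" using sd Jl_nonneg[of x] elim by (intro mult_nonneg_nonneg divide_nonneg_nonneg) auto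
      ultimately show ?case using eq[OF elim] by simp
    qed
    show "eventually (\<lambda>x. u x / ((1 - \<rho>) * x powr (- \<rho>)) \<le> 1 + \<delta> / \<sigma> * flux_const * x powr - \<delta>) at_top"
      using eventually_gt_at_top[of 1]
    proof eventually_elim
      case (elim x)
      have "Hl x / x powr \<sigma> \<le> 1" using Hl_le[of x] elim by (simp add: field_simps)
      moreover have "Jl x / x powr \<sigma> \<le> flux_const * x powr - \<delta>"
      proof -
        have "x powr (\<sigma> - \<delta>) = x powr \<sigma> * x powr - \<delta>" by (simp add: powr_add[symmetric])
        then show ?thesis using Jl_le[OF elim] elim by (simp add: divide_le_eq mult_ac)
      qed
      then have "\<delta> / \<sigma> * (Jl x / x powr \<sigma>) \<le> \<delta> / \<sigma> * (flux_const * x powr - \<delta>)" using sd by (intro mult_left_mono) auto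
      ultimately show ?case using eq[OF elim] by (simp add: mult.assoc)
    qed
  qed (use lo hi in simp_all)
qed

end

theorem theorem1p1:
  fixes K :: "real \<Rightarrow> real \<Rightarrow> real" and \<gamma> C \<rho> \<beta> :: real
  assumes gamma: "0 \<le> \<gamma>" "\<gamma> < 1"
    and K_cont: "continuous_on ({0<..} \<times> {0<..}) (\<lambda>(x, y). K x y)"
    and K_sym: "\<And>x y. x > 0 \<Longrightarrow> y > 0 \<Longrightarrow> K x y = K y x"
    and K_nonneg: "\<And>x y. x > 0 \<Longrightarrow> y > 0 \<Longrightarrow> K x y \<ge> 0"
    and K_hom: "\<And>a x y. a > 0 \<Longrightarrow> x > 0 \<Longrightarrow> y > 0 \<Longrightarrow> K (a * x) (a * y) = a powr \<gamma> * K x y"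
    and C_pos: "C > 0"
    and K_bound: "\<And>x y. x > 0 \<Longrightarrow> y > 0 \<Longrightarrow> K x y \<le> C * (x powr \<gamma> + y powr \<gamma>)"
    and rho: "\<gamma> < \<rho>" "\<rho> < 1"
    and beta: "\<beta> = 1 / (\<rho> - \<gamma>)"
  shows "\<exists>h :: real \<Rightarrow> real.
           weak_stationary_solution K \<beta> \<rho> h \<and>
           (\<forall>x\<ge>0. h x \<ge> 0) \<and>
           continuous_on {0<..} h \<and>
           ((\<lambda>x. h x / ((1 - \<rho>) * x powr (- \<rho>))) \<longlongrightarrow> 1) at_top"
proof -
  interpret coagulation_kernel K \<gamma> C \<rho>
    by (rule coagulation_kernel.intro) (use gamma K_cont K_nonneg C_pos K_bound rho in auto)
  obtain \<nu> h Hl Jl where "lattice_limit K \<gamma> C \<rho> \<nu> h Hl Jl"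
    using lattice_limit_exists by blast
  then interpret lattice_limit K \<gamma> C \<rho> \<nu> h Hl Jl .
  show ?thesis
    by (intro exI[of _ u] conjI allI impI weak_stationary_solution_u[OF beta] u_nonneg u_cont u_asymptotics)
qed

end
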